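(* Let $n\ge 2$, $\delta\in(0,1/2)$, let $g$ be admissible and assume $$-\infty<\liminf_{x\downarrow 0}x g(x)\le\limsup_{x\downarrow 0}x g(x)<0 .$$ Let $X$ be the market model driven by $g$ (with all $\mu_i(0)\in(0,1-\delta)$), and fix $x_0\in(0,1-\delta)$. (i) If $\displaystyle\int_{x_0}^{1-\delta}\exp\Big(\int_{x_0}^{y}A_1(z)g(z)\,dz\Big)dy<\infty$, then the market is not $\delta$-diverse. (ii) If $\displaystyle\int_{x_0}^{1-\delta}\exp\Big(\int_{x_0}^{y}A_2(z)g(z)\,dz\Big)dy=\infty$, then the market is $\delta$-diverse.
   Context: Fix an integer $n\ge 2$ and $\delta\in(0,1)$. A continuous function $g:(0,1-\delta)\to\mathbb{R}$ is called admissible if $\lim_{x\uparrow 1-\delta}g(x)=+\infty$. Let $W=(W_1,\dots,W_n)$ be an $n$-dimensional standard Brownian motion on a filtered probability space whose filtration satisfies the usual conditions and is generated by $W$. The market model driven by $g$ is an $(0,\infty)^n$-valued continuous process $X(t)=(X_1(t),\dots,X_n(t))$ satisfying $$d\log X_i(t)=-g(\mu_i(t))\,dt+dW_i(t),\qquad i=1,\dots,n,$$ where $S(t)=X_1(t)+\dots+X_n(t)$ and $\mu_i(t)=X_i(t)/S(t)$ are the market weights; the process is considered up to the first time some $\mu_i$ reaches $1-\delta$ or some $X_i$ reaches $0$. The market is called $\delta$-diverse if almost surely $\mu_i(t)<1-\delta$ for all $i=1,\dots,n$ and all $t\ge 0$ (i.e. almost surely no market weight ever reaches $1-\delta$ and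 no capitalization ever reaches $0$). Define $A_1(x)=\frac{2}{1+(n-1)^{-1}}\cdot\frac{1}{x(1-x)}$, $A_2(x)=\frac{1}{x(1-x)}$, $a_1=A_1(1-\delta)$, $a_2=A_2(1-\delta)$. *)

theory Defs
  imports "HOL-Probability.Probability"
begin

definition A1 :: "nat \<Rightarrow> real \<Rightarrow> real" where
  "A1 n x = (2 / (1 + 1 / (real n - 1))) * (1 / (x * (1 - x)))"

definition A2 :: "real \<Rightarrow> real" where
  "A2 x = 1 / (x * (1 - x))"

definition admissible :: "real \<Rightarrow> (real \<Rightarrow> real) \<Rightarrow> bool" where
  "admissible \<delta> g \<longleftrightarrow> continuous_on {0<..<1 - \<delta>} g \<and> filterlim g at_top (at_left (1 - \<delta>))"

definition std_BM :: "'a measure \<Rightarrow> nat \<Rightarrow> (nat \<Rightarrow> real \<Rightarrow> 'a \<Rightarrow> real) \<Rightarrow> bool" where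
  "std_BM M n W \<longleftrightarrow>
     prob_space M \<and>
     (\<forall>i<n. \<forall>t\<ge>0. W i t \<in> borel_measurable M) \<and>
     (AE \<omega> in M. \<forall>i<n. W i 0 \<omega> = 0 \<and> continuous_on {0..} (\<lambda>t. W i t \<omega>)) \<and>
     (\<forall>(k::nat) (ts::nat \<Rightarrow> real). 0 \<le> ts 0 \<and> (\<forall>j<k. ts j < ts (Suc j)) \<longrightarrow>
        prob_space.indep_vars M (\<lambda>_. borel)
          (\<lambda>(i, j) \<omega>. W i (ts (Suc j)) \<omega> - W i (ts j) \<omega>) ({..<n} \<times> {..<k}) \<and>
        (\<forall>i<n. \<forall>j<k. distributed M lborel (\<lambda>\<omega>. W i (ts (Suc j)) \<omega> - W i (ts j) \<omega>)
                 (\<lambda>x. ennreal (normal_density 0 (sqrt (ts (Suc j) - ts j)) x))))"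

definition BM_filtration :: "'a measure \<Rightarrow> nat \<Rightarrow> (nat \<Rightarrow> real \<Rightarrow> 'a \<Rightarrow> real) \<Rightarrow> real \<Rightarrow> 'a set set" where
  "BM_filtration M n W t =
     (\<Inter>u\<in>{t<..}. sigma_sets (space M)
        ({W i s -` B \<inter> space M | i s B. i < n \<and> 0 \<le> s \<and> s \<le> u \<and> B \<in> sets borel}
         \<union> null_sets M))"

definition total_cap :: "nat \<Rightarrow> (nat \<Rightarrow> real \<Rightarrow> 'a \<Rightarrow> real) \<Rightarrow> real \<Rightarrow> 'a \<Rightarrow> real" where
  "total_cap n X t \<omega> = (\<Sum>i<n. X i t \<omega>)"

definition mkt_weight :: "nat \<Rightarrow> (nat \<Rightarrow> real \<Rightarrow> 'a \<Rightarrow> real) \<Rightarrow> nat \<Rightarrow> real \<Rightarrow> 'a \<Rightarrow> real" where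
  "mkt_weight n X i t \<omega> = X i t \<omega> / total_cap n X t \<omega>"

text \<open>X is the market model driven by g with initial capitalizations x0, considered up to the
  first time some market weight reaches 1 - delta or some capitalization reaches 0:
  X is adapted, has continuous paths, starts at x0, and the (pathwise) equation
  log X_i(t) = log X_i(0) - int_0^t g(mu_i(s)) ds + W_i(t) holds at every time t before
  that stopping time.  After it, X is unconstrained (beyond continuity).\<close>
definition market_model ::
  "'a measure \<Rightarrow> nat \<Rightarrow> real \<Rightarrow> (real \<Rightarrow> real) \<Rightarrow> (nat \<Rightarrow> real \<Rightarrow> 'a \<Rightarrow> real)
     \<Rightarrow> (nat \<Rightarrow> real) \<Rightarrow> (nat \<Rightarrow> real \<Rightarrow> 'a \<Rightarrow> real) \<Rightarrow> bool" where
  "market_model M n \<delta> g W x0 X \<longleftrightarrow>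
     (\<forall>i<n. \<forall>t\<ge>0. \<forall>B\<in>sets borel. X i t -` B \<inter> space M \<in> BM_filtration M n W t) \<and>
     (AE \<omega> in M. \<forall>i<n. X i 0 \<omega> = x0 i \<and> continuous_on {0..} (\<lambda>t. X i t \<omega>)) \<and>
     (AE \<omega> in M. \<forall>t\<ge>0.
        (\<forall>s\<in>{0..t}. \<forall>i<n. 0 < X i s \<omega> \<and> mkt_weight n X i s \<omega> < 1 - \<delta>) \<longrightarrow>
        (\<forall>i<n. ln (X i t \<omega>) = ln (x0 i) - integral {0..t} (\<lambda>s. g (mkt_weight n X i s \<omega>)) + W i t \<omega>))"

definition delta_diverse ::
  "'a measure \<Rightarrow> nat \<Rightarrow> real \<Rightarrow> (nat \<Rightarrow> real \<Rightarrow> 'a \<Rightarrow> real) \<Rightarrow> bool" where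
  "delta_diverse M n \<delta> X \<longleftrightarrow>
     (AE \<omega> in M. \<forall>t\<ge>0. \<forall>i<n. 0 < X i t \<omega> \<and> mkt_weight n X i t \<omega> < 1 - \<delta>)"

end

theory Submission
  imports Defs
begin

text \<open>
  The stochastic part of the argument is an Euler scheme. As long as the path has stayed in a compact
  region, a time step of length \<open>h\<close> multiplies the weights by \<open>exp (- g h + \<Delta>W)\<close> and renormalizes them.
  A second-order Taylor expansion together with the independence of \<open>\<Delta>W\<close> from the past shows that
  \<open>f (\<mu> i)\<close> gains at least \<open>c h - o(h)\<close> in expectation when the generator of \<open>\<mu>\<close> maps \<open>f\<close> to a function
  \<open>\<ge> c\<close>. Summing over the grid and comparing the Euler steps with the true path gives Dynkin's
  inequality up to the last grid time spent in the region.

  The quadratic variation of \<open>ln (\<mu> i)\<close> has rate between \<open>(1 + 1/(n-1)) (1 - \<mu> i)\<^sup>2\<close> and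
  \<open>2 (1 - \<mu> i)\<^sup>2\<close>; these two extremes produce \<open>A1\<close> and \<open>A2\<close>. For (i) let \<open>f' = exp (\<integral> (A1 g\<^sup>+ + C))\<close>: the
  generator is bounded below by some \<open>c > 0\<close> on the whole state space while \<open>f\<close> is bounded, so the weights
  cannot stay below \<open>1 - \<delta>\<close> forever. For (ii) let \<open>f' = \<rho> exp (\<integral> (A2 g - C))\<close> with a ramp \<open>\<rho>\<close> vanishing
  away from \<open>1 - \<delta>\<close>: the generator is bounded above while \<open>f \<longlongrightarrow> \<infinity>\<close> at \<open>1 - \<delta>\<close>, and Fatou's lemma excludes
  that a weight reaches \<open>1 - \<delta>\<close> in finite time. That no capitalization vanishes first is a pathwise fact.
\<close>

section \<open>Weights under exponential tilting\<close>

text \<open>The constants come from one cancellation. Let \<open>q = \<mu> i\<close> and let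
  \<open>k (1 - q)\<^sup>2\<close> be the quadratic variation rate of \<open>ln q\<close>. The
  generator terms that matter near \<open>1 - \<delta>\<close> are
  \<open>- f' q (1 - q) g + f'' q\<^sup>2 (1 - q)\<^sup>2 k / 2\<close>, and they cancel when
  \<open>f'' / f' = 2 g / (k q (1 - q))\<close>; the value \<open>k = 1 + 1 / (n - 1)\<close> gives
  \<open>A1 g\<close> and \<open>k = 2\<close> gives \<open>A2 g\<close>. The constant
  \<open>C\<close> in the exponent pays for the remaining drift, in particular that of the other
  assets: a lower bound on the generator wants more curvature and an upper bound less, whence its
  two signs. The test functions exist only below \<open>1 - \<delta>\<close>, while a Gaussian step
  may overshoot any level. So expectations are taken for a smooth extension beyond a compact region,
  and the exit step is discarded afterwards. The generator bounds do not depend on the region, which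
  lets it grow in the end.\<close>

definition softmax :: "nat \<Rightarrow> nat \<Rightarrow> (nat \<Rightarrow> real) \<Rightarrow> (nat \<Rightarrow> real) \<Rightarrow> real" where
  "softmax n i p d = p i * exp (d i) / (\<Sum>j<n. p j * exp (d j))"

definition weights :: "nat \<Rightarrow> (nat \<Rightarrow> real) \<Rightarrow> bool" where
  "weights n p \<longleftrightarrow> (\<forall>j<n. 0 \<le> p j) \<and> (\<Sum>j<n. p j) = 1"

lemma weights_denom_pos:
  assumes "weights n p"
  shows "0 < (\<Sum>j<n. p j * exp (d j))"
proof -
  have nn: "\<And>j. j < n \<Longrightarrow> 0 \<le> p j" and s: "(\<Sum>j<n. p j) = 1" using assms by (auto simp: weights_def)
  have "0 \<le> (\<Sum>j<n. p j * exp (d j))" using nn by (intro sum_nonneg) auto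
  moreover have "(\<Sum>j<n. p j * exp (d j)) \<noteq> 0"
  proof
    assume "(\<Sum>j<n. p j * exp (d j)) = 0"
    then have "\<forall>j\<in>{..<n}. p j * exp (d j) = 0"
      using nn by (subst (asm) sum_nonneg_eq_0_iff) auto
    then have "(\<Sum>j<n. p j) = 0" by (intro sum.neutral) auto
    then show False using s by simp
  qed
  ultimately show ?thesis by simp
qed

lemma weights_softmax:
  assumes "weights n p"
  shows "weights n (\<lambda>j. softmax n j p d)"
  using weights_denom_pos[OF assms, of d] assms
  by (auto simp: weights_def softmax_def simp flip: sum_divide_distrib)

lemma weights_le_1:
  assumes "weights n p" "i < n" shows "0 \<le> p i" "p i \<le> 1"
proof -
  show "0 \<le> p i" using assms by (auto simp: weights_def)
  have "p i \<le> (\<Sum>j<n. p j)" using assms by (intro member_le_sum) (auto simp: weights_def)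
  then show "p i \<le> 1" using assms by (auto simp: weights_def)
qed

lemma weights_average_le:
  assumes "weights n p" "\<And>j. j < n \<Longrightarrow> \<bar>d j\<bar> \<le> R"
  shows "\<bar>\<Sum>j<n. p j * d j\<bar> \<le> R"
proof -
  have "\<bar>\<Sum>j<n. p j * d j\<bar> \<le> (\<Sum>j<n. p j * R)"
    using assms by (intro order_trans[OF sum_abs] sum_mono) (auto simp: weights_def abs_mult intro!: mult_left_mono)
  also have "\<dots> = R" using assms(1) by (simp add: weights_def flip: sum_distrib_right)
  finally show ?thesis .
qed

lemma softmax_0 [simp]: "weights n p \<Longrightarrow> softmax n i p (\<lambda>j. 0) = p i"
  by (simp add: softmax_def weights_def)

text \<open>Exponents add, as tilts act on log capitalizations. This lets an Euler step be read as
  the true step followed by a small corrective tilt, so that only the correction has to be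
  estimated.\<close>

lemma softmax_softmax:
  assumes "weights n p"
  shows "softmax n i (\<lambda>j. softmax n j p d) e = softmax n i p (\<lambda>j. d j + e j)"
proof -
  let ?D = "\<Sum>j<n. p j * exp (d j)"
  have D: "?D > 0" by (rule weights_denom_pos[OF assms])
  have "(\<Sum>j<n. p j * exp (d j) / ?D * exp (e j)) = (\<Sum>j<n. p j * exp (d j + e j)) / ?D"
    by (simp add: sum_divide_distrib exp_add algebra_simps)
  then show ?thesis using D by (simp add: softmax_def exp_add)
qed

text \<open>Along a ray of tilts the weights form an exponential family, so each weight changes at
  the rate of its own size times its deviation from the weighted mean.\<close>

lemma softmax_deriv:
  assumes "weights n p"
  shows "((\<lambda>u. softmax n i p (\<lambda>j. u * d j)) has_real_derivative
     softmax n i p (\<lambda>j. u * d j) * (d i - (\<Sum>j<n. softmax n j p (\<lambda>j. u * d j) * d j))) (at u)"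
proof -
  let ?D = "\<lambda>u. \<Sum>j<n. p j * exp (u * d j)"
  have D: "?D u > 0" by (rule weights_denom_pos[OF assms])
  have dD: "(?D has_real_derivative (\<Sum>j<n. p j * (exp (u * d j) * d j))) (at u)"
    by (rule DERIV_sum) (auto intro!: derivative_eq_intros)
  have s: "(\<Sum>j<n. softmax n j p (\<lambda>j. u * d j) * d j) = (\<Sum>j<n. p j * (exp (u * d j) * d j)) / ?D u"
    unfolding softmax_def sum_divide_distrib by (intro sum.cong) (simp_all add: mult_ac)
  have "((\<lambda>u. p i * exp (u * d i) / ?D u) has_real_derivative
     (p i * (exp (u * d i) * d i) * ?D u - p i * exp (u * d i) * (\<Sum>j<n. p j * (exp (u * d j) * d j))) / (?D u * ?D u)) (at u)"
    using D dD by (intro DERIV_divide) (auto intro!: derivative_eq_intros)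
  moreover have "(p i * (exp (u * d i) * d i) * ?D u - p i * exp (u * d i) * (\<Sum>j<n. p j * (exp (u * d j) * d j))) / (?D u * ?D u)
     = softmax n i p (\<lambda>j. u * d j) * (d i - (\<Sum>j<n. softmax n j p (\<lambda>j. u * d j) * d j))"
    unfolding s using D by (simp add: softmax_def field_simps)
  ultimately show ?thesis by (simp add: softmax_def)
qed

text \<open>Mean value theorem on the ray from \<open>0\<close> to \<open>d\<close>: the weight is
  at most 1 and the deviation from the mean at most \<open>2 * R\<close>, whatever the size of
  \<open>R\<close>.\<close>

lemma softmax_lipschitz:
  assumes "weights n p" "i < n" "\<And>j. j < n \<Longrightarrow> \<bar>d j\<bar> \<le> R"
  shows "\<bar>softmax n i p d - p i\<bar> \<le> 2 * R"
proof -
  let ?q = "\<lambda>u. softmax n i p (\<lambda>j. u * d j)"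
  obtain u where "?q 1 - ?q 0 = (1 - 0) * (?q u * (d i - (\<Sum>j<n. softmax n j p (\<lambda>j. u * d j) * d j)))"
    using MVT2[of 0 1 ?q, OF _ softmax_deriv[OF assms(1)]] by auto
  moreover have w: "weights n (\<lambda>j. softmax n j p (\<lambda>j. u * d j))" by (rule weights_softmax[OF assms(1)])
  have "\<bar>?q u * (d i - (\<Sum>j<n. softmax n j p (\<lambda>j. u * d j) * d j))\<bar> \<le> 1 * (2 * R)"
    unfolding abs_mult
  proof (rule mult_mono)
    show "\<bar>d i - (\<Sum>j<n. softmax n j p (\<lambda>j. u * d j) * d j)\<bar> \<le> 2 * R"
      using weights_average_le[of n _ d R, OF w assms(3)] assms(3)[OF assms(2)] by linarith
  qed (use weights_le_1[OF w assms(2)] in auto)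
  ultimately show ?thesis using assms(1) by simp
qed

text \<open>Taylor's formula to second order on the ray. All derivatives are polynomials in
  \<open>d i\<close> and the weighted moments of \<open>d\<close>, each bounded by the matching
  power of \<open>R\<close>, so the cubic remainder is uniform in \<open>n\<close> and
  \<open>p\<close>; the constant 10 is generous.\<close>

lemma softmax_expansion:
  assumes p: "weights n p" and i: "i < n" and R: "\<And>j. j < n \<Longrightarrow> \<bar>d j\<bar> \<le> R"
  defines "m \<equiv> \<Sum>j<n. p j * d j" and "w \<equiv> \<Sum>j<n. p j * (d j)\<^sup>2"
  shows "\<bar>softmax n i p d - p i - p i * (d i - m) - p i * ((d i - m)\<^sup>2 - w + m\<^sup>2) / 2\<bar> \<le> 10 * R ^ 3"
proof -
  have R0: "0 \<le> R" using R[OF i] by linarith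
  define q where "q j u = softmax n j p (\<lambda>j. u * d j)" for j u
  define M where "M u = (\<Sum>j<n. q j u * d j)" for u
  define V where "V u = (\<Sum>j<n. q j u * (d j)\<^sup>2)" for u
  define V3 where "V3 u = (\<Sum>j<n. q j u * (d j) ^ 3)" for u
  have dq: "(q j has_real_derivative q j u * (d j - M u)) (at u)" for j u
    using softmax_deriv[OF p] unfolding q_def M_def by blast
  have sq: "weights n (\<lambda>j. q j u)" for u unfolding q_def by (rule weights_softmax[OF p])
  have dM: "(M has_real_derivative V u - (M u)\<^sup>2) (at u)" for u
  proof -
    have "(M has_real_derivative (\<Sum>j<n. q j u * (d j - M u) * d j)) (at u)"
      unfolding M_def by (rule DERIV_sum) (use dq M_def in \<open>auto intro!: derivative_eq_intros\<close>)
    moreover have "(\<Sum>j<n. q j u * (d j - M u) * d j) = V u - M u * (\<Sum>j<n. q j u * d j)"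
      by (simp add: V_def algebra_simps power2_eq_square sum_subtractf sum_distrib_left)
    ultimately show ?thesis by (simp add: M_def power2_eq_square)
  qed
  have dV: "(V has_real_derivative V3 u - M u * V u) (at u)" for u
  proof -
    have "(V has_real_derivative (\<Sum>j<n. q j u * (d j - M u) * (d j)\<^sup>2)) (at u)"
      unfolding V_def by (rule DERIV_sum) (use dq in \<open>auto intro!: derivative_eq_intros\<close>)
    moreover have "(\<Sum>j<n. q j u * (d j - M u) * (d j)\<^sup>2) = V3 u - M u * V u"
      by (simp add: V_def V3_def algebra_simps power2_eq_square power3_eq_cube sum_subtractf sum_distrib_left)
    ultimately show ?thesis by simp
  qed
  \<comment> \<open>The second derivative of \<open>q i\<close> is \<open>q i * k\<close>: squared
    deviation minus the variance \<open>V - M\<^sup>2\<close>, which is the derivative of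
    \<open>M\<close>.\<close>
  define k where "k u = (d i - M u)\<^sup>2 - V u + (M u)\<^sup>2" for u
  define k' where "k' u = (- 2 * d i + 4 * M u) * (V u - (M u)\<^sup>2) - (V3 u - M u * V u)" for u
  have dk: "(k has_real_derivative k' u) (at u)" for u
    unfolding k_def k'_def
    by (auto intro!: derivative_eq_intros dM dV simp: algebra_simps power2_eq_square)
  define D where "D l = (if l = 0 then q i else if l = 1 then (\<lambda>u. q i u * (d i - M u))
     else if l = 2 then (\<lambda>u. q i u * k u) else (\<lambda>u. q i u * (d i - M u) * k u + q i u * k' u))" for l :: nat
  have "\<exists>t>0. t < 1 \<and> q i 1 = (\<Sum>l<3. D l 0 / fact l * 1 ^ l) + D 3 t / fact 3 * 1 ^ 3"
  proof (rule Maclaurin)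
    show "\<forall>m t. m < 3 \<and> 0 \<le> t \<and> t \<le> 1 \<longrightarrow> (D m has_real_derivative D (Suc m) t) (at t)"
    proof (intro allI impI, elim conjE)
      fix m :: nat and t :: real assume "m < 3"
      then consider "m = 0" | "m = 1" | "m = 2" by linarith
      then show "(D m has_real_derivative D (Suc m) t) (at t)"
      proof cases
        case 1 then show ?thesis using dq by (simp add: D_def)
      next
        case 2
        have "((\<lambda>u. q i u * (d i - M u)) has_real_derivative q i t * k t) (at t)"
          unfolding k_def
          by (auto intro!: derivative_eq_intros dq dM simp: algebra_simps power2_eq_square)
        then show ?thesis using 2 by (simp add: D_def)
      next
        case 3
        have "((\<lambda>u. q i u * k u) has_real_derivative q i t * (d i - M t) * k t + q i t * k' t) (at t)"
          by (auto intro!: derivative_eq_intros dq dk simp: algebra_simps power2_eq_square)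
        then show ?thesis using 3 by (simp add: D_def)
      qed
    qed
  qed (auto simp: D_def)
  then obtain t where t: "q i 1 = (\<Sum>l<3. D l 0 / fact l) + D 3 t / 6" by (auto simp: fact_numeral)
  have q0: "q j 0 = p j" for j unfolding q_def using p by (simp)
  have M0: "M 0 = m" "V 0 = w" by (simp_all add: M_def V_def m_def w_def q0)
  have "(\<Sum>l<3. D l 0 / fact l) = D 0 0 + D 1 0 + D 2 0 / 2"
    by (simp add: numeral_3_eq_3 numeral_2_eq_2)
  then have eq: "softmax n i p d - p i - p i * (d i - m) - p i * ((d i - m)\<^sup>2 - w + m\<^sup>2) / 2 = D 3 t / 6"
    using t by (simp add: D_def q0 M0 k_def) (simp add: q_def)
  have sqR: "x\<^sup>2 \<le> R\<^sup>2" if "\<bar>x\<bar> \<le> R" for x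
    using that R0 abs_le_square_iff[of x R] by simp
  have Mb: "\<bar>M t\<bar> \<le> R" unfolding M_def by (rule weights_average_le[OF sq R])
  have Vb: "\<bar>V t\<bar> \<le> R\<^sup>2" unfolding V_def
    by (rule weights_average_le[OF sq]) (use R sqR in auto)
  have V3b: "\<bar>V3 t\<bar> \<le> R ^ 3" unfolding V3_def
    by (rule weights_average_le[OF sq]) (use R in \<open>auto simp: power_abs intro!: power_mono\<close>)
  have V0: "0 \<le> V t" unfolding V_def using sq by (intro sum_nonneg) (auto simp: weights_def)
  have M2: "(M t)\<^sup>2 \<le> R\<^sup>2" using Mb by (rule sqR)
  have dm: "\<bar>d i - M t\<bar> \<le> 2 * R" using Mb R[OF i] by linarith
  have kb: "\<bar>k t\<bar> \<le> 5 * R\<^sup>2"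
  proof -
    have "(d i - M t)\<^sup>2 \<le> (2 * R)\<^sup>2" using dm R0 abs_le_square_iff[of "d i - M t" "2 * R"] by simp
    then have "(d i - M t)\<^sup>2 \<le> 4 * R\<^sup>2" by (simp add: power_mult_distrib)
    then show ?thesis unfolding k_def using V0 Vb M2 zero_le_power2[of "d i - M t"] zero_le_power2[of "M t"]
      by linarith
  qed
  have k'b: "\<bar>k' t\<bar> \<le> 8 * (R * R\<^sup>2)"
  proof -
    have 1: "\<bar>- 2 * d i + 4 * M t\<bar> \<le> 6 * R" using Mb R[OF i] by linarith
    have 2: "\<bar>V t - (M t)\<^sup>2\<bar> \<le> R\<^sup>2" using V0 Vb M2 zero_le_power2[of "M t"] by linarith
    have "\<bar>(- 2 * d i + 4 * M t) * (V t - (M t)\<^sup>2)\<bar> \<le> 6 * R * R\<^sup>2"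
      unfolding abs_mult using 1 2 by (intro mult_mono) auto
    moreover have "\<bar>M t * V t\<bar> \<le> R * R\<^sup>2"
      unfolding abs_mult using Mb Vb R0 by (intro mult_mono) auto
    moreover have "R ^ 3 = R * R\<^sup>2" by (simp add: power2_eq_square power3_eq_cube)
    ultimately show ?thesis unfolding k'_def using V3b by linarith
  qed
  have "\<bar>(d i - M t) * k t\<bar> \<le> 2 * R * (5 * R\<^sup>2)"
    unfolding abs_mult using dm kb R0 by (intro mult_mono) auto
  then have B: "\<bar>(d i - M t) * k t + k' t\<bar> \<le> 18 * R ^ 3"
    using k'b by (simp add: power2_eq_square power3_eq_cube)
  have "D 3 t = q i t * ((d i - M t) * k t + k' t)" by (simp add: D_def algebra_simps)
  then have "\<bar>D 3 t\<bar> \<le> 1 * (18 * R ^ 3)"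
    unfolding \<open>D 3 t = _\<close> abs_mult using weights_le_1[OF sq i, of t] B
    by (intro mult_mono) auto
  then show ?thesis unfolding eq using R0 by (simp add: abs_le_iff)
qed

section \<open>Second-order expansion of a function of one weight\<close>

lemma continuous_bounded_unit:
  fixes f :: "real \<Rightarrow> real"
  assumes "continuous_on {0..1} f"
  obtains B where "\<And>x. x \<in> {0..1} \<Longrightarrow> \<bar>f x\<bar> \<le> B"
proof -
  have "bounded (f ` {0..1})" using compact_imp_bounded[OF compact_continuous_image[OF assms]] by simp
  then obtain B where "\<forall>x\<in>{0..1}. \<bar>f x\<bar> \<le> B" unfolding bounded_iff by auto
  then show thesis by (intro that) blast
qed

text \<open>Gaussian increments are unbounded, so a modulus valid only for close points is of no use
  under an expectation. Far points are charged to the linear term: twice the sup bound over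
  \<open>d\<close>, times a distance of at least \<open>d\<close>, covers any oscillation.\<close>

lemma modulus_affine:
  fixes f :: "real \<Rightarrow> real"
  assumes "continuous_on {0..1} f" "0 < e"
  obtains C where "0 \<le> C" "\<And>x y. x \<in> {0..1} \<Longrightarrow> y \<in> {0..1} \<Longrightarrow> \<bar>f x - f y\<bar> \<le> e + C * \<bar>x - y\<bar>"
proof -
  have "uniformly_continuous_on {0..1} f" using assms(1) by (intro compact_uniformly_continuous) auto
  then obtain d where d: "0 < d" "\<And>x y. x \<in> {0..1} \<Longrightarrow> y \<in> {0..1} \<Longrightarrow> \<bar>x - y\<bar> < d \<Longrightarrow> \<bar>f x - f y\<bar> < e"
    using assms(2) unfolding uniformly_continuous_on_def dist_real_def by metis
  obtain B where B: "\<And>x. x \<in> {0..1} \<Longrightarrow> \<bar>f x\<bar> \<le> B"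
    using continuous_bounded_unit[OF assms(1)] by blast
  have B0: "0 \<le> B" using B[of 0] by auto
  show thesis
  proof (rule that[of "2 * B / d"])
    show "0 \<le> 2 * B / d" using B0 d by auto
    fix x y :: real assume xy: "x \<in> {0..1}" "y \<in> {0..1}"
    show "\<bar>f x - f y\<bar> \<le> e + 2 * B / d * \<bar>x - y\<bar>"
    proof (cases "\<bar>x - y\<bar> < d")
      case True
      then have "\<bar>f x - f y\<bar> < e" using d(2)[OF xy] by simp
      moreover have "0 \<le> 2 * B / d * \<bar>x - y\<bar>" using B0 d by auto
      ultimately show ?thesis by linarith
    next
      case False
      have "\<bar>f x - f y\<bar> \<le> 2 * B / d * d" using B[OF xy(1)] B[OF xy(2)] d by auto
      also have "\<dots> \<le> 2 * B / d * \<bar>x - y\<bar>" using False B0 d by (intro mult_left_mono) auto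
      finally show ?thesis using assms(2) by linarith
    qed
  qed
qed

definition kron :: "nat \<Rightarrow> nat \<Rightarrow> real" where
  "kron j l = (if j = l then 1 else 0)"

text \<open>Chain rule: the gradient at \<open>d = 0\<close> of
  \<open>d \<mapsto> f (softmax n i p d)\<close>, where \<open>f1\<close> is the derivative of
  \<open>f\<close>.\<close>

definition grad :: "(real \<Rightarrow> real) \<Rightarrow> nat \<Rightarrow> (nat \<Rightarrow> real) \<Rightarrow> nat \<Rightarrow> real" where
  "grad f1 i p j = f1 (p i) * p i * (kron j i - p j)"

text \<open>Half the Hessian, so that the second-order term is \<open>\<Sum>j l. hess j l * d j * d l\<close>.\<close>
definition hess :: "(real \<Rightarrow> real) \<Rightarrow> (real \<Rightarrow> real) \<Rightarrow> nat \<Rightarrow> (nat \<Rightarrow> real) \<Rightarrow> nat \<Rightarrow> nat \<Rightarrow> real" where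
  "hess f1 f2 i p j l = (f2 (p i) * (p i)\<^sup>2 + f1 (p i) * p i) / 2 * ((kron j i - p j) * (kron l i - p l))
     + f1 (p i) * p i / 2 * (p j * p l - kron j l * p j)"

lemma sum_kron: "i < n \<Longrightarrow> (\<Sum>j<n. kron j i * x j) = x i" "i < n \<Longrightarrow> (\<Sum>j<n. kron i j * x j) = x i"
  by (simp_all add: kron_def if_distrib[of "\<lambda>c. c * _"] cong: if_cong)

text \<open>The right-hand side is the second-order Taylor polynomial of \<open>f\<close> composed
  with the expansion of \<open>softmax\<close>. As a linear plus a quadratic form in
  \<open>d\<close>, with coefficients depending on \<open>p\<close> only, it allows expectations to
  be taken term by term.\<close>

lemma grad_hess_sum:
  assumes i: "i < n"
  defines "m \<equiv> \<lambda>p d. \<Sum>j<n. p j * d j"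
  shows "(\<Sum>j<n. grad f1 i p j * d j) + (\<Sum>j<n. \<Sum>l<n. hess f1 f2 i p j l * (d j * d l))
     = f1 (p i) * (p i * (d i - m p d)) + f1 (p i) * (p i * ((d i - m p d)\<^sup>2 - (\<Sum>j<n. p j * (d j)\<^sup>2) + (m p d)\<^sup>2) / 2)
       + f2 (p i) / 2 * (p i * (d i - m p d))\<^sup>2"
proof -
  have a: "(\<Sum>j<n. (kron j i - p j) * d j) = d i - m p d"
    by (simp add: left_diff_distrib sum_subtractf sum_kron i m_def)
  have 1: "(\<Sum>j<n. grad f1 i p j * d j) = f1 (p i) * (p i * (d i - m p d))"
    unfolding grad_def a[symmetric] by (simp add: sum_distrib_left mult_ac)
  have aa: "(\<Sum>j<n. \<Sum>l<n. ((kron j i - p j) * (kron l i - p l)) * (d j * d l)) = (d i - m p d)\<^sup>2"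
    unfolding a[symmetric] power2_eq_square sum_product by (simp add: mult_ac)
  have mm: "(\<Sum>j<n. \<Sum>l<n. p j * p l * (d j * d l)) = (m p d)\<^sup>2"
    unfolding m_def power2_eq_square sum_product by (simp add: mult_ac)
  have kk: "(\<Sum>j<n. \<Sum>l<n. kron j l * p j * (d j * d l)) = (\<Sum>j<n. p j * (d j)\<^sup>2)"
  proof (rule sum.cong[OF refl])
    fix j assume j: "j \<in> {..<n}"
    have "(\<Sum>l<n. kron j l * p j * (d j * d l)) = (\<Sum>l<n. kron j l * (p j * (d j * d l)))" by (simp add: mult_ac)
    also have "\<dots> = p j * (d j)\<^sup>2" using j by (simp add: sum_kron power2_eq_square)
    finally show "(\<Sum>l<n. kron j l * p j * (d j * d l)) = p j * (d j)\<^sup>2" .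
  qed
  have ring: "(A * u + B * (v - w)) * z = A * (u * z) + (B * (v * z) - B * (w * z))" for A B u v w z :: real
    by (simp add: algebra_simps)
  have "(\<Sum>j<n. \<Sum>l<n. hess f1 f2 i p j l * (d j * d l))
     = (\<Sum>j<n. \<Sum>l<n. (f2 (p i) * (p i)\<^sup>2 + f1 (p i) * p i) / 2 * (((kron j i - p j) * (kron l i - p l)) * (d j * d l))
       + (f1 (p i) * p i / 2 * (p j * p l * (d j * d l)) - f1 (p i) * p i / 2 * (kron j l * p j * (d j * d l))))"
    unfolding hess_def by (intro sum.cong refl ring)
  also have "\<dots> = (f2 (p i) * (p i)\<^sup>2 + f1 (p i) * p i) / 2 * (d i - m p d)\<^sup>2
     + (f1 (p i) * p i / 2 * (m p d)\<^sup>2 - f1 (p i) * p i / 2 * (\<Sum>j<n. p j * (d j)\<^sup>2))"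
    by (simp only: sum.distrib sum_subtractf sum_distrib_left[symmetric] aa mm kk)
  finally show ?thesis unfolding 1 power_mult_distrib[of "p i" "d i - m p d"] by (simp add: field_simps)
qed

text \<open>Independent components of unit variance pick out the trace, which is thus the Ito
  correction. The factor \<open>1 - 2 * p i + (\<Sum>j<n. (p j)\<^sup>2)\<close> equals
  \<open>(1 - p i)\<^sup>2\<close> plus the squares of the other weights: the quadratic variation
  rate of \<open>ln (\<mu> i)\<close>.\<close>

lemma hess_trace:
  assumes "i < n" "weights n p"
  shows "(\<Sum>j<n. hess f1 f2 i p j j)
    = f2 (p i) * (p i)\<^sup>2 / 2 * (1 - 2 * p i + (\<Sum>j<n. (p j)\<^sup>2)) + f1 (p i) * p i * ((\<Sum>j<n. (p j)\<^sup>2) - p i)"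
proof -
  have "(\<Sum>j<n. (kron j i - p j)\<^sup>2) = (\<Sum>j<n. kron j i * 1 - 2 * (kron j i * p j) + (p j)\<^sup>2)"
    by (intro sum.cong refl) (auto simp: kron_def power2_eq_square algebra_simps)
  also have "\<dots> = 1 - 2 * p i + (\<Sum>j<n. (p j)\<^sup>2)"
    using sum_kron(1)[OF assms(1), of "\<lambda>_. 1"] sum_kron(1)[OF assms(1), of p]
    by (simp add: sum.distrib sum_subtractf flip: sum_distrib_left)
  finally have 1: "(\<Sum>j<n. (kron j i - p j)\<^sup>2) = 1 - 2 * p i + (\<Sum>j<n. (p j)\<^sup>2)" .
  have 2: "(\<Sum>j<n. (p j)\<^sup>2 - p j) = (\<Sum>j<n. (p j)\<^sup>2) - 1"
    using assms(2) by (simp add: sum_subtractf weights_def)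
  have 3: "(\<Sum>j<n. hess f1 f2 i p j j) = (f2 (p i) * (p i)\<^sup>2 + f1 (p i) * p i) / 2 * (\<Sum>j<n. (kron j i - p j)\<^sup>2)
     + f1 (p i) * p i / 2 * (\<Sum>j<n. (p j)\<^sup>2 - p j)"
    by (simp add: hess_def kron_def sum.distrib sum_distrib_left power2_eq_square)
  show ?thesis unfolding 3 1 2 by (simp add: field_simps)
qed

text \<open>As \<open>f2\<close> is merely continuous, the second-order error is only small relative
  to the square of \<open>d\<close>; everything of higher order is pushed into the fourth power.
  Over a step of length \<open>h\<close> the two errors have means of order \<open>eps * h\<close>
  and \<open>h\<^sup>2\<close>. \<open>C\<close> depends on the functions and \<open>eps\<close>
  alone. Upper bounds follow by applying this to \<open>- f\<close>.\<close>

lemma one_step: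
  assumes f: "\<And>x. x \<in> {0..1} \<Longrightarrow> (f has_real_derivative f1 x) (at x)"
    and f1: "\<And>x. x \<in> {0..1} \<Longrightarrow> (f1 has_real_derivative f2 x) (at x)"
    and f2: "continuous_on {0..1} f2" and eps: "0 < eps"
  obtains C where "0 \<le> C" "\<And>n i p d. weights n p \<Longrightarrow> i < n \<Longrightarrow>
     f (p i) + (\<Sum>j<n. grad f1 i p j * d j) + (\<Sum>j<n. \<Sum>l<n. hess f1 f2 i p j l * (d j * d l))
       - eps * (\<Sum>j<n. (d j)\<^sup>2) - C * (\<Sum>j<n. (d j)\<^sup>2)\<^sup>2 \<le> f (softmax n i p d)"
proof -
  \<comment> \<open>Three shares: the modulus of \<open>f2\<close> costs two of them, through the
    factor \<open>4 * R\<^sup>2 / 2\<close>, and splitting the cubic terms costs the third.\<close>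
  define e where "e = eps / 3"
  have e: "0 < e" using eps by (simp add: e_def)
  obtain C1 where C1: "0 \<le> C1" "\<And>x y. x \<in> {0..1} \<Longrightarrow> y \<in> {0..1} \<Longrightarrow> \<bar>f2 x - f2 y\<bar> \<le> e + C1 * \<bar>x - y\<bar>"
    using modulus_affine[OF f2 e] by blast
  have cf1: "continuous_on {0..1} f1"
    using f1 by (intro continuous_at_imp_continuous_on ballI) (blast intro: DERIV_isCont)
  obtain B1 where B1: "\<And>x. x \<in> {0..1} \<Longrightarrow> \<bar>f1 x\<bar> \<le> B1"
    using continuous_bounded_unit[OF cf1] by blast
  obtain B2 where B2: "\<And>x. x \<in> {0..1} \<Longrightarrow> \<bar>f2 x\<bar> \<le> B2"
    using continuous_bounded_unit[OF f2] by blast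
  define B where "B = max B1 B2"
  have B: "\<bar>f1 x\<bar> \<le> B" "\<bar>f2 x\<bar> \<le> B" if "x \<in> {0..1}" for x using B1[OF that] B2[OF that] by (auto simp: B_def)
  have B0: "0 \<le> B" using B(1)[of 0] by auto
  \<comment> \<open>All cubic coefficients together: \<open>10 * B\<close> from \<open>f1\<close>,
    \<open>6 * B\<close> from \<open>f2\<close>, and \<open>4 * C1\<close> from the linear part of
    the modulus.\<close>
  define C2 where "C2 = 16 * B + 4 * C1"
  have C20: "0 \<le> C2" using B0 C1 by (simp add: C2_def)
  show thesis
  proof (rule that[of "20 * B + C2\<^sup>2 / (4 * e)"])
    show "0 \<le> 20 * B + C2\<^sup>2 / (4 * e)" using B0 e by auto
    fix n i p d assume p: "weights n p" and i: "i < n"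
    define r where "r = (\<Sum>j<n. (d j :: real)\<^sup>2)"
    define R where "R = sqrt r"
    have r0: "0 \<le> r" unfolding r_def by (intro sum_nonneg) auto
    have R0: "0 \<le> R" and R2: "R\<^sup>2 = r" using r0 by (auto simp: R_def)
    have dR: "\<bar>d j\<bar> \<le> R" if "j < n" for j
    proof -
      have "(d j)\<^sup>2 \<le> r" unfolding r_def using that by (intro member_le_sum) auto
      then show ?thesis unfolding R_def by (intro real_le_rsqrt) simp
    qed
    define m where "m = (\<Sum>j<n. p j * d j)"
    define w where "w = (\<Sum>j<n. p j * (d j)\<^sup>2)"
    define q where "q = softmax n i p d"
    define D where "D = q - p i"
    define lin where "lin = p i * (d i - m)"
    define quad where "quad = p i * ((d i - m)\<^sup>2 - w + m\<^sup>2) / 2"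
    have exp: "\<bar>D - lin - quad\<bar> \<le> 10 * R ^ 3"
      using softmax_expansion[of n p i d R, OF p i dR] unfolding D_def lin_def quad_def q_def m_def w_def by simp
    have DR: "\<bar>D\<bar> \<le> 2 * R" unfolding D_def q_def by (rule softmax_lipschitz[of n p i d R, OF p i dR])
    have pi: "p i \<in> {0..1}" using weights_le_1[OF p i] by auto
    have qi: "q \<in> {0..1}" using weights_le_1[OF weights_softmax[OF p] i] by (auto simp: q_def)
    have mR: "\<bar>m\<bar> \<le> R" unfolding m_def by (rule weights_average_le[of n p d R, OF p dR])
    have sqR: "x\<^sup>2 \<le> y\<^sup>2" if "\<bar>x\<bar> \<le> y" for x y :: real
      using that abs_le_square_iff[of x y] by simp
    have wR: "\<bar>w\<bar> \<le> R\<^sup>2" unfolding w_def by (rule weights_average_le[OF p]) (use dR sqR in auto)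
    have dm: "\<bar>d i - m\<bar> \<le> 2 * R" using mR dR[OF i] by linarith
    have linR: "\<bar>lin\<bar> \<le> 2 * R"
      using mult_mono[of "p i" 1 "\<bar>d i - m\<bar>" "2 * R"] pi dm by (auto simp: lin_def abs_mult)
    have quadR: "\<bar>quad\<bar> \<le> 3 * R\<^sup>2"
    proof -
      have "(d i - m)\<^sup>2 \<le> 4 * R\<^sup>2" using sqR[OF dm] by (simp add: power_mult_distrib)
      moreover have "m\<^sup>2 \<le> R\<^sup>2" by (rule sqR[OF mR])
      ultimately have k: "\<bar>(d i - m)\<^sup>2 - w + m\<^sup>2\<bar> \<le> 6 * R\<^sup>2"
        using wR zero_le_power2[of "d i - m"] zero_le_power2[of m] by linarith
      then show ?thesis
        using mult_mono[of "p i" 1 "\<bar>(d i - m)\<^sup>2 - w + m\<^sup>2\<bar>" "6 * R\<^sup>2"] pi by (auto simp: quad_def abs_mult)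
    qed
    have "\<bar>D - lin\<bar> \<le> 3 * R\<^sup>2 + 10 * R ^ 3" using exp quadR by linarith
    moreover have "\<bar>D + lin\<bar> \<le> 4 * R" using DR linR by linarith
    ultimately have "\<bar>D - lin\<bar> * \<bar>D + lin\<bar> \<le> (3 * R\<^sup>2 + 10 * R ^ 3) * (4 * R)"
      using R0 by (intro mult_mono) auto
    moreover have "\<bar>D\<^sup>2 - lin\<^sup>2\<bar> = \<bar>D - lin\<bar> * \<bar>D + lin\<bar>"
      by (simp add: power2_eq_square algebra_simps flip: abs_mult)
    moreover have "(3 * R\<^sup>2 + 10 * R ^ 3) * (4 * R) = 12 * R ^ 3 + 40 * R ^ 4"
      by (simp add: algebra_simps power2_eq_square power3_eq_cube power4_eq_xxxx)
    ultimately have sq: "\<bar>D\<^sup>2 - lin\<^sup>2\<bar> \<le> 12 * R ^ 3 + 40 * R ^ 4" by linarith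
    \<comment> \<open>Lagrange form of the remainder; Taylor's theorem wants two distinct points, so
      the degenerate step is treated apart.\<close>
    obtain x where x: "x \<in> {0..1}" "\<bar>x - p i\<bar> \<le> \<bar>D\<bar>" "f q = f (p i) + f1 (p i) * D + f2 x / 2 * D\<^sup>2"
    proof (cases "q = p i")
      case True
      then show ?thesis using pi that[of "p i"] by (simp add: D_def)
    next
      case False
      define df where "df k = (if k = 0 then f else if k = 1 then f1 else f2)" for k :: nat
      have "\<exists>t. (if q < p i then q < t \<and> t < p i else p i < t \<and> t < q) \<and>
         f q = (\<Sum>m<2. df m (p i) / fact m * (q - p i) ^ m) + df 2 t / fact 2 * (q - p i) ^ 2"
        by (rule Taylor[where a=0 and b=1]) (use False pi qi f f1 in \<open>auto simp: df_def less_2_cases_iff\<close>)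
      then obtain t where t: "if q < p i then q < t \<and> t < p i else p i < t \<and> t < q"
        "f q = (\<Sum>m<2. df m (p i) / fact m * (q - p i) ^ m) + df 2 t / fact 2 * (q - p i) ^ 2" by blast
      show ?thesis
        by (rule that[of t]) (use t pi qi in \<open>auto simp: D_def df_def numeral_2_eq_2 split: if_splits\<close>)
    qed
    have "C1 * \<bar>x - p i\<bar> \<le> C1 * (2 * R)" using x(2) DR C1 by (intro mult_left_mono) auto
    then have f2x: "\<bar>f2 x - f2 (p i)\<bar> \<le> e + 2 * C1 * R" using C1(2)[OF x(1) pi] by linarith
    have t1: "\<bar>f1 (p i) * (D - lin - quad)\<bar> \<le> B * (10 * R ^ 3)"
      unfolding abs_mult using B(1)[OF pi] exp B0 by (intro mult_mono) auto
    have "D\<^sup>2 \<le> 4 * R\<^sup>2" using sqR[OF DR] by (simp add: power_mult_distrib)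
    then have t2: "\<bar>(f2 x - f2 (p i)) * D\<^sup>2\<bar> \<le> (e + 2 * C1 * R) * (4 * R\<^sup>2)"
      unfolding abs_mult using f2x R0 e C1 by (intro mult_mono) auto
    have t3: "\<bar>f2 (p i) * (D\<^sup>2 - lin\<^sup>2)\<bar> \<le> B * (12 * R ^ 3 + 40 * R ^ 4)"
      unfolding abs_mult using B(2)[OF pi] sq B0 by (intro mult_mono) auto
    \<comment> \<open>Young's inequality trades the cubic term for a small multiple of the square
      and a large multiple of the fourth power.\<close>
    have "C2 * R ^ 3 \<le> e * R\<^sup>2 + C2\<^sup>2 / (4 * e) * R ^ 4"
    proof -
      have "0 \<le> (2 * e * R - C2 * R\<^sup>2)\<^sup>2 / (4 * e)" using e by auto
      also have "\<dots> = e * R\<^sup>2 + C2\<^sup>2 / (4 * e) * R ^ 4 - C2 * R ^ 3"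
        using e by (simp add: field_simps power2_eq_square power3_eq_cube power4_eq_xxxx)
      finally show ?thesis by linarith
    qed
    moreover have "f q - f (p i) - f1 (p i) * lin - f1 (p i) * quad - f2 (p i) / 2 * lin\<^sup>2
       = f1 (p i) * (D - lin - quad) + (f2 x - f2 (p i)) * D\<^sup>2 / 2 + f2 (p i) * (D\<^sup>2 - lin\<^sup>2) / 2"
      unfolding x(3) by (simp add: field_simps)
    moreover have "B * (10 * R ^ 3) + (e + 2 * C1 * R) * (4 * R\<^sup>2) / 2 + B * (12 * R ^ 3 + 40 * R ^ 4) / 2
       = 2 * e * R\<^sup>2 + C2 * R ^ 3 + 20 * B * R ^ 4"
      by (simp add: C2_def field_simps power2_eq_square power3_eq_cube)
    ultimately have "f (p i) + f1 (p i) * lin + f1 (p i) * quad + f2 (p i) / 2 * lin\<^sup>2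
        - 3 * e * R\<^sup>2 - (20 * B + C2\<^sup>2 / (4 * e)) * R ^ 4 \<le> f q"
    proof -
      assume a: "C2 * R ^ 3 \<le> e * R\<^sup>2 + C2\<^sup>2 / (4 * e) * R ^ 4"
        and b: "f q - f (p i) - f1 (p i) * lin - f1 (p i) * quad - f2 (p i) / 2 * lin\<^sup>2
          = f1 (p i) * (D - lin - quad) + (f2 x - f2 (p i)) * D\<^sup>2 / 2 + f2 (p i) * (D\<^sup>2 - lin\<^sup>2) / 2"
        and c: "B * (10 * R ^ 3) + (e + 2 * C1 * R) * (4 * R\<^sup>2) / 2 + B * (12 * R ^ 3 + 40 * R ^ 4) / 2
          = 2 * e * R\<^sup>2 + C2 * R ^ 3 + 20 * B * R ^ 4"
      have arith: "F0 + l + k + s - 3 * z - (Y + Q) \<le> F1"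
        if "\<bar>u1\<bar> \<le> b1" "\<bar>u2\<bar> \<le> b2" "\<bar>u3\<bar> \<le> b3" "X \<le> z + Q" "F1 - F0 - l - k - s = u1 + u2 / 2 + u3 / 2"
          "b1 + b2 / 2 + b3 / 2 = 2 * z + X + Y" for F0 F1 l k s z Y Q u1 u2 u3 b1 b2 b3 X :: real
        using that by linarith
      show ?thesis unfolding distrib_right[of "20 * B"] mult.assoc[of 3]
        by (rule arith[OF t1 t2 t3 a b]) (use c in \<open>simp only: mult.assoc[of 2]\<close>)
    qed
    moreover have "R ^ 4 = r\<^sup>2" unfolding R2[symmetric] by (simp flip: power_mult)
    moreover have "f1 (p i) * lin + f1 (p i) * quad + f2 (p i) / 2 * lin\<^sup>2
      = (\<Sum>j<n. grad f1 i p j * d j) + (\<Sum>j<n. \<Sum>l<n. hess f1 f2 i p j l * (d j * d l))"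
      unfolding grad_hess_sum[OF i] lin_def quad_def m_def w_def by simp
    ultimately show "f (p i) + (\<Sum>j<n. grad f1 i p j * d j) + (\<Sum>j<n. \<Sum>l<n. hess f1 f2 i p j l * (d j * d l))
       - eps * (\<Sum>j<n. (d j)\<^sup>2) - (20 * B + C2\<^sup>2 / (4 * e)) * (\<Sum>j<n. (d j)\<^sup>2)\<^sup>2 \<le> f (softmax n i p d)"
      by (simp add: R2 e_def flip: r_def q_def)
  qed
qed

section \<open>Increments of Brownian motion\<close>

locale brownian = prob_space M for M :: "'a measure" +
  fixes n :: nat and W :: "nat \<Rightarrow> real \<Rightarrow> 'a \<Rightarrow> real"
  assumes BM: "std_BM M n W"
begin

text \<open>The completed natural filtration of \<open>W\<close> without right limits. Independence
  of later increments is within direct reach for it, whereas \<open>BM_filtration\<close> looks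
  infinitesimally ahead; path continuity of \<open>X\<close> will bridge the gap.\<close>

definition past :: "real \<Rightarrow> 'a measure" where
  "past t = sigma (space M)
     ({W i s -` B \<inter> space M | i s B. i < n \<and> 0 \<le> s \<and> s \<le> t \<and> B \<in> sets borel} \<union> null_sets M)"

definition incr :: "real \<Rightarrow> real \<Rightarrow> nat \<Rightarrow> 'a \<Rightarrow> real" where
  "incr s t j \<omega> = W j t \<omega> - W j s \<omega>"

lemma W_measurable [measurable]: "i < n \<Longrightarrow> 0 \<le> t \<Longrightarrow> W i t \<in> borel_measurable M"
  using BM by (auto simp: std_BM_def)

lemma incr_measurable [measurable]:
  "i < n \<Longrightarrow> 0 \<le> s \<Longrightarrow> 0 \<le> t \<Longrightarrow> incr s t i \<in> borel_measurable M"
  unfolding incr_def by measurable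

lemma W_paths: "AE \<omega> in M. \<forall>i<n. W i 0 \<omega> = 0 \<and> continuous_on {0..} (\<lambda>t. W i t \<omega>)"
  using BM by (auto simp: std_BM_def)

lemma indep_increments:
  assumes "0 \<le> ts 0" "\<And>j. j < k \<Longrightarrow> ts j < ts (Suc j)"
  shows "indep_vars (\<lambda>_. borel) (\<lambda>(i, j) \<omega>. W i (ts (Suc j)) \<omega> - W i (ts j) \<omega>) ({..<n} \<times> {..<k})"
  using BM assms by (auto simp: std_BM_def)

lemma increment_distributed:
  assumes "0 \<le> s" "s < t" "i < n"
  shows "distributed M lborel (incr s t i) (\<lambda>x. ennreal (normal_density 0 (sqrt (t - s)) x))"
proof -
  define ts where "ts j = (if j = 0 then s else t)" for j :: nat
  have "\<forall>i<n. \<forall>j<1. distributed M lborel (\<lambda>\<omega>. W i (ts (Suc j)) \<omega> - W i (ts j) \<omega>)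
                 (\<lambda>x. ennreal (normal_density 0 (sqrt (ts (Suc j) - ts j)) x))"
    using BM assms(1,2) unfolding std_BM_def
    by (elim conjE allE[where x=1] allE[where x=ts]) (auto simp: ts_def)
  then show ?thesis using assms(3) by (auto simp: ts_def incr_def[abs_def])
qed

lemma space_past [simp]: "space (past t) = space M"
  by (simp add: past_def space_measure_of_conv)

lemma past_gen_subset:
  "{W i s -` B \<inter> space M | i s B. i < n \<and> 0 \<le> s \<and> s \<le> t \<and> B \<in> sets borel} \<union> null_sets M \<subseteq> sets M"
  by (auto intro!: measurable_sets)

lemma sets_past: "sets (past t) = sigma_sets (space M)
     ({W i s -` B \<inter> space M | i s B. i < n \<and> 0 \<le> s \<and> s \<le> t \<and> B \<in> sets borel} \<union> null_sets M)"
  unfolding past_def using past_gen_subset[of t] sets.space_closed[of M]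
  by (intro sets_measure_of) (rule order_trans)

lemma past_subset: "sets (past t) \<subseteq> sets M"
  unfolding sets_past by (rule sets.sigma_sets_subset[OF past_gen_subset])

lemma past_measurable_imp: "f \<in> measurable (past t) N \<Longrightarrow> f \<in> measurable M N"
  using past_subset by (auto simp: measurable_def)

lemma past_mono: "s \<le> t \<Longrightarrow> sets (past s) \<subseteq> sets (past t)"
  unfolding sets_past by (rule sigma_sets_mono') (auto; blast intro: order_trans)

lemma null_in_past: "N \<in> null_sets M \<Longrightarrow> N \<in> sets (past t)"
  unfolding sets_past by auto

text \<open>On the exceptional null set the preimage under \<open>g\<close> is a measurable subset
  of a null set, hence itself a generator of \<open>past t\<close>. Since \<open>M\<close> need not
  be complete, this rests on the measurability of \<open>g\<close> in \<open>M\<close>.\<close>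

lemma past_complete:
  assumes f: "f \<in> measurable (past t) N" and g: "g \<in> measurable M N" and ae: "AE \<omega> in M. f \<omega> = g \<omega>"
  shows "g \<in> measurable (past t) N"
proof (rule measurableI)
  fix x assume "x \<in> space (past t)" then show "g x \<in> space N" using g by (auto simp: measurable_def)
next
  fix A assume A: "A \<in> sets N"
  obtain Z where Z: "{\<omega>\<in>space M. f \<omega> \<noteq> g \<omega>} \<subseteq> Z" "Z \<in> null_sets M"
    using ae by (auto simp: eventually_ae_filter)
  have "f -` A \<inter> space M \<in> sets (past t)" using measurable_sets[OF f A] by simp
  moreover have "Z \<in> sets (past t)" by (rule null_in_past[OF Z(2)])
  moreover have "(g -` A \<inter> space M) \<inter> Z \<in> sets (past t)"
    by (rule null_in_past) (use Z(2) measurable_sets[OF g A] in \<open>auto intro: null_set_Int1 null_set_Int2\<close>)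
  moreover have "g -` A \<inter> space M = ((f -` A \<inter> space M) - Z) \<union> ((g -` A \<inter> space M) \<inter> Z)"
    using Z(1) by auto
  ultimately show "g -` A \<inter> space (past t) \<in> sets (past t)"
    using sets.Un sets.Diff by (metis space_past)
qed

text \<open>Independence of increments is given along increasing times, so a finite set of past
  times is completed to a grid. It starts at 0, so that values of \<open>W\<close> become sums of
  increments, and ends with \<open>t\<close> and \<open>t'\<close>, so that the increment of
  interest is the last one.\<close>

lemma grid_exists:
  assumes "finite S" "S \<subseteq> {0..t}" "0 \<le> t" "t < t'"
  obtains k :: nat and ts :: "nat \<Rightarrow> real" where
    "ts 0 = 0" "\<And>j. j < Suc k \<Longrightarrow> ts j < ts (Suc j)" "ts k = t" "ts (Suc k) = t'"
    "S \<subseteq> ts ` {..k}"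
proof -
  define T where "T = insert 0 (insert t S)"
  define L where "L = sorted_list_of_set T"
  have T: "finite T" "T \<noteq> {}" "T \<subseteq> {0..t}" "0 \<in> T" "t \<in> T" "S \<subseteq> T" using assms by (auto simp: T_def)
  have L: "sorted_wrt (<) L" "set L = T" using T by (auto simp: L_def)
  then have Lne: "L \<noteq> []" using T(2) by auto
  define k where "k = length L - 1"
  have lk: "length L = Suc k" using Lne by (simp add: k_def)
  define ts where "ts j = (if j \<le> k then L ! j else t')" for j
  have mono: "i < j \<Longrightarrow> j \<le> k \<Longrightarrow> L ! i < L ! j" for i j
    using sorted_wrt_nth_less[OF L(1)] lk by auto
  have mono': "i \<le> j \<Longrightarrow> j \<le> k \<Longrightarrow> L ! i \<le> L ! j" for i j
    using mono[of i j] by (cases "i = j") auto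
  have inT: "j \<le> k \<Longrightarrow> L ! j \<in> T" for j using L(2) lk by (metis le_imp_less_Suc nth_mem)
  have ex: "\<And>x. x \<in> T \<Longrightarrow> \<exists>j\<le>k. L ! j = x" using L(2) lk by (metis in_set_conv_nth less_Suc_eq_le)
  have "L ! 0 = 0" using ex[OF T(4)] mono'[of 0] inT[of 0] T(3) by fastforce
  moreover have "L ! k = t"
  proof -
    obtain j where "j \<le> k" "L ! j = t" using ex[OF T(5)] by auto
    then have "t \<le> L ! k" using mono'[of j k] by auto
    then show ?thesis using inT[of k] T(3) by fastforce
  qed
  ultimately have ends: "L ! 0 = 0" "L ! k = t" by auto
  show thesis
  proof (rule that[of ts k])
    show "ts 0 = 0" "ts k = t" "ts (Suc k) = t'" using ends by (auto simp: ts_def)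
    show "ts j < ts (Suc j)" if "j < Suc k" for j
    proof (cases "j = k")
      case True then show ?thesis using ends assms(4) by (simp add: ts_def)
    next
      case False then show ?thesis using that mono[of j "Suc j"] by (simp add: ts_def)
    qed
    show "S \<subseteq> ts ` {..k}"
    proof
      fix x assume "x \<in> S"
      then obtain j where "j \<le> k" "L ! j = x" using ex T(6) by blast
      then show "x \<in> ts ` {..k}" by (auto simp: ts_def image_iff intro!: bexI[of _ j])
    qed
  qed
qed

text \<open>A pi-system whose generated sigma-algebra contains \<open>past t\<close>: events
  decided, up to a null set, by finitely many earlier values of \<open>W\<close>. The almost sure
  formulation admits the null events, with \<open>S = {}\<close>.\<close>

definition cyl :: "real \<Rightarrow> 'a set set" where
  "cyl t = {B \<in> sets M. \<exists>S C. finite S \<and> S \<subseteq> {0..t} \<and> C \<in> sets (PiM ({..<n} \<times> S) (\<lambda>_. borel)) \<and>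
     (AE \<omega> in M. \<omega> \<in> B \<longleftrightarrow> (\<lambda>(i, s)\<in>{..<n} \<times> S. W i s \<omega>) \<in> C)}"

lemma cyl_gen: "{W i s -` B \<inter> space M | i s B. i < n \<and> 0 \<le> s \<and> s \<le> t \<and> B \<in> sets borel} \<union> null_sets M \<subseteq> cyl t"
proof (intro Un_least subsetI)
  fix A assume "A \<in> {W i s -` B \<inter> space M | i s B. i < n \<and> 0 \<le> s \<and> s \<le> t \<and> B \<in> sets borel}"
  then obtain i s B where A: "A = W i s -` B \<inter> space M" "i < n" "0 \<le> s" "s \<le> t" "B \<in> sets borel" by blast
  let ?P = "PiM ({..<n} \<times> {s}) (\<lambda>_. borel :: real measure)"
  have "(\<lambda>x. x (i, s)) \<in> borel_measurable ?P" using A by (intro measurable_component_singleton) auto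
  then have C: "(\<lambda>x. x (i, s)) -` B \<inter> space ?P \<in> sets ?P" using A by (intro measurable_sets)
  show "A \<in> cyl t" unfolding cyl_def
    using A C by (intro CollectI conjI exI[of _ "{s}"] exI[of _ "(\<lambda>x. x (i, s)) -` B \<inter> space ?P"])
      (auto intro!: measurable_sets AE_I2 simp: space_PiM PiE_def extensional_def restrict_def)
next
  fix N assume N: "N \<in> null_sets M"
  show "N \<in> cyl t" unfolding cyl_def
    using N AE_not_in[OF N] by (intro CollectI conjI exI[of _ "{}"]) auto
qed

lemma Int_stable_cyl: "Int_stable (cyl t)"
proof (rule Int_stableI)
  fix A B assume "A \<in> cyl t" "B \<in> cyl t"
  then obtain S C S' C' where A: "A \<in> sets M" "finite S" "S \<subseteq> {0..t}" "C \<in> sets (PiM ({..<n} \<times> S) (\<lambda>_. borel))"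
      "AE \<omega> in M. \<omega> \<in> A \<longleftrightarrow> (\<lambda>(i, s)\<in>{..<n} \<times> S. W i s \<omega>) \<in> C"
    and B: "B \<in> sets M" "finite S'" "S' \<subseteq> {0..t}" "C' \<in> sets (PiM ({..<n} \<times> S') (\<lambda>_. borel))"
      "AE \<omega> in M. \<omega> \<in> B \<longleftrightarrow> (\<lambda>(i, s)\<in>{..<n} \<times> S'. W i s \<omega>) \<in> C'"
    unfolding cyl_def by auto
  let ?P = "PiM ({..<n} \<times> (S \<union> S')) (\<lambda>_. borel :: real measure)"
  let ?D = "((\<lambda>x. restrict x ({..<n} \<times> S)) -` C \<inter> space ?P) \<inter> ((\<lambda>x. restrict x ({..<n} \<times> S')) -` C' \<inter> space ?P)"
  have D: "?D \<in> sets ?P"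
    by (intro sets.Int measurable_sets[OF measurable_restrict_subset] A B) auto
  have r: "restrict (\<lambda>(i, s)\<in>{..<n} \<times> (S \<union> S'). W i s \<omega>) ({..<n} \<times> S) = (\<lambda>(i, s)\<in>{..<n} \<times> S. W i s \<omega>)"
    "restrict (\<lambda>(i, s)\<in>{..<n} \<times> (S \<union> S'). W i s \<omega>) ({..<n} \<times> S') = (\<lambda>(i, s)\<in>{..<n} \<times> S'. W i s \<omega>)" for \<omega>
    by (auto simp: fun_eq_iff)
  have "AE \<omega> in M. \<omega> \<in> A \<inter> B \<longleftrightarrow> (\<lambda>(i, s)\<in>{..<n} \<times> (S \<union> S'). W i s \<omega>) \<in> ?D"
    using A(5) B(5) by eventually_elim (auto simp: r space_PiM simp del: restrict_restrict)
  with A B D show "A \<inter> B \<in> cyl t" unfolding cyl_def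
    by (intro CollectI conjI exI[of _ "S \<union> S'"] exI[of _ ?D]) auto
qed

abbreviation incr_vec :: "real \<Rightarrow> real \<Rightarrow> 'a \<Rightarrow> nat \<Rightarrow> real" where
  "incr_vec s t \<omega> \<equiv> (\<lambda>j\<in>{..<n}. incr s t j \<omega>)"

lemma incr_vec_measurable: "0 \<le> s \<Longrightarrow> 0 \<le> t \<Longrightarrow> incr_vec s t \<in> measurable M (PiM {..<n} (\<lambda>_. borel))"
  by (intro measurable_restrict) auto

text \<open>On a grid through the times of the cylinder event, the event depends on the columns
  before \<open>k\<close> of the array of increments and the new increment on column
  \<open>k\<close>; disjoint blocks of an independent family are independent.\<close>

lemma indep_cyl_increment:
  assumes t: "0 \<le> t" "t < t'" and A: "A \<in> cyl t" and D: "D \<in> sets (PiM {..<n} (\<lambda>_. borel))"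
  shows "prob (A \<inter> (incr_vec t t' -` D \<inter> space M)) = prob A * prob (incr_vec t t' -` D \<inter> space M)"
proof -
  obtain S C where A: "A \<in> sets M" "finite S" "S \<subseteq> {0..t}" "C \<in> sets (PiM ({..<n} \<times> S) (\<lambda>_. borel))"
      "AE \<omega> in M. \<omega> \<in> A \<longleftrightarrow> (\<lambda>(i, s)\<in>{..<n} \<times> S. W i s \<omega>) \<in> C"
    using A unfolding cyl_def by auto
  obtain k ts where ts: "ts 0 = 0" "\<And>j. j < Suc k \<Longrightarrow> ts j < ts (Suc j)" "ts k = t" "ts (Suc k) = t'"
    "S \<subseteq> ts ` {..k}" by (rule grid_exists[OF A(2,3) t]) blast
  obtain m where m: "\<And>s. s \<in> S \<Longrightarrow> m s \<le> k \<and> ts (m s) = s"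
  proof -
    have "\<forall>s\<in>S. \<exists>j. j \<le> k \<and> ts j = s" using ts(5) by auto
    from bchoice[OF this] obtain m where "\<forall>s\<in>S. m s \<le> k \<and> ts (m s) = s" by blast
    then show thesis by (intro that[of m]) auto
  qed
  define I where "I = ({..<n} :: nat set) \<times> {..<Suc k}"
  define X where "X = (\<lambda>(i, j) \<omega>. W i (ts (Suc j)) \<omega> - W i (ts j) \<omega>)"
  define P where "P = ({..<n} :: nat set) \<times> {..<k}"
  define Q where "Q = ({..<n} :: nat set) \<times> {k}"
  have ind: "indep_vars (\<lambda>_. borel) X I"
    unfolding X_def I_def by (rule indep_increments) (use ts in auto)
  \<comment> \<open>\<open>h\<close> recovers the values of \<open>W\<close> as partial sums of
    increments. The recovery is only almost sure, because \<open>W i 0 = 0\<close> is.\<close>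
  define h where "h x = (\<lambda>(i, s)\<in>{..<n} \<times> S. \<Sum>j<m s. x (i, j))" for x :: "nat \<times> nat \<Rightarrow> real"
  define g where "g x = (\<lambda>i\<in>{..<n}. x (i, k))" for x :: "nat \<times> nat \<Rightarrow> real"
  have h: "h \<in> measurable (PiM P (\<lambda>_. borel)) (PiM ({..<n} \<times> S) (\<lambda>_. borel))"
    unfolding h_def
    by (rule measurable_restrict)
       (auto simp: P_def split: prod.split intro!: borel_measurable_sum measurable_component_singleton dest: m)
  have g: "g \<in> measurable (PiM Q (\<lambda>_. borel)) (PiM {..<n} (\<lambda>_. borel))"
    unfolding g_def
    by (rule measurable_restrict) (auto simp: Q_def intro!: measurable_component_singleton)
  let ?XP = "\<lambda>\<omega>. restrict (\<lambda>i. X i \<omega>) P" and ?XQ = "\<lambda>\<omega>. restrict (\<lambda>i. X i \<omega>) Q"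
  have iv: "indep_var (PiM P (\<lambda>_. borel)) ?XP (PiM Q (\<lambda>_. borel)) ?XQ"
    by (rule indep_var_restrict[OF ind]) (auto simp: P_def Q_def I_def)
  then have XP: "?XP \<in> measurable M (PiM P (\<lambda>_. borel))" and XQ: "?XQ \<in> measurable M (PiM Q (\<lambda>_. borel))"
    by (auto simp: indep_var_eq)
  have gq: "(g \<circ> (\<lambda>\<omega>. restrict (\<lambda>i. X i \<omega>) Q)) = incr_vec t t'"
    using ts by (auto simp: fun_eq_iff g_def Q_def X_def incr_def restrict_def)
  have hp: "AE \<omega> in M. (h \<circ> (\<lambda>\<omega>. restrict (\<lambda>i. X i \<omega>) P)) \<omega> = (\<lambda>(i, s)\<in>{..<n} \<times> S. W i s \<omega>)"
    using W_paths
  proof eventually_elim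
    case (elim \<omega>)
    have "(\<Sum>j<m s. restrict (\<lambda>i. X i \<omega>) P (i, j)) = W i s \<omega>" if "i < n" "s \<in> S" for i s
    proof -
      have "(\<Sum>j<m s. restrict (\<lambda>i. X i \<omega>) P (i, j)) = (\<Sum>j<m s. W i (ts (Suc j)) \<omega> - W i (ts j) \<omega>)"
        using that m[OF that(2)] by (intro sum.cong) (auto simp: P_def X_def)
      also have "\<dots> = W i (ts (m s)) \<omega> - W i (ts 0) \<omega>" by (rule sum_lessThan_telescope)
      finally show ?thesis using m[OF that(2)] elim that ts(1) by simp
    qed
    then show ?case by (auto simp: h_def fun_eq_iff restrict_def)
  qed
  define H where "H = h \<circ> (\<lambda>\<omega>. restrict (\<lambda>i. X i \<omega>) P)"
  have Hm: "H \<in> measurable M (PiM ({..<n} \<times> S) (\<lambda>_. borel))" and gm: "incr_vec t t' \<in> measurable M (PiM {..<n} (\<lambda>_. borel))"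
    using measurable_comp[OF XP h] measurable_comp[OF XQ g] unfolding gq H_def by auto
  have HC: "H -` C \<inter> space M \<in> sets M" by (rule measurable_sets[OF Hm A(4)])
  have gD: "incr_vec t t' -` D \<inter> space M \<in> sets M" by (rule measurable_sets[OF gm D])
  have AH: "AE \<omega> in M. \<omega> \<in> A \<longleftrightarrow> \<omega> \<in> H -` C \<inter> space M"
    using A(5) hp AE_space by eventually_elim (auto simp: H_def)
  have "prob (A \<inter> (incr_vec t t' -` D \<inter> space M)) = prob ((H -` C \<inter> space M) \<inter> (incr_vec t t' -` D \<inter> space M))"
    using AH A(1) HC gD by (intro finite_measure_eq_AE) auto
  also have "\<dots> = prob ((\<lambda>x. (?XP x, ?XQ x)) -` ((h -` C \<inter> space (PiM P (\<lambda>_. borel))) \<times> (g -` D \<inter> space (PiM Q (\<lambda>_. borel)))) \<inter> space M)"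
    unfolding gq[symmetric] H_def
    using XP XQ by (intro arg_cong[of _ _ prob]) (auto simp: space_PiM)
  also have "\<dots> = prob (?XP -` (h -` C \<inter> space (PiM P (\<lambda>_. borel))) \<inter> space M)
      * prob (?XQ -` (g -` D \<inter> space (PiM Q (\<lambda>_. borel))) \<inter> space M)"
    by (rule indep_varD[OF iv measurable_sets[OF h A(4)] measurable_sets[OF g D]])
  also have "?XP -` (h -` C \<inter> space (PiM P (\<lambda>_. borel))) \<inter> space M = H -` C \<inter> space M"
    by (auto simp: H_def space_PiM)
  also have "?XQ -` (g -` D \<inter> space (PiM Q (\<lambda>_. borel))) \<inter> space M = incr_vec t t' -` D \<inter> space M"
    unfolding gq[symmetric] by (auto simp: space_PiM)
  also have "prob (H -` C \<inter> space M) = prob A"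
    using AH A(1) HC by (intro finite_measure_eq_AE) auto
  finally show ?thesis .
qed

text \<open>Independence of two pi-systems passes to the generated sigma-algebras;
  \<open>cyl t\<close> covers the past, and preimages under \<open>incr_vec\<close> cover every
  function of the increment.\<close>

lemma indep_past_increment:
  assumes t: "0 \<le> t" "t < t'" and Z: "Z \<in> measurable (past t) N"
    and G: "G \<in> measurable (PiM {..<n} (\<lambda>_. borel)) N'"
  shows "indep_var N (Z :: 'a \<Rightarrow> real) N' (\<lambda>\<omega>. G (incr_vec t t' \<omega>))"
proof -
  let ?\<G> = "{incr_vec t t' -` D \<inter> space M | D. D \<in> sets (PiM {..<n} (\<lambda>_. borel))}"
  have im: "incr_vec t t' \<in> measurable M (PiM {..<n} (\<lambda>_. borel))"
    using t by (intro incr_vec_measurable) auto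
  have "indep_set (cyl t) ?\<G>"
  proof (rule indep_setI)
    show "cyl t \<subseteq> events" by (auto simp: cyl_def)
    show "?\<G> \<subseteq> events" using measurable_sets[OF im] by auto
    show "prob (a \<inter> b) = prob a * prob b" if "a \<in> cyl t" "b \<in> ?\<G>" for a b
      using that indep_cyl_increment[OF t] by auto
  qed
  moreover have "Int_stable ?\<G>"
  proof (rule Int_stableI)
    fix a b assume "a \<in> ?\<G>" "b \<in> ?\<G>"
    then obtain D E where "a = incr_vec t t' -` D \<inter> space M" "D \<in> sets (PiM {..<n} (\<lambda>_. borel))"
      "b = incr_vec t t' -` E \<inter> space M" "E \<in> sets (PiM {..<n} (\<lambda>_. borel))" by blast
    then show "a \<inter> b \<in> ?\<G>" by (intro CollectI exI[of _ "D \<inter> E"]) auto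
  qed
  ultimately have ind: "indep_set (sigma_sets (space M) (cyl t)) (sigma_sets (space M) ?\<G>)"
    by (rule indep_set_sigma_sets[OF _ Int_stable_cyl])
  have ps: "sets (past t) \<subseteq> sigma_sets (space M) (cyl t)"
    unfolding sets_past by (rule sigma_sets_mono'[OF cyl_gen])
  have "indep_set (sigma_sets (space M) {Z -` A \<inter> space M |A. A \<in> sets N})
     (sigma_sets (space M) {(\<lambda>\<omega>. G (incr_vec t t' \<omega>)) -` A \<inter> space M |A. A \<in> sets N'})"
    unfolding indep_set_def
  proof (rule indep_sets_mono_sets[OF ind[unfolded indep_set_def]])
    have "{Z -` A \<inter> space M |A. A \<in> sets N} \<subseteq> sigma_sets (space M) (cyl t)"
      using measurable_sets[OF Z] ps by auto
    then have 1: "sigma_sets (space M) {Z -` A \<inter> space M |A. A \<in> sets N} \<subseteq> sigma_sets (space M) (cyl t)"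
      by (rule sigma_sets_mono)
    have "{(\<lambda>\<omega>. G (incr_vec t t' \<omega>)) -` A \<inter> space M |A. A \<in> sets N'} \<subseteq> ?\<G>"
    proof clarify
      fix A assume "A \<in> sets N'"
      then have "G -` A \<inter> space (PiM {..<n} (\<lambda>_. borel)) \<in> sets (PiM {..<n} (\<lambda>_. borel))"
        by (rule measurable_sets[OF G])
      moreover have "(\<lambda>\<omega>. G (incr_vec t t' \<omega>)) -` A \<inter> space M
         = incr_vec t t' -` (G -` A \<inter> space (PiM {..<n} (\<lambda>_. borel))) \<inter> space M"
        by (auto simp: space_PiM)
      ultimately show "\<exists>D. (\<lambda>\<omega>. G (incr_vec t t' \<omega>)) -` A \<inter> space M = incr_vec t t' -` D \<inter> space M
           \<and> D \<in> sets (PiM {..<n} (\<lambda>_. borel))" by blast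
    qed
    then have 2: "sigma_sets (space M) {(\<lambda>\<omega>. G (incr_vec t t' \<omega>)) -` A \<inter> space M |A. A \<in> sets N'} \<subseteq> sigma_sets (space M) ?\<G>"
      by (rule sigma_sets_mono')
    fix b :: bool
    show "(case b of True \<Rightarrow> sigma_sets (space M) {Z -` A \<inter> space M |A. A \<in> sets N}
       | False \<Rightarrow> sigma_sets (space M) {(\<lambda>\<omega>. G (incr_vec t t' \<omega>)) -` A \<inter> space M |A. A \<in> sets N'})
       \<subseteq> (case b of True \<Rightarrow> sigma_sets (space M) (cyl t) | False \<Rightarrow> sigma_sets (space M) ?\<G>)"
      using 1 2 by (cases b) auto
  qed
  moreover have "Z \<in> measurable M N" by (rule past_measurable_imp[OF Z])
  moreover have "(\<lambda>\<omega>. G (incr_vec t t' \<omega>)) \<in> measurable M N'" by (rule measurable_compose[OF im G])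
  ultimately show ?thesis by (simp add: indep_var_eq)
qed

section \<open>Moments of increments and of their products with past variables\<close>

lemma incr_moments:
  assumes "0 \<le> s" "s < t" "i < n"
  shows "integrable M (incr s t i)" "expectation (incr s t i) = 0"
    "integrable M (\<lambda>\<omega>. (incr s t i \<omega>)\<^sup>2)" "expectation (\<lambda>\<omega>. (incr s t i \<omega>)\<^sup>2) = t - s"
    "integrable M (\<lambda>\<omega>. (incr s t i \<omega>) ^ 4)" "expectation (\<lambda>\<omega>. (incr s t i \<omega>) ^ 4) = 3 * (t - s)\<^sup>2"
proof -
  have sg: "0 < sqrt (t - s)" using assms by simp
  note D = increment_distributed[OF assms]
  have I: "integrable M (\<lambda>\<omega>. (incr s t i \<omega>) ^ k)" for k
    using integrable_normal_moment[OF sg, of 0 k]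
    by (subst distributed_integrable[OF D, symmetric]) (auto simp: normal_density_nonneg)
  have E: "expectation (\<lambda>\<omega>. (incr s t i \<omega>) ^ k) = (\<integral>x. normal_density 0 (sqrt (t - s)) x * x ^ k \<partial>lborel)" for k
    by (rule distributed_integral[OF D, symmetric]) (auto simp: normal_density_nonneg)
  show "integrable M (incr s t i)" using I[of 1] by simp
  show "integrable M (\<lambda>\<omega>. (incr s t i \<omega>)\<^sup>2)" "integrable M (\<lambda>\<omega>. (incr s t i \<omega>) ^ 4)" by (rule I)+
  show "expectation (incr s t i) = 0" using E[of 1] integral_normal_moment_odd[OF sg, of 0 0] by simp
  show "expectation (\<lambda>\<omega>. (incr s t i \<omega>)\<^sup>2) = t - s"
    using E[of 2] integral_normal_moment_even[OF sg, of 0 1] assms by (simp add: fact_numeral)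
  show "expectation (\<lambda>\<omega>. (incr s t i \<omega>) ^ 4) = 3 * (t - s)\<^sup>2"
    using E[of 4] integral_normal_moment_even[OF sg, of 0 2] assms
    by (simp add: fact_numeral power_divide)
qed

lemma incr_indep:
  assumes "0 \<le> s" "s < t" "i < n" "j < n" "i \<noteq> j"
  shows "indep_var borel (incr s t i) borel (incr s t j)"
proof -
  define ts where "ts j = (if j = 0 then s else t)" for j :: nat
  have iv: "indep_vars (\<lambda>_. borel) (\<lambda>(i, j) \<omega>. W i (ts (Suc j)) \<omega> - W i (ts j) \<omega>) ({..<n} \<times> {..<1})"
    by (rule indep_increments) (use assms in \<open>auto simp: ts_def\<close>)
  have "indep_var borel ((\<lambda>x. x (i, 0)) \<circ> (\<lambda>\<omega>. restrict (\<lambda>p. (case p of (i, j) \<Rightarrow> \<lambda>\<omega>. W i (ts (Suc j)) \<omega> - W i (ts j) \<omega>) \<omega>) {(i, 0)}))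
     borel ((\<lambda>x. x (j, 0)) \<circ> (\<lambda>\<omega>. restrict (\<lambda>p. (case p of (i, j) \<Rightarrow> \<lambda>\<omega>. W i (ts (Suc j)) \<omega> - W i (ts j) \<omega>) \<omega>) {(j, 0)}))"
    using assms by (intro indep_var_compose[OF indep_var_restrict[OF iv]]) (auto intro!: measurable_component_singleton)
  then show ?thesis by (simp add: comp_def ts_def incr_def[abs_def])
qed

lemma incr_cross_moments:
  assumes "0 \<le> s" "s < t" "i < n" "j < n"
  shows "integrable M (\<lambda>\<omega>. incr s t i \<omega> * incr s t j \<omega>)"
    "expectation (\<lambda>\<omega>. incr s t i \<omega> * incr s t j \<omega>) = (if i = j then t - s else 0)"
proof -
  note m = incr_moments[OF assms(1,2)]
  have "integrable M (\<lambda>\<omega>. incr s t i \<omega> * incr s t j \<omega>) \<and>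
     expectation (\<lambda>\<omega>. incr s t i \<omega> * incr s t j \<omega>) = (if i = j then t - s else 0)"
  proof (cases "i = j")
    case True
    then show ?thesis using m(3,4)[OF assms(3)] by (simp add: power2_eq_square)
  next
    case False
    then show ?thesis
      using indep_var_integrable[OF incr_indep[OF assms False] m(1)[OF assms(3)] m(1)[OF assms(4)]]
        indep_var_lebesgue_integral[OF incr_indep[OF assms False] m(1)[OF assms(3)] m(1)[OF assms(4)]]
        m(2)[OF assms(3)] by simp
  qed
  then show "integrable M (\<lambda>\<omega>. incr s t i \<omega> * incr s t j \<omega>)"
    "expectation (\<lambda>\<omega>. incr s t i \<omega> * incr s t j \<omega>) = (if i = j then t - s else 0)" by auto
qed

lemma bounded_integrable:
  fixes Z :: "'a \<Rightarrow> real"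
  assumes "Z \<in> borel_measurable M" "\<And>\<omega>. \<omega> \<in> space M \<Longrightarrow> \<bar>Z \<omega>\<bar> \<le> B"
  shows "integrable M Z"
  using assms by (intro integrable_const_bound[where B=B]) (auto intro!: AE_I2)

context
  fixes s t :: real and Z :: "'a \<Rightarrow> real" and B :: real
  assumes st: "0 \<le> s" "s < t" and Z: "Z \<in> borel_measurable (past s)"
    and B: "\<And>\<omega>. \<omega> \<in> space M \<Longrightarrow> \<bar>Z \<omega>\<bar> \<le> B"
begin

lemma past_bounded_integrable: "integrable M Z"
  using bounded_integrable[OF past_measurable_imp[OF Z] B] .

lemma past_times_incr:
  assumes "i < n"
  shows "integrable M (\<lambda>\<omega>. Z \<omega> * incr s t i \<omega>)" "expectation (\<lambda>\<omega>. Z \<omega> * incr s t i \<omega>) = 0"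
proof -
  have "indep_var borel Z borel (\<lambda>\<omega>. (\<lambda>x. x i) (incr_vec s t \<omega>))"
    using assms by (intro indep_past_increment[OF st Z] measurable_component_singleton) auto
  then have iv: "indep_var borel Z borel (incr s t i)" using assms by simp
  show "integrable M (\<lambda>\<omega>. Z \<omega> * incr s t i \<omega>)"
    by (rule indep_var_integrable[OF iv past_bounded_integrable incr_moments(1)[OF st assms]])
  show "expectation (\<lambda>\<omega>. Z \<omega> * incr s t i \<omega>) = 0"
    using indep_var_lebesgue_integral[OF iv past_bounded_integrable incr_moments(1)[OF st assms]] incr_moments(2)[OF st assms] by simp
qed

text \<open>Only the diagonal survives, since distinct components are independent and centred; this
  is what turns a quadratic form into a trace.\<close>

lemma past_times_incr2:
  assumes "i < n" "j < n"
  shows "integrable M (\<lambda>\<omega>. Z \<omega> * (incr s t i \<omega> * incr s t j \<omega>))"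
    "expectation (\<lambda>\<omega>. Z \<omega> * (incr s t i \<omega> * incr s t j \<omega>)) = (if i = j then t - s else 0) * expectation Z"
proof -
  have "(\<lambda>x. x i * x j :: real) \<in> borel_measurable (PiM {..<n} (\<lambda>_. borel))"
    using assms by (intro borel_measurable_times measurable_component_singleton) auto
  then have "indep_var borel Z borel (\<lambda>\<omega>. (\<lambda>x. x i * x j) (incr_vec s t \<omega>))"
    by (rule indep_past_increment[OF st Z])
  then have iv: "indep_var borel Z borel (\<lambda>\<omega>. incr s t i \<omega> * incr s t j \<omega>)" using assms by simp
  show "integrable M (\<lambda>\<omega>. Z \<omega> * (incr s t i \<omega> * incr s t j \<omega>))"
    by (rule indep_var_integrable[OF iv past_bounded_integrable incr_cross_moments(1)[OF st assms]])
  show "expectation (\<lambda>\<omega>. Z \<omega> * (incr s t i \<omega> * incr s t j \<omega>)) = (if i = j then t - s else 0) * expectation Z"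
    using indep_var_lebesgue_integral[OF iv past_bounded_integrable incr_cross_moments(1)[OF st assms]]
      incr_cross_moments(2)[OF st assms] by (simp add: mult.commute)
qed

end

end

section \<open>The market as an adapted process\<close>

locale market = brownian M n W for M :: "'a measure" and n W +
  fixes \<delta> :: real and g :: "real \<Rightarrow> real" and x0 :: "nat \<Rightarrow> real" and X :: "nat \<Rightarrow> real \<Rightarrow> 'a \<Rightarrow> real"
  assumes n2: "n \<ge> 2"
    and delta: "0 < \<delta>" "\<delta> < 1 / 2"
    and adm: "admissible \<delta> g"
    and init: "\<forall>i<n. 0 < x0 i \<and> x0 i / (\<Sum>j<n. x0 j) < 1 - \<delta>"
    and model: "market_model M n \<delta> g W x0 X"
begin

abbreviation \<mu> :: "nat \<Rightarrow> real \<Rightarrow> 'a \<Rightarrow> real" where "\<mu> \<equiv> mkt_weight n X"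

definition init_weight :: "nat \<Rightarrow> real" where "init_weight i = x0 i / (\<Sum>j<n. x0 j)"

text \<open>All almost sure facts about a path in one predicate: they hold off a single null set,
  and what is derived from them is pathwise.\<close>

definition regular :: "'a \<Rightarrow> bool" where
  "regular \<omega> \<longleftrightarrow> (\<forall>i<n. W i 0 \<omega> = 0 \<and> continuous_on {0..} (\<lambda>t. W i t \<omega>)) \<and>
     (\<forall>i<n. X i 0 \<omega> = x0 i \<and> continuous_on {0..} (\<lambda>t. X i t \<omega>)) \<and>
     (\<forall>t\<ge>0. (\<forall>s\<in>{0..t}. \<forall>i<n. 0 < X i s \<omega> \<and> mkt_weight n X i s \<omega> < 1 - \<delta>) \<longrightarrow>
        (\<forall>i<n. ln (X i t \<omega>) = ln (x0 i) - integral {0..t} (\<lambda>s. g (mkt_weight n X i s \<omega>)) + W i t \<omega>))"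

lemma AE_regular: "AE \<omega> in M. regular \<omega>"
  using W_paths model unfolding regular_def market_model_def by auto

lemma g_continuous: "continuous_on {0<..<1 - \<delta>} g"
  using adm by (simp add: admissible_def)

text \<open>\<open>BM_filtration\<close> at \<open>s\<close> is an intersection over all later
  \<open>u\<close>; taking \<open>u = t\<close> places it inside \<open>past t\<close> as soon as
  \<open>s < t\<close>.\<close>

lemma X_past_less:
  assumes "i < n" "0 \<le> s" "s < t"
  shows "X i s \<in> borel_measurable (past t)"
proof (rule measurableI)
  fix B :: "real set" assume "B \<in> sets borel"
  then have "X i s -` B \<inter> space M \<in> BM_filtration M n W s"
    using model assms by (auto simp: market_model_def)
  then show "X i s -` B \<inter> space (past t) \<in> sets (past t)"
    unfolding BM_filtration_def sets_past using assms by auto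
qed auto

lemma X_measurable [measurable]: "i < n \<Longrightarrow> 0 \<le> s \<Longrightarrow> X i s \<in> borel_measurable M"
  using past_measurable_imp[OF X_past_less[of i s "s + 1"]] by simp

text \<open>By path continuity \<open>X i t\<close> is almost surely the limit of values at earlier
  times, each measurable in \<open>past t\<close>. At time 0 there are none, but the value is almost
  surely the constant \<open>x0 i\<close>. Measurability at \<open>t\<close> itself makes the state
  independent of the increment that starts at \<open>t\<close>.\<close>

lemma X_past:
  assumes i: "i < n" and t: "0 \<le> t"
  shows "X i t \<in> borel_measurable (past t)"
proof (cases "t = 0")
  case True
  have "AE \<omega> in M. x0 i = X i 0 \<omega>" using AE_regular by eventually_elim (use i in \<open>auto simp: regular_def\<close>)
  then show ?thesis using past_complete[of "\<lambda>_. x0 i" 0 borel "X i 0"] i True by simp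
next
  case False
  define r where "r m = t * (1 - inverse (real (Suc m)))" for m
  have r: "0 \<le> r m" "r m < t" for m
    using False t by (auto simp: r_def inverse_eq_divide field_simps)
  have rl: "r \<longlonglongrightarrow> t"
    unfolding r_def by (rule tendsto_eq_intros LIMSEQ_inverse_real_of_nat refl | simp)+
  have Y: "(\<lambda>\<omega>. lim (\<lambda>m. X i (r m) \<omega>)) \<in> borel_measurable (past t)"
    using X_past_less[OF i r] by (rule borel_measurable_lim_metric)
  have "AE \<omega> in M. lim (\<lambda>m. X i (r m) \<omega>) = X i t \<omega>"
    using AE_regular
  proof eventually_elim
    case (elim \<omega>)
    then have "continuous_on {0..} (\<lambda>t. X i t \<omega>)" using i by (auto simp: regular_def)
    then have "(\<lambda>m. X i (r m) \<omega>) \<longlonglongrightarrow> X i t \<omega>"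
      using r t rl by (intro continuous_on_tendsto_compose[of "{0..}" "\<lambda>t. X i t \<omega>" r t]) auto
    then show ?case by (rule limI)
  qed
  then show ?thesis by (rule past_complete[OF Y X_measurable[OF i t]])
qed

lemma X_past_le: "i < n \<Longrightarrow> 0 \<le> s \<Longrightarrow> s \<le> t \<Longrightarrow> X i s \<in> borel_measurable (past t)"
  using X_past[of i s] past_mono[of s t] by (auto simp: measurable_def)

lemma weight_past: "i < n \<Longrightarrow> 0 \<le> t \<Longrightarrow> \<mu> i t \<in> borel_measurable (past t)"
  unfolding mkt_weight_def[abs_def] total_cap_def
  by (intro borel_measurable_divide borel_measurable_sum X_past) auto

lemma weight_measurable [measurable]: "i < n \<Longrightarrow> 0 \<le> t \<Longrightarrow> \<mu> i t \<in> borel_measurable M"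
  by (rule past_measurable_imp[OF weight_past])

text \<open>Stated for capitalizations and multiplied out by the total, so that the conditions are
  closed without any division. The upper cap \<open>K\<close> bounds the total and thereby keeps
  every weight away from 0.\<close>

definition in_region :: "real \<Rightarrow> (nat \<Rightarrow> real) \<Rightarrow> bool" where
  "in_region K x \<longleftrightarrow> (\<forall>j<n. 1 / K \<le> x j \<and> x j \<le> K \<and> x j \<le> (1 - \<delta> - 1 / K) * (\<Sum>l<n. x l))"

text \<open>Only rational multiples of \<open>t\<close> are inspected, which makes the event measurable; on continuous
  paths this is the same as inspecting all of \<open>{0..t}\<close>.\<close>
definition alive :: "real \<Rightarrow> real \<Rightarrow> 'a set" where
  "alive K t = {\<omega> \<in> space M. \<forall>q\<in>\<rat> \<inter> {0..1}. in_region K (\<lambda>j. X j (q * t) \<omega>)}"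

lemma alive_past:
  assumes "0 \<le> t"
  shows "alive K t \<in> sets (past t)"
proof -
  have "{\<omega> \<in> space (past t). in_region K (\<lambda>j. X j (q * t) \<omega>)} \<in> sets (past t)" if "q \<in> \<rat> \<inter> {0..1}" for q
  proof -
    have Xq [measurable]: "X j (q * t) \<in> borel_measurable (past t)" if "j < n" for j
      using that \<open>q \<in> _\<close> assms mult_left_le_one_le[of t q] by (intro X_past_le) auto
    have S [measurable]: "(\<lambda>\<omega>. \<Sum>l<n. X l (q * t) \<omega>) \<in> borel_measurable (past t)"
      using Xq by (intro borel_measurable_sum) auto
    have "{\<omega> \<in> space (past t). \<forall>j\<in>{..<n}. 1 / K \<le> X j (q * t) \<omega> \<and> X j (q * t) \<omega> \<le> K \<and>
         X j (q * t) \<omega> \<le> (1 - \<delta> - 1 / K) * (\<Sum>l<n. X l (q * t) \<omega>)} \<in> sets (past t)"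
    proof (rule sets.sets_Collect_finite_All)
      fix j assume "j \<in> {..<n}"
      then have [measurable]: "X j (q * t) \<in> borel_measurable (past t)" using Xq by simp
      show "{\<omega> \<in> space (past t). 1 / K \<le> X j (q * t) \<omega> \<and> X j (q * t) \<omega> \<le> K \<and>
         X j (q * t) \<omega> \<le> (1 - \<delta> - 1 / K) * (\<Sum>l<n. X l (q * t) \<omega>)} \<in> sets (past t)"
        by measurable
    qed simp
    then show ?thesis unfolding in_region_def Ball_def lessThan_iff .
  qed
  then have q: "{\<omega> \<in> space (past t). in_region K (\<lambda>j. X j (q * t) \<omega>)} \<in> sets (past t)" if "q \<in> \<rat> \<inter> {0..1}" for q
    using that by blast
  have "countable (\<rat> \<inter> {0..1::real})" by (rule countable_subset[OF Int_lower1 countable_rat])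
  then have "{\<omega> \<in> space (past t). \<forall>q\<in>\<rat> \<inter> {0..1}. in_region K (\<lambda>j. X j (q * t) \<omega>)} \<in> sets (past t)"
    using q by (intro sets.sets_Collect_countable_All')
  then show ?thesis by (simp add: alive_def)
qed

lemma alive_measurable [measurable]: "0 \<le> t \<Longrightarrow> alive K t \<in> sets M"
  using alive_past past_subset by blast

lemma alive_in_region: "\<omega> \<in> alive K t \<Longrightarrow> in_region K (\<lambda>j. X j t \<omega>)"
  unfolding alive_def by (auto dest!: bspec[of _ _ 1])

lemma regular_X: "regular \<omega> \<Longrightarrow> i < n \<Longrightarrow> continuous_on {0..} (\<lambda>t. X i t \<omega>)"
  "regular \<omega> \<Longrightarrow> i < n \<Longrightarrow> X i 0 \<omega> = x0 i"
  by (auto simp: regular_def)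

lemma regular_W: "regular \<omega> \<Longrightarrow> i < n \<Longrightarrow> continuous_on {0..} (\<lambda>t. W i t \<omega>)"
  "regular \<omega> \<Longrightarrow> i < n \<Longrightarrow> W i 0 \<omega> = 0"
  by (auto simp: regular_def)

lemma closed_in_region:
  assumes "regular \<omega>"
  shows "closed {s \<in> {0..t}. in_region K (\<lambda>j. X j s \<omega>)}"
proof -
  have c: "continuous_on {0..t} (\<lambda>s. X j s \<omega>)" if "j < n" for j
    by (rule continuous_on_subset[OF regular_X(1)[OF assms that]]) auto
  have "{s \<in> {0..t}. in_region K (\<lambda>j. X j s \<omega>)} = {0..t} \<inter> (\<Inter>j\<in>{..<n}. {s \<in> {0..t}. 1 / K \<le> X j s \<omega>}
     \<inter> {s \<in> {0..t}. X j s \<omega> \<le> K} \<inter> {s \<in> {0..t}. X j s \<omega> \<le> (1 - \<delta> - 1 / K) * (\<Sum>l<n. X l s \<omega>)})"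
    by (auto simp: in_region_def)
  also have "closed \<dots>"
    by (intro closed_Int closed_INT ballI continuous_on_closed_Collect_le continuous_intros c) auto
  finally show ?thesis .
qed

text \<open>Being outside the region is an open condition within \<open>{0..t}\<close>, so a failure
  at one time persists on a small interval, which contains a rational multiple of
  \<open>t\<close>.\<close>

lemma alive_iff:
  assumes "regular \<omega>" "\<omega> \<in> space M" "0 \<le> t"
  shows "\<omega> \<in> alive K t \<longleftrightarrow> (\<forall>s\<in>{0..t}. in_region K (\<lambda>j. X j s \<omega>))"
proof
  assume "\<forall>s\<in>{0..t}. in_region K (\<lambda>j. X j s \<omega>)"
  then show "\<omega> \<in> alive K t"
    using assms mult_left_le_one_le[of t] by (auto simp: alive_def)
next
  assume a: "\<omega> \<in> alive K t"
  show "\<forall>s\<in>{0..t}. in_region K (\<lambda>j. X j s \<omega>)"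
  proof (cases "t = 0")
    case True
    then show ?thesis using alive_in_region[OF a] by simp
  next
    case False
    then have t: "0 < t" using assms by simp
    show ?thesis
    proof (rule ballI, rule ccontr)
      fix s assume s: "s \<in> {0..t}" "\<not> in_region K (\<lambda>j. X j s \<omega>)"
      let ?C = "{s \<in> {0..t}. in_region K (\<lambda>j. X j s \<omega>)}"
      have "open (- ?C)" using closed_in_region[OF assms(1)] by blast
      then obtain e where e: "0 < e" "ball s e \<subseteq> - ?C" using s by (auto elim!: openE[of _ s])
      define l where "l = max 0 (s - e)"
      define u where "u = min t (s + e)"
      have lu: "l < u" using s t e by (auto simp: l_def u_def)
      then have "l / t < u / t" using t by (simp add: divide_strict_right_mono)
      then obtain q where q: "q \<in> \<rat>" "l / t < q" "q < u / t" using Rats_dense_in_real by blast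
      then have q': "l < q * t" "q * t < u" using t by (auto simp: field_simps)
      have "0 \<le> q" using q(2) t l_def by (smt (verit) divide_nonneg_pos)
      moreover have "q \<le> 1"
      proof -
        have "q * t < 1 * t" using q'(2) by (auto simp: u_def)
        then show ?thesis using t by (simp only: mult_less_cancel_right) auto
      qed
      ultimately have "in_region K (\<lambda>j. X j (q * t) \<omega>)" using a q(1) by (auto simp: alive_def)
      moreover have "q * t \<in> ball s e" using q' by (auto simp: l_def u_def dist_real_def)
      moreover have "q * t \<in> {0..t}" using q' unfolding l_def u_def atLeastAtMost_iff by linarith
      ultimately show False using e(2) by blast
    qed
  qed
qed

lemma alive_antimono:
  assumes "regular \<omega>" "\<omega> \<in> alive K t" "0 \<le> s" "s \<le> t"
  shows "\<omega> \<in> alive K s"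
  using assms alive_iff[of \<omega> t K] alive_iff[of \<omega> s K] by (auto simp: alive_def)

end

section \<open>Expected second-order change over one time step\<close>

context brownian
begin

text \<open>The coefficients are known at time \<open>s\<close>. In the linear form only the drift
  survives. In the quadratic form the diagonal noise terms survive at order \<open>t - s\<close> and
  mixed terms of drift and noise have mean zero; what remains is drift times drift, at most
  \<open>B ^ 3 * (t - s)\<^sup>2\<close> for each of \<open>n\<^sup>2\<close> pairs.\<close>

lemma quadratic_expectation:
  fixes a b :: "nat \<Rightarrow> 'a \<Rightarrow> real" and c :: "nat \<Rightarrow> nat \<Rightarrow> 'a \<Rightarrow> real"
  assumes st: "0 \<le> s" "s < t"
    and a: "\<And>j. j < n \<Longrightarrow> a j \<in> borel_measurable (past s)" "\<And>j \<omega>. j < n \<Longrightarrow> \<omega> \<in> space M \<Longrightarrow> \<bar>a j \<omega>\<bar> \<le> B"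
    and b: "\<And>j. j < n \<Longrightarrow> b j \<in> borel_measurable (past s)" "\<And>j \<omega>. j < n \<Longrightarrow> \<omega> \<in> space M \<Longrightarrow> \<bar>b j \<omega>\<bar> \<le> B"
    and c: "\<And>j l. j < n \<Longrightarrow> l < n \<Longrightarrow> c j l \<in> borel_measurable (past s)"
      "\<And>j l \<omega>. j < n \<Longrightarrow> l < n \<Longrightarrow> \<omega> \<in> space M \<Longrightarrow> \<bar>c j l \<omega>\<bar> \<le> B"
  defines "d \<equiv> \<lambda>j \<omega>. b j \<omega> * (t - s) + incr s t j \<omega>"
  defines "Q \<equiv> \<lambda>\<omega>. (\<Sum>j<n. a j \<omega> * d j \<omega>) + (\<Sum>j<n. \<Sum>l<n. c j l \<omega> * (d j \<omega> * d l \<omega>))"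
    and "L \<equiv> \<lambda>\<omega>. (\<Sum>j<n. a j \<omega> * b j \<omega>) + (\<Sum>j<n. c j j \<omega>)"
  shows "integrable M Q" "integrable M L"
    "(t - s) * expectation L - (real n)\<^sup>2 * B ^ 3 * (t - s)\<^sup>2 \<le> expectation Q"
proof -
  let ?h = "t - s"
  have B0: "0 \<le> B" if "j < n" for j using that not_empty a(2) by (metis abs_ge_zero order_trans equals0I)
  have ab: "(\<lambda>\<omega>. a j \<omega> * b j \<omega>) \<in> borel_measurable (past s)" if "j < n" for j
    using a(1) b(1) that by auto
  have abB: "\<bar>a j \<omega> * b j \<omega>\<bar> \<le> B * B" if "j < n" "\<omega> \<in> space M" for j \<omega>
    unfolding abs_mult using a(2) b(2) that B0[OF that(1)] by (intro mult_mono) auto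
  have cb: "(\<lambda>\<omega>. c j l \<omega> * b k \<omega>) \<in> borel_measurable (past s)" if "j < n" "l < n" "k < n" for j l k
    using c(1) b(1) that by auto
  have cbB: "\<bar>c j l \<omega> * b k \<omega>\<bar> \<le> B * B" if "j < n" "l < n" "k < n" "\<omega> \<in> space M" for j l k \<omega>
    unfolding abs_mult using c(2) b(2) that B0[OF that(1)] by (intro mult_mono) auto
  have cbb: "(\<lambda>\<omega>. c j l \<omega> * b j \<omega> * b l \<omega>) \<in> borel_measurable (past s)" if "j < n" "l < n" for j l
    using c(1) b(1) that by auto
  have cbbB: "\<bar>c j l \<omega> * b j \<omega> * b l \<omega>\<bar> \<le> B * B * B" if "j < n" "l < n" "\<omega> \<in> space M" for j l \<omega>
    unfolding abs_mult[of "_ * _"] using cbB b(2) that B0[OF that(1)] by (intro mult_mono) auto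
  have A: "integrable M (\<lambda>\<omega>. a j \<omega> * d j \<omega>)"
    "expectation (\<lambda>\<omega>. a j \<omega> * d j \<omega>) = ?h * expectation (\<lambda>\<omega>. a j \<omega> * b j \<omega>)" if j: "j < n" for j
  proof -
    have eq: "(\<lambda>\<omega>. a j \<omega> * d j \<omega>) = (\<lambda>\<omega>. ?h * (a j \<omega> * b j \<omega>) + a j \<omega> * incr s t j \<omega>)"
      by (simp add: d_def algebra_simps)
    note i1 = past_bounded_integrable[OF st ab[OF j] abB[OF j]]
    note i2 = past_times_incr[OF st a(1)[OF j] a(2)[OF j] j]
    show "integrable M (\<lambda>\<omega>. a j \<omega> * d j \<omega>)" unfolding eq using i1 i2 by auto
    show "expectation (\<lambda>\<omega>. a j \<omega> * d j \<omega>) = ?h * expectation (\<lambda>\<omega>. a j \<omega> * b j \<omega>)"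
      unfolding eq using i1 i2 by simp
  qed
  have C: "integrable M (\<lambda>\<omega>. c j l \<omega> * (d j \<omega> * d l \<omega>))"
    "expectation (\<lambda>\<omega>. c j l \<omega> * (d j \<omega> * d l \<omega>))
      = ?h\<^sup>2 * expectation (\<lambda>\<omega>. c j l \<omega> * b j \<omega> * b l \<omega>) + (if j = l then ?h else 0) * expectation (c j l)"
    if j: "j < n" and l: "l < n" for j l
  proof -
    have eq: "(\<lambda>\<omega>. c j l \<omega> * (d j \<omega> * d l \<omega>)) = (\<lambda>\<omega>. ?h\<^sup>2 * (c j l \<omega> * b j \<omega> * b l \<omega>)
       + ?h * (c j l \<omega> * b j \<omega> * incr s t l \<omega>) + ?h * (c j l \<omega> * b l \<omega> * incr s t j \<omega>)
       + c j l \<omega> * (incr s t j \<omega> * incr s t l \<omega>))"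
      by (simp add: d_def algebra_simps power2_eq_square)
    note i1 = past_bounded_integrable[OF st cbb[OF j l] cbbB[OF j l]]
    note i2 = past_times_incr[OF st cb[OF j l j] cbB[OF j l j] l]
    note i3 = past_times_incr[OF st cb[OF j l l] cbB[OF j l l] j]
    note i4 = past_times_incr2[OF st c(1)[OF j l] c(2)[OF j l] j l]
    show "integrable M (\<lambda>\<omega>. c j l \<omega> * (d j \<omega> * d l \<omega>))" unfolding eq using i1 i2 i3 i4 by auto
    show "expectation (\<lambda>\<omega>. c j l \<omega> * (d j \<omega> * d l \<omega>))
      = ?h\<^sup>2 * expectation (\<lambda>\<omega>. c j l \<omega> * b j \<omega> * b l \<omega>) + (if j = l then ?h else 0) * expectation (c j l)"
      unfolding eq using i1 i2 i3 i4 by simp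
  qed
  show "integrable M Q" unfolding Q_def using A(1) C(1) by (intro Bochner_Integration.integrable_add Bochner_Integration.integrable_sum) auto
  have ci: "integrable M (c j l)" if "j < n" "l < n" for j l by (rule past_bounded_integrable[OF st c(1)[OF that] c(2)[OF that]])
  have abi: "integrable M (\<lambda>\<omega>. a j \<omega> * b j \<omega>)" if "j < n" for j by (rule past_bounded_integrable[OF st ab[OF that] abB[OF that]])
  show "integrable M L" unfolding L_def using ci abi by (intro Bochner_Integration.integrable_add Bochner_Integration.integrable_sum) auto
  have EL: "expectation L = (\<Sum>j<n. expectation (\<lambda>\<omega>. a j \<omega> * b j \<omega>)) + (\<Sum>j<n. expectation (c j j))"
    unfolding L_def using ci abi
    by (subst Bochner_Integration.integral_add) (auto intro!: arg_cong2[where f="(+)"] Bochner_Integration.integral_sum)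
  have "expectation Q = (\<Sum>j<n. expectation (\<lambda>\<omega>. a j \<omega> * d j \<omega>)) + (\<Sum>j<n. \<Sum>l<n. expectation (\<lambda>\<omega>. c j l \<omega> * (d j \<omega> * d l \<omega>)))"
  proof -
    have 1: "integrable M (\<lambda>\<omega>. \<Sum>l<n. c j l \<omega> * (d j \<omega> * d l \<omega>))" if "j < n" for j
      using C(1) that by (intro Bochner_Integration.integrable_sum) auto
    have 2: "expectation (\<lambda>\<omega>. \<Sum>l<n. c j l \<omega> * (d j \<omega> * d l \<omega>)) = (\<Sum>l<n. expectation (\<lambda>\<omega>. c j l \<omega> * (d j \<omega> * d l \<omega>)))"
      if "j < n" for j
      using C(1) that by (intro Bochner_Integration.integral_sum) auto
    have 3: "expectation (\<lambda>\<omega>. \<Sum>j<n. \<Sum>l<n. c j l \<omega> * (d j \<omega> * d l \<omega>))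
       = (\<Sum>j<n. expectation (\<lambda>\<omega>. \<Sum>l<n. c j l \<omega> * (d j \<omega> * d l \<omega>)))"
      using 1 by (intro Bochner_Integration.integral_sum) auto
    have 4: "integrable M (\<lambda>\<omega>. \<Sum>j<n. \<Sum>l<n. c j l \<omega> * (d j \<omega> * d l \<omega>))"
      by (rule Bochner_Integration.integrable_sum) (use 1 in auto)
    have 5: "integrable M (\<lambda>\<omega>. \<Sum>j<n. a j \<omega> * d j \<omega>)"
      using A(1) by (intro Bochner_Integration.integrable_sum) auto
    have 6: "expectation (\<lambda>\<omega>. \<Sum>j<n. a j \<omega> * d j \<omega>) = (\<Sum>j<n. expectation (\<lambda>\<omega>. a j \<omega> * d j \<omega>))"
      using A(1) by (intro Bochner_Integration.integral_sum) auto
    show ?thesis unfolding Q_def Bochner_Integration.integral_add[OF 5 4] 6 3 using 2 by simp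
  qed
  also have "\<dots> = (\<Sum>j<n. ?h * expectation (\<lambda>\<omega>. a j \<omega> * b j \<omega>)) + (\<Sum>j<n. \<Sum>l<n. ?h\<^sup>2 * expectation (\<lambda>\<omega>. c j l \<omega> * b j \<omega> * b l \<omega>)
     + (if j = l then ?h else 0) * expectation (c j l))"
    using A(2) C(2) by simp
  also have "\<dots> = ?h * expectation L + (\<Sum>j<n. \<Sum>l<n. ?h\<^sup>2 * expectation (\<lambda>\<omega>. c j l \<omega> * b j \<omega> * b l \<omega>))"
    unfolding EL by (simp add: sum.distrib sum_distrib_left distrib_left if_distrib[of "\<lambda>c. c * _"] cong: if_cong)
  finally have EQ: "expectation Q = ?h * expectation L + (\<Sum>j<n. \<Sum>l<n. ?h\<^sup>2 * expectation (\<lambda>\<omega>. c j l \<omega> * b j \<omega> * b l \<omega>))" .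
  have "- (B ^ 3) \<le> expectation (\<lambda>\<omega>. c j l \<omega> * b j \<omega> * b l \<omega>)" if "j < n" "l < n" for j l
  proof -
    have "expectation (\<lambda>\<omega>. - (B ^ 3)) \<le> expectation (\<lambda>\<omega>. c j l \<omega> * b j \<omega> * b l \<omega>)"
      using past_bounded_integrable[OF st cbb[OF that] cbbB[OF that]] cbbB[OF that]
      by (intro integral_mono) (auto simp: power3_eq_cube abs_le_iff; smt (verit))+
    then show ?thesis by (simp add: prob_space)
  qed
  then have "(\<Sum>j<n. \<Sum>l<n. ?h\<^sup>2 * - (B ^ 3)) \<le> (\<Sum>j<n. \<Sum>l<n. ?h\<^sup>2 * expectation (\<lambda>\<omega>. c j l \<omega> * b j \<omega> * b l \<omega>))"
    by (intro sum_mono mult_left_mono) auto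
  moreover have "(\<Sum>j<n. \<Sum>l<n. ?h\<^sup>2 * - (B ^ 3)) = - ((real n)\<^sup>2 * B ^ 3 * ?h\<^sup>2)"
    by (simp add: power2_eq_square)
  ultimately show "?h * expectation L - (real n)\<^sup>2 * B ^ 3 * ?h\<^sup>2 \<le> expectation Q"
    unfolding EQ by linarith
qed

end

section \<open>Euler steps and Dynkin's inequality\<close>

context market
begin

definition max_weight :: "real \<Rightarrow> real" where "max_weight K = 1 - \<delta> - 1 / K"
text \<open>In the region every capitalization is at least \<open>1 / K\<close> and the total at
  most \<open>n * K\<close>.\<close>

definition min_weight :: "real \<Rightarrow> real" where "min_weight K = 1 / (real n * K\<^sup>2)"
text \<open>\<open>g\<close> may be unbounded towards both ends of its interval. Clamping its
  argument gives a bounded continuous function on the whole line that agrees with \<open>g\<close>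
  along every path inside the region.\<close>

definition g_clamp :: "real \<Rightarrow> real \<Rightarrow> real" where "g_clamp K x = g (max (min_weight K) (min (max_weight K) x))"

text \<open>\<open>4 \<le> K\<close> and \<open>\<delta> < 1 / 2\<close> keep
  \<open>max_weight K\<close> at least \<open>1 / 4\<close>, and \<open>min_weight K\<close> is at
  most \<open>1 / 4\<close>.\<close>

lemma min_max_weight:
  assumes "4 \<le> K"
  shows "0 < min_weight K" "min_weight K \<le> max_weight K" "max_weight K < 1 - \<delta>" "0 < max_weight K"
proof -
  have "1 / K \<le> 1 / 4" using assms by (intro divide_left_mono) auto
  then have x: "1 / 4 \<le> max_weight K" using delta by (simp add: max_weight_def)
  have "4 * 1 \<le> K * K" using assms by (intro mult_mono) auto
  then have "1 * 4 \<le> real n * K\<^sup>2" using n2 by (intro mult_mono) (auto simp: power2_eq_square)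
  then have "min_weight K \<le> 1 / 4" unfolding min_weight_def by (intro divide_left_mono) auto
  then show "min_weight K \<le> max_weight K" using x by linarith
  show "0 < max_weight K" using x by linarith
  show "0 < min_weight K" using assms n2 by (auto simp: min_weight_def)
  show "max_weight K < 1 - \<delta>" using assms by (simp add: max_weight_def)
qed

lemma in_region_sum_pos:
  assumes "0 < K" "in_region K x"
  shows "0 < (\<Sum>j<n. x j)"
proof -
  have "0 < 1 / K" using assms by simp
  then have "0 < x j" if "j < n" for j using assms(2) that unfolding in_region_def by (meson less_le_trans)
  then show ?thesis using n2 lessThan_empty_iff[of n] by (intro sum_pos) auto
qed

lemma in_region_weights:
  assumes K: "0 < K" and in_region: "in_region K x"
  shows "weights n (\<lambda>j. x j / (\<Sum>j<n. x j))" "\<And>j. j < n \<Longrightarrow> min_weight K \<le> x j / (\<Sum>j<n. x j) \<and> x j / (\<Sum>j<n. x j) \<le> max_weight K"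
proof -
  let ?S = "\<Sum>j<n. x j"
  have S: "0 < ?S" by (rule in_region_sum_pos[OF K in_region])
  have x: "1 / K \<le> x j" "x j \<le> K" "x j \<le> max_weight K * ?S" if "j < n" for j
    using in_region that by (auto simp: in_region_def max_weight_def)
  have "0 < 1 / K" using K by simp
  then have x0: "0 \<le> x j" if "j < n" for j using x(1)[OF that] by linarith
  show "weights n (\<lambda>j. x j / ?S)"
    using S x0 by (auto simp: weights_def simp flip: sum_divide_distrib)
  fix j assume j: "j < n"
  have "?S \<le> (\<Sum>j<n. K)" using x(2) by (intro sum_mono) auto
  then have "?S \<le> real n * K" by simp
  then have "(1 / K) / (real n * K) \<le> x j / ?S"
    using x(1)[OF j] x0[OF j] S by (intro frac_le) auto
  moreover have "(1 / K) / (real n * K) = min_weight K" by (simp add: min_weight_def power2_eq_square)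
  ultimately show "min_weight K \<le> x j / ?S \<and> x j / ?S \<le> max_weight K"
    using x(3)[OF j] S by (simp add: pos_divide_le_eq)
qed

lemma alive_weights:
  assumes "0 < K" "\<omega> \<in> alive K t"
  shows "weights n (\<lambda>j. \<mu> j t \<omega>)" "\<And>j. j < n \<Longrightarrow> min_weight K \<le> \<mu> j t \<omega> \<and> \<mu> j t \<omega> \<le> max_weight K"
  using in_region_weights[OF assms(1) alive_in_region[OF assms(2)]] by (auto simp: mkt_weight_def total_cap_def)

lemma g_clamp_eq: "min_weight K \<le> x \<Longrightarrow> x \<le> max_weight K \<Longrightarrow> g_clamp K x = g x"
  by (simp add: g_clamp_def max_def min_def)

lemma g_clamp_continuous: "4 \<le> K \<Longrightarrow> continuous_on UNIV (g_clamp K)"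
  unfolding g_clamp_def using min_max_weight[of K]
  by (intro continuous_on_compose2[OF g_continuous] continuous_intros) auto

lemma g_clamp_bounded:
  assumes "4 \<le> K"
  obtains B where "\<And>x. \<bar>g_clamp K x\<bar> \<le> B"
proof -
  have "continuous_on {min_weight K..max_weight K} g"
    by (rule continuous_on_subset[OF g_continuous]) (use min_max_weight[OF assms] in auto)
  then have "bounded (g ` {min_weight K..max_weight K})" by (intro compact_imp_bounded compact_continuous_image) auto
  then obtain B where "\<forall>x\<in>{min_weight K..max_weight K}. \<bar>g x\<bar> \<le> B" by (auto simp: bounded_iff)
  then show thesis using min_max_weight[OF assms] by (intro that[of B]) (auto simp: g_clamp_def)
qed

lemma g_clamp_measurable [measurable]: "4 \<le> K \<Longrightarrow> g_clamp K \<in> borel_measurable borel"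
  by (rule borel_measurable_continuous_onI[OF g_clamp_continuous])

end

text \<open>The generator bound is asked for weights inside the region, whereas \<open>f\<close> is
  smooth on the whole line, since an Euler step may land anywhere in \<open>{0..1}\<close>. The sign
  of \<open>c\<close> is free, so that \<open>- f\<close> can be treated as well.\<close>

locale market_test_function = market M n W \<delta> g x0 X for M :: "'a measure" and n W \<delta> g x0 X +
  fixes K :: real and f f1 f2 :: "real \<Rightarrow> real" and i :: nat and c :: real
  assumes K4: "4 \<le> K" and i: "i < n"
    and df: "\<And>x. (f has_real_derivative f1 x) (at x)"
    and df1: "\<And>x. (f1 has_real_derivative f2 x) (at x)"
    and cf2: "continuous_on UNIV f2"
    and drift: "\<And>p. weights n p \<Longrightarrow> (\<And>j. j < n \<Longrightarrow> min_weight K \<le> p j \<and> p j \<le> max_weight K) \<Longrightarrow>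
      c \<le> (\<Sum>j<n. grad f1 i p j * - g (p j)) + (\<Sum>j<n. hess f1 f2 i p j j)"
begin

lemma f_measurable [measurable]: "f \<in> borel_measurable borel"
  "f1 \<in> borel_measurable borel" "f2 \<in> borel_measurable borel"
  using df df1 cf2
  by (auto intro!: borel_measurable_continuous_onI continuous_at_imp_continuous_on intro: DERIV_isCont)

lemma K0: "0 < K" using K4 by simp

text \<open>The drift is frozen at the start of the step and the noise is kept exact. As
  \<open>next_weight\<close> applies this to the true weights at time \<open>s\<close>, and not to
  an earlier Euler iterate, errors do not propagate from step to step.\<close>

definition euler :: "real \<Rightarrow> real \<Rightarrow> nat \<Rightarrow> 'a \<Rightarrow> real" where
  "euler s t j \<omega> = - g_clamp K (\<mu> j s \<omega>) * (t - s) + incr s t j \<omega>"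

definition next_weight :: "real \<Rightarrow> real \<Rightarrow> 'a \<Rightarrow> real" where
  "next_weight s t \<omega> = softmax n i (\<lambda>j. \<mu> j s \<omega>) (\<lambda>j. euler s t j \<omega>)"

lemma euler_measurable [measurable]: "j < n \<Longrightarrow> 0 \<le> s \<Longrightarrow> 0 \<le> t \<Longrightarrow> euler s t j \<in> borel_measurable M"
  using K4 unfolding euler_def[abs_def] by measurable

lemma next_weight_measurable [measurable]: "0 \<le> s \<Longrightarrow> 0 \<le> t \<Longrightarrow> next_weight s t \<in> borel_measurable M"
  using i unfolding next_weight_def[abs_def] softmax_def by measurable

lemma unit_bounds:
  obtains B where "0 \<le> B" "\<And>x. x \<in> {0..1} \<Longrightarrow> \<bar>f x\<bar> \<le> B" "\<And>x. x \<in> {0..1} \<Longrightarrow> \<bar>f1 x\<bar> \<le> B"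
    "\<And>x. x \<in> {0..1} \<Longrightarrow> \<bar>f2 x\<bar> \<le> B" "\<And>x. \<bar>g_clamp K x\<bar> \<le> B"
proof -
  have c: "continuous_on {0..1} f" "continuous_on {0..1} f1" "continuous_on {0..1} f2"
    using df df1 continuous_on_subset[OF cf2]
    by (auto intro!: continuous_at_imp_continuous_on intro: DERIV_isCont)
  obtain B0 where B0: "\<And>x. x \<in> {0..1} \<Longrightarrow> \<bar>f x\<bar> \<le> B0" using continuous_bounded_unit[OF c(1)] by blast
  obtain B1 where B1: "\<And>x. x \<in> {0..1} \<Longrightarrow> \<bar>f1 x\<bar> \<le> B1" using continuous_bounded_unit[OF c(2)] by blast
  obtain B2 where B2: "\<And>x. x \<in> {0..1} \<Longrightarrow> \<bar>f2 x\<bar> \<le> B2" using continuous_bounded_unit[OF c(3)] by blast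
  obtain B3 where B3: "\<And>x. \<bar>g_clamp K x\<bar> \<le> B3" by (rule g_clamp_bounded[OF K4]) blast
  show thesis
    by (rule that[of "\<bar>B0\<bar> + \<bar>B1\<bar> + \<bar>B2\<bar> + \<bar>B3\<bar>"])
      (use B0 B1 B2 B3 in \<open>(simp; fail) | (smt (verit, best))\<close>)+
qed

text \<open>Dynkin's inequality for a single step, with an error that stays small when summed over a
  grid: \<open>eps\<close> times the total time plus \<open>C\<close> times the total time times the
  mesh. The indicator of \<open>alive K s\<close> makes the Taylor coefficients bounded and leaves
  them measurable in the past.\<close>

lemma step_expectation:
  assumes eps: "0 < eps"
  obtains C where "0 \<le> C" "\<And>s t. 0 \<le> s \<Longrightarrow> s < t \<Longrightarrow> t - s \<le> 1 \<Longrightarrow>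
    integrable M (\<lambda>\<omega>. indicator (alive K s) \<omega> * (f (next_weight s t \<omega>) - f (\<mu> i s \<omega>))) \<and>
    c * (t - s) * prob (alive K s) - eps * (t - s) - C * (t - s)\<^sup>2
     \<le> expectation (\<lambda>\<omega>. indicator (alive K s) \<omega> * (f (next_weight s t \<omega>) - f (\<mu> i s \<omega>)))"
proof -
  obtain B' where B': "0 \<le> B'" "\<And>x. x \<in> {0..1} \<Longrightarrow> \<bar>f x\<bar> \<le> B'" "\<And>x. x \<in> {0..1} \<Longrightarrow> \<bar>f1 x\<bar> \<le> B'"
    "\<And>x. x \<in> {0..1} \<Longrightarrow> \<bar>f2 x\<bar> \<le> B'" "\<And>x. \<bar>g_clamp K x\<bar> \<le> B'" using unit_bounds by blast
  define B where "B = 2 * B'"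
  have B0: "0 \<le> B" using B' by (simp add: B_def)
  \<comment> \<open>For the majorant \<open>r\<close> introduced below, \<open>expectation r\<close>
    is at most \<open>2 * real n * (B\<^sup>2 + 1) * (t - s)\<close>.\<close>
  define e where "e = eps / (2 * real n * (B\<^sup>2 + 1))"
  have e: "0 < e" using eps n2 by (auto simp: e_def intro!: divide_pos_pos mult_pos_pos add_nonneg_pos)
  obtain C0 where C0: "0 \<le> C0" "\<And>n i p d. weights n p \<Longrightarrow> i < n \<Longrightarrow>
     f (p i) + (\<Sum>j<n. grad f1 i p j * d j) + (\<Sum>j<n. \<Sum>l<n. hess f1 f2 i p j l * (d j * d l))
       - e * (\<Sum>j<n. (d j)\<^sup>2) - C0 * (\<Sum>j<n. (d j)\<^sup>2)\<^sup>2 \<le> f (softmax n i p d)"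
    using one_step[OF df df1 continuous_on_subset[OF cf2 subset_UNIV] e] by blast
  show thesis
  proof (rule that)
    show "0 \<le> (real n)\<^sup>2 * B ^ 3 + C0 * (8 * (real n)\<^sup>2 * (B ^ 4 + 3))" using B0 C0(1) by auto
    fix s t :: real assume st: "0 \<le> s" "s < t" and h1: "t - s \<le> 1"
    let ?h = "t - s" and ?A = "alive K s" and ?p = "\<lambda>\<omega> j. \<mu> j s \<omega>"
    define a where "a j \<omega> = indicator ?A \<omega> * grad f1 i (?p \<omega>) j" for j \<omega>
    define b where "b j \<omega> = - g_clamp K (\<mu> j s \<omega>)" for j \<omega>
    define cc where "cc j l \<omega> = indicator ?A \<omega> * hess f1 f2 i (?p \<omega>) j l" for j l \<omega>
    have mA [measurable]: "?A \<in> sets (past s)" using st by (intro alive_past)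
    have mw [measurable]: "\<mu> j s \<in> borel_measurable (past s)" if "j < n" for j using weight_past[OF that] st by auto
    have wi: "\<mu> i s \<in> borel_measurable (past s)" using i by (rule mw)
    have am: "a j \<in> borel_measurable (past s)" if "j < n" for j
      unfolding a_def[abs_def] grad_def using mw[OF that] wi by measurable
    have bm: "b j \<in> borel_measurable (past s)" if "j < n" for j
      unfolding b_def[abs_def] using mw[OF that] K4 by measurable
    have cm: "cc j l \<in> borel_measurable (past s)" if "j < n" "l < n" for j l
      unfolding cc_def[abs_def] hess_def using mw[OF that(1)] mw[OF that(2)] wi by measurable
    have W: "weights n (?p \<omega>)" "\<And>j. j < n \<Longrightarrow> min_weight K \<le> ?p \<omega> j \<and> ?p \<omega> j \<le> max_weight K" if "\<omega> \<in> ?A" for \<omega>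
      using alive_weights[OF K0 that] by auto
    have W01: "?p \<omega> j \<in> {0..1}" if "\<omega> \<in> ?A" "j < n" for \<omega> j
      using weights_le_1[OF W(1)[OF that(1)] that(2)] by auto
    have mul1: "\<bar>x * y\<bar> \<le> C" if "\<bar>x\<bar> \<le> C" "\<bar>y\<bar> \<le> 1" for x y C :: real
      using mult_mono[of "\<bar>x\<bar>" C "\<bar>y\<bar>" 1] that by (simp add: abs_mult)
    have k1: "\<bar>kron j l - x\<bar> \<le> 1" if "x \<in> {0..1}" for j l x using that by (auto simp: kron_def)
    have aB: "\<bar>a j \<omega>\<bar> \<le> B" if "j < n" for j \<omega>
    proof (cases "\<omega> \<in> ?A")
      case True
      have "\<bar>f1 (?p \<omega> i) * ?p \<omega> i * (kron j i - ?p \<omega> j)\<bar> \<le> B'"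
        using B'(3)[OF W01[OF True i]] W01[OF True i] W01[OF True that] k1[OF W01[OF True that]]
        by (intro mul1) auto
      then show ?thesis using True B'(1) by (simp add: a_def grad_def B_def)
    next
      case False
      then show ?thesis using B0 by (simp add: a_def)
    qed
    have bB: "\<bar>b j \<omega>\<bar> \<le> B" for j \<omega> using B'(1) B'(5)[of "\<mu> j s \<omega>"] by (simp add: b_def B_def)
    have cB: "\<bar>cc j l \<omega>\<bar> \<le> B" if "j < n" "l < n" for j l \<omega>
    proof (cases "\<omega> \<in> ?A")
      case True
      note w = W01[OF True i] W01[OF True that(1)] W01[OF True that(2)]
      have 1: "\<bar>f1 (?p \<omega> i) * ?p \<omega> i\<bar> \<le> B'" using B'(3)[OF w(1)] w by (intro mul1) auto
      have 2: "\<bar>f2 (?p \<omega> i) * (?p \<omega> i)\<^sup>2\<bar> \<le> B'" using B'(4)[OF w(1)] w by (intro mul1) (auto simp: power_le_one)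
      have 3: "\<bar>(f2 (?p \<omega> i) * (?p \<omega> i)\<^sup>2 + f1 (?p \<omega> i) * ?p \<omega> i) / 2 * ((kron j i - ?p \<omega> j) * (kron l i - ?p \<omega> l))\<bar> \<le> B'"
        using 1 2 k1[OF w(2), of j i] k1[OF w(3), of l i] by (intro mul1) auto
      have 4: "\<bar>?p \<omega> j * ?p \<omega> l - kron j l * ?p \<omega> j\<bar> \<le> 1"
      proof -
        have "?p \<omega> j * ?p \<omega> l - kron j l * ?p \<omega> j = ?p \<omega> j * (?p \<omega> l - kron j l)" by (simp add: algebra_simps)
        also have "\<bar>\<dots>\<bar> \<le> 1" using w k1[OF w(3), of j l] by (intro mul1) auto
        finally show ?thesis .
      qed
      have "\<bar>f1 (?p \<omega> i) * ?p \<omega> i / 2 * (?p \<omega> j * ?p \<omega> l - kron j l * ?p \<omega> j)\<bar> \<le> B'"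
        using 1 4 B'(1) by (intro mul1) auto
      then show ?thesis using True 3 B'(1) unfolding cc_def hess_def B_def by simp
    next
      case False
      then show ?thesis using B0 by (simp add: cc_def)
    qed
    define d where "d j \<omega> = b j \<omega> * ?h + incr s t j \<omega>" for j \<omega>
    have d_eq: "euler s t j \<omega> = d j \<omega>" for j \<omega> by (simp add: euler_def d_def b_def)
    define Q where "Q \<omega> = (\<Sum>j<n. a j \<omega> * d j \<omega>) + (\<Sum>j<n. \<Sum>l<n. cc j l \<omega> * (d j \<omega> * d l \<omega>))" for \<omega>
    define L where "L \<omega> = (\<Sum>j<n. a j \<omega> * b j \<omega>) + (\<Sum>j<n. cc j j \<omega>)" for \<omega>
    note quad = quadratic_expectation[where a=a and b=b and c=cc and B=B, OF st am aB bm bB cm cB, folded d_def, folded Q_def L_def]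
    have cA: "c * indicator ?A \<omega> \<le> L \<omega>" for \<omega>
    proof (cases "\<omega> \<in> ?A")
      case True
      have "c \<le> (\<Sum>j<n. grad f1 i (?p \<omega>) j * - g (?p \<omega> j)) + (\<Sum>j<n. hess f1 f2 i (?p \<omega>) j j)"
        using W[OF True] by (intro drift) auto
      also have "\<dots> = L \<omega>" using True W(2)[OF True] by (simp add: L_def a_def b_def cc_def g_clamp_eq)
      finally show ?thesis using True by simp
    next
      case False then show ?thesis by (simp add: L_def a_def cc_def)
    qed
    have "expectation (\<lambda>\<omega>. c * indicator ?A \<omega>) \<le> expectation L"
      using quad(2) cA st by (intro integral_mono) (auto intro!: integrable_mult_right integrable_real_indicator simp: emeasure_eq_measure)
    then have EL: "c * prob ?A \<le> expectation L" using st by simp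
    \<comment> \<open>Majorants of the second and fourth power of the norm of \<open>d\<close>, with
      the random drift replaced by its bound so that their expectations are explicit.\<close>
    define r where "r \<omega> = (\<Sum>j<n. 2 * (B\<^sup>2 * ?h\<^sup>2 + (incr s t j \<omega>)\<^sup>2))" for \<omega>
    define r2 where "r2 \<omega> = real n * (\<Sum>j<n. 8 * (B ^ 4 * ?h ^ 4 + (incr s t j \<omega>) ^ 4))" for \<omega>
    note mom = incr_moments[OF st]
    have ri: "integrable M r" and r2i: "integrable M r2" unfolding r_def r2_def using mom(3,5) by auto
    have Er: "expectation r = real n * (2 * (B\<^sup>2 * ?h\<^sup>2 + ?h))"
      unfolding r_def using mom(3,4) by (subst Bochner_Integration.integral_sum) (auto simp: prob_space)
    have Er2: "expectation r2 = (real n)\<^sup>2 * (8 * (B ^ 4 * ?h ^ 4 + 3 * ?h\<^sup>2))"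
    proof -
      have "expectation (\<lambda>\<omega>. \<Sum>j<n. 8 * (B ^ 4 * ?h ^ 4 + (incr s t j \<omega>) ^ 4)) = real n * (8 * (B ^ 4 * ?h ^ 4 + 3 * ?h\<^sup>2))"
        using mom(5,6) by (subst Bochner_Integration.integral_sum) (auto simp: prob_space)
      then show ?thesis unfolding r2_def by (simp add: power2_eq_square)
    qed
    have bh: "(b j \<omega> * ?h)\<^sup>2 \<le> B\<^sup>2 * ?h\<^sup>2" for j \<omega>
      using abs_le_square_iff[of "b j \<omega>" B] bB[of j \<omega>] B0 by (auto simp: power_mult_distrib intro!: mult_right_mono)
    have sq2: "(x + y)\<^sup>2 \<le> 2 * (x\<^sup>2 + y\<^sup>2)" for x y :: real
      using zero_le_power2[of "x - y"] by (simp add: power2_eq_square algebra_simps)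
    have d2: "(d j \<omega>)\<^sup>2 \<le> 2 * (B\<^sup>2 * ?h\<^sup>2 + (incr s t j \<omega>)\<^sup>2)" for j \<omega>
      unfolding d_def by (rule order_trans[OF sq2]) (use bh in simp)
    have d4: "((d j \<omega>)\<^sup>2)\<^sup>2 \<le> 8 * (B ^ 4 * ?h ^ 4 + (incr s t j \<omega>) ^ 4)" for j \<omega>
    proof -
      have "((d j \<omega>)\<^sup>2)\<^sup>2 \<le> (2 * (B\<^sup>2 * ?h\<^sup>2 + (incr s t j \<omega>)\<^sup>2))\<^sup>2" using d2[of j \<omega>] by (intro power_mono) auto
      also have "\<dots> = 4 * (B\<^sup>2 * ?h\<^sup>2 + (incr s t j \<omega>)\<^sup>2)\<^sup>2" by (subst power_mult_distrib) simp
      also have "\<dots> \<le> 4 * (2 * ((B\<^sup>2 * ?h\<^sup>2)\<^sup>2 + ((incr s t j \<omega>)\<^sup>2)\<^sup>2))" by (intro mult_left_mono sq2) auto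
      also have "\<dots> = 8 * (B ^ 4 * ?h ^ 4 + (incr s t j \<omega>) ^ 4)" by (simp add: power_mult_distrib flip: power_mult)
      finally show ?thesis .
    qed
    have rb: "(\<Sum>j<n. (d j \<omega>)\<^sup>2) \<le> r \<omega>" for \<omega> unfolding r_def by (intro sum_mono d2)
    have r2b: "(\<Sum>j<n. (d j \<omega>)\<^sup>2)\<^sup>2 \<le> r2 \<omega>" for \<omega>
    proof -
      have "(\<Sum>j<n. (d j \<omega>)\<^sup>2)\<^sup>2 \<le> (\<Sum>j<n. ((d j \<omega>)\<^sup>2)\<^sup>2) * real (card {..<n})" by (rule sum_squared_le_sum_of_squares)
      also have "\<dots> \<le> (\<Sum>j<n. 8 * (B ^ 4 * ?h ^ 4 + (incr s t j \<omega>) ^ 4)) * real n"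
        unfolding card_lessThan by (intro mult_right_mono sum_mono d4) auto
      finally show ?thesis by (simp add: r2_def mult.commute)
    qed
    have r0: "0 \<le> r \<omega>" "0 \<le> r2 \<omega>" for \<omega>
      using rb[of \<omega>] r2b[of \<omega>] by (auto intro: order_trans[rotated] sum_nonneg zero_le_power2)
    let ?G = "\<lambda>\<omega>. indicator ?A \<omega> * (f (next_weight s t \<omega>) - f (\<mu> i s \<omega>))"
    have pw: "Q \<omega> - e * r \<omega> - C0 * r2 \<omega> \<le> ?G \<omega>" for \<omega>
    proof (cases "\<omega> \<in> ?A")
      case True
      have "e * (\<Sum>j<n. (d j \<omega>)\<^sup>2) \<le> e * r \<omega>" "C0 * (\<Sum>j<n. (d j \<omega>)\<^sup>2)\<^sup>2 \<le> C0 * r2 \<omega>"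
        using rb r2b e C0(1) by (auto intro!: mult_left_mono)
      moreover have "f (?p \<omega> i) + Q \<omega> - e * (\<Sum>j<n. (d j \<omega>)\<^sup>2) - C0 * (\<Sum>j<n. (d j \<omega>)\<^sup>2)\<^sup>2 \<le> f (next_weight s t \<omega>)"
        using C0(2)[OF W(1)[OF True] i, of "\<lambda>j. d j \<omega>"] True unfolding next_weight_def d_eq
        by (simp add: Q_def a_def cc_def add.assoc)
      ultimately show ?thesis using True by simp
    next
      case False
      then have "Q \<omega> = 0" by (simp add: Q_def a_def cc_def)
      moreover have "0 \<le> e * r \<omega>" "0 \<le> C0 * r2 \<omega>" using r0[of \<omega>] e C0(1) by auto
      ultimately show ?thesis using False by simp
    qed
    have Gi: "integrable M ?G"
    proof (rule bounded_integrable[where B="2 * B'"])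
      show "?G \<in> borel_measurable M"
      proof -
        have [measurable]: "next_weight s t \<in> borel_measurable M" "\<mu> i s \<in> borel_measurable M"
          using st i by (auto intro: next_weight_measurable weight_measurable)
        show ?thesis using st by measurable
      qed
      fix \<omega> show "\<bar>?G \<omega>\<bar> \<le> 2 * B'"
      proof (cases "\<omega> \<in> ?A")
        case True
        have "next_weight s t \<omega> \<in> {0..1}"
          using weights_le_1[OF weights_softmax[OF W(1)[OF True]] i] by (auto simp: next_weight_def)
        then show ?thesis using B'(2)[of "next_weight s t \<omega>"] B'(2)[OF W01[OF True i]] True by auto
      qed (use B' in auto)
    qed
    have "expectation (\<lambda>\<omega>. Q \<omega> - e * r \<omega> - C0 * r2 \<omega>) \<le> expectation ?G"
      using quad(1) ri r2i Gi pw by (intro integral_mono) auto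
    then have E: "expectation Q - e * expectation r - C0 * expectation r2 \<le> expectation ?G"
      using quad(1) ri r2i by simp
    have hh: "?h\<^sup>2 \<le> ?h" "?h ^ 4 \<le> ?h\<^sup>2"
      using h1 st power_decreasing[of 1 2 ?h] power_decreasing[of 2 4 ?h] by auto
    have "e * expectation r \<le> e * (real n * (2 * ((B\<^sup>2 + 1) * ?h)))"
      unfolding Er using e hh(1) by (intro mult_left_mono) (auto simp: distrib_right intro!: mult_left_mono)
    also have "\<dots> = (e * (2 * real n * (B\<^sup>2 + 1))) * ?h" by simp
    also have "\<dots> = eps * ?h"
    proof -
      have "2 * real n * (B\<^sup>2 + 1) \<noteq> 0" using n2 by (simp add: add_nonneg_eq_0_iff)
      then show ?thesis by (simp add: e_def)
    qed
    finally have 1: "e * expectation r \<le> eps * ?h" .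
    have 2: "C0 * expectation r2 \<le> C0 * ((real n)\<^sup>2 * (8 * ((B ^ 4 + 3) * ?h\<^sup>2)))"
      unfolding Er2 using C0(1) hh(2) B0 by (intro mult_left_mono) (auto simp: distrib_right intro!: mult_left_mono)
    have 3: "?h * (c * prob ?A) \<le> ?h * expectation L" using EL st by (intro mult_left_mono) auto
    show "integrable M ?G \<and> c * ?h * prob ?A - eps * ?h - ((real n)\<^sup>2 * B ^ 3 + C0 * (8 * (real n)\<^sup>2 * (B ^ 4 + 3))) * ?h\<^sup>2 \<le> expectation ?G"
      using E 1 2 3 quad(3) Gi by (simp add: algebra_simps)
  qed
qed

end

text \<open>\<open>P\<close> holds on an initial segment, so terms come in three kinds: steps inside
  it, one exit step, and zeros afterwards.\<close>

lemma antimono_sum_bound: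
  fixes e :: "nat \<Rightarrow> real"
  assumes P: "\<And>k. P (Suc k) \<Longrightarrow> P k"
    and a: "\<And>k. k < N \<Longrightarrow> P (Suc k) \<Longrightarrow> \<bar>e k\<bar> \<le> a"
    and b: "\<And>k. k < N \<Longrightarrow> P k \<Longrightarrow> \<not> P (Suc k) \<Longrightarrow> \<bar>e k\<bar> \<le> b"
    and z: "\<And>k. \<not> P k \<Longrightarrow> e k = 0" and "0 \<le> a" "0 \<le> b"
  shows "\<bar>\<Sum>k<N. e k\<bar> \<le> real N * a + b"
proof -
  have "\<bar>\<Sum>k<m. e k\<bar> \<le> real m * a + (if P m then 0 else b)" if "m \<le> N" for m
    using that
  proof (induction m)
    case 0 then show ?case using assms by simp
  next
    case (Suc m)
    then have IH: "\<bar>\<Sum>k<m. e k\<bar> \<le> real m * a + (if P m then 0 else b)" by simp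
    have "\<bar>e m\<bar> \<le> (if P (Suc m) then a else if P m then b else 0)"
      using a[of m] b[of m] z[of m] Suc.prems by auto
    with IH P[of m] show ?case
      using \<open>0 \<le> a\<close> by (auto simp: distrib_right split: if_splits)
  qed
  from this[of N] show ?thesis using \<open>0 \<le> b\<close> by (auto split: if_splits)
qed

text \<open>The sum stops at the last index \<open>m\<close> of the initial segment on which
  \<open>P\<close> holds. If \<open>P\<close> fails already at 0, all terms vanish and
  \<open>m = 0\<close>, which is why \<open>P m\<close> is claimed for positive \<open>m\<close>
  only.\<close>

lemma antimono_telescope:
  fixes a :: "nat \<Rightarrow> real"
  assumes P: "\<And>k. P (Suc k) \<Longrightarrow> P k"
  obtains m where "m \<le> N" "(\<Sum>k<N. if P (Suc k) then a (Suc k) - a k else 0) = a m - a 0"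
    "m = 0 \<or> P m" "m < N \<Longrightarrow> \<not> P (Suc m)"
proof -
  have mono: "P k \<Longrightarrow> m \<le> k \<Longrightarrow> P m" for m k
    by (induction k) (auto simp: le_Suc_eq P)
  have "\<exists>m\<le>N. (\<Sum>k<N. if P (Suc k) then a (Suc k) - a k else 0) = a m - a 0 \<and> (m = 0 \<or> P m) \<and> (m < N \<longrightarrow> \<not> P (Suc m))"
  proof (induction N)
    case 0 then show ?case by auto
  next
    case (Suc N)
    then obtain m where m: "m \<le> N" "(\<Sum>k<N. if P (Suc k) then a (Suc k) - a k else 0) = a m - a 0"
      "m = 0 \<or> P m" "m < N \<longrightarrow> \<not> P (Suc m)" by blast
    show ?case
    proof (cases "P (Suc N)")
      case True
      then have "m = N" using m(1,4) mono[of "Suc N" "Suc m"] by (cases "m < N") auto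
      then show ?thesis using m(2) True by (intro exI[of _ "Suc N"]) auto
    next
      case False
      then show ?thesis using m by (intro exI[of _ m]) (auto simp: less_Suc_eq)
    qed
  qed
  then show thesis using that by blast
qed

lemma uniform_modulus:
  fixes \<phi> :: "real \<Rightarrow> real"
  assumes "continuous_on {0..T} \<phi>" "0 < e"
  shows "\<forall>\<^sub>F N in sequentially. \<forall>s\<in>{0..T}. \<forall>r\<in>{0..T}. \<bar>r - s\<bar> \<le> T / real N \<longrightarrow> \<bar>\<phi> r - \<phi> s\<bar> \<le> e"
proof -
  have "uniformly_continuous_on {0..T} \<phi>" using assms(1) by (intro compact_uniformly_continuous) auto
  then obtain d where d: "0 < d" "\<And>r s. r \<in> {0..T} \<Longrightarrow> s \<in> {0..T} \<Longrightarrow> \<bar>r - s\<bar> < d \<Longrightarrow> \<bar>\<phi> r - \<phi> s\<bar> < e"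
    using assms(2) unfolding uniformly_continuous_on_def dist_real_def by metis
  have "(\<lambda>N. T / real N) \<longlonglongrightarrow> 0" by (rule lim_const_over_n)
  then have "\<forall>\<^sub>F N in sequentially. T / real N < d" using d(1) by (rule order_tendstoD)
  then show ?thesis by eventually_elim (use d(2) in \<open>fastforce intro: less_imp_le\<close>)
qed

context market
begin

lemma regular_weight_0: "regular \<omega> \<Longrightarrow> i < n \<Longrightarrow> \<mu> i 0 \<omega> = init_weight i"
  by (simp add: mkt_weight_def total_cap_def init_weight_def regular_X(2))

lemma regular_log:
  assumes "regular \<omega>" "0 \<le> t" "\<And>s j. 0 \<le> s \<Longrightarrow> s \<le> t \<Longrightarrow> j < n \<Longrightarrow> 0 < X j s \<omega> \<and> \<mu> j s \<omega> < 1 - \<delta>" "j < n"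
  shows "ln (X j t \<omega>) = ln (x0 j) - integral {0..t} (\<lambda>s. g (\<mu> j s \<omega>)) + W j t \<omega>"
  using assms unfolding regular_def by auto

lemma alive_good:
  assumes "4 \<le> K" "regular \<omega>" "\<omega> \<in> alive K t" "0 \<le> s" "s \<le> t" "j < n"
  shows "0 < X j s \<omega>" "0 < \<mu> j s \<omega>" "\<mu> j s \<omega> < 1 - \<delta>"
proof -
  have a: "\<omega> \<in> alive K s" by (rule alive_antimono[OF assms(2-5)])
  have "0 < 1 / K" using assms(1) by simp
  then show "0 < X j s \<omega>" using alive_in_region[OF a] assms(6) unfolding in_region_def by (meson less_le_trans)
  show "0 < \<mu> j s \<omega>" "\<mu> j s \<omega> < 1 - \<delta>"
    using alive_weights(2)[OF _ a assms(6)] min_max_weight[OF assms(1)] assms(1) by auto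
qed

text \<open>After leaving the region capitalizations may reach 0 and the weights may become
  discontinuous. Raising each capitalization to at least \<open>1 / K\<close> keeps the quotient
  continuous at all times, so a uniform modulus on \<open>{0..T}\<close> exists without reference to
  the exit time.\<close>

definition clamped_weight :: "real \<Rightarrow> 'a \<Rightarrow> nat \<Rightarrow> real \<Rightarrow> real" where
  "clamped_weight K \<omega> j s = max (1 / K) (X j s \<omega>) / (\<Sum>l<n. max (1 / K) (X l s \<omega>))"

lemma clamped_weight_continuous:
  assumes "0 < K" "regular \<omega>" "j < n"
  shows "continuous_on {0..} (clamped_weight K \<omega> j)"
proof -
  have "0 < (\<Sum>l<n. max (1 / K) (X l s \<omega>))" for s
    using assms(1) n2 lessThan_empty_iff[of n] by (intro sum_pos) (auto simp: less_max_iff_disj)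
  then have "(\<Sum>l<n. max (1 / K) (X l s \<omega>)) \<noteq> 0" for s by (metis less_irrefl)
  then show ?thesis unfolding clamped_weight_def
    using regular_X(1)[OF assms(2)] assms(3) by (intro continuous_intros) auto
qed

lemma clamped_weight_eq:
  assumes "\<omega> \<in> alive K s" "j < n"
  shows "clamped_weight K \<omega> j s = \<mu> j s \<omega>"
proof -
  have "max (1 / K) (X l s \<omega>) = X l s \<omega>" if "l < n" for l
    using alive_in_region[OF assms(1)] that by (auto simp: in_region_def max_def)
  then show ?thesis using assms(2) by (simp add: clamped_weight_def mkt_weight_def total_cap_def)
qed

end

section \<open>Pathwise error of the Euler scheme\<close>

context market_test_function
begin

text \<open>The true step and the Euler step carry the same noise, so they differ by a tilt that
  integrates the variation of \<open>g\<close> along the path, at most \<open>e * (t - s)\<close>.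
  With small \<open>e\<close> this is of smaller order than the step.\<close>

lemma next_weight_close:
  assumes \<omega>: "regular \<omega>" "\<omega> \<in> alive K t" and st: "0 \<le> s" "s < t"
    and e: "\<And>r j. s \<le> r \<Longrightarrow> r \<le> t \<Longrightarrow> j < n \<Longrightarrow> \<bar>g_clamp K (\<mu> j r \<omega>) - g_clamp K (\<mu> j s \<omega>)\<bar> \<le> e"
  shows "\<bar>next_weight s t \<omega> - \<mu> i t \<omega>\<bar> \<le> 2 * (e * (t - s))"
proof -
  note good = alive_good[OF K4 \<omega>]
  have al: "\<omega> \<in> alive K r" if "0 \<le> r" "r \<le> t" for r by (rule alive_antimono[OF \<omega> that])
  have gc: "continuous_on {0..t} (\<lambda>r. g (\<mu> j r \<omega>))" if j: "j < n" for j
  proof -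
    have "continuous_on {0..t} (\<lambda>r. g_clamp K (clamped_weight K \<omega> j r))"
      by (rule continuous_on_compose2[OF g_clamp_continuous[OF K4] continuous_on_subset[OF clamped_weight_continuous[OF K0 \<omega>(1) j]]]) auto
    then show ?thesis
      by (rule continuous_on_eq) (use al alive_weights(2)[OF K0 al j] in \<open>auto simp: clamped_weight_eq j g_clamp_eq\<close>)
  qed
  define ds where "ds j = ln (X j t \<omega>) - ln (X j s \<omega>)" for j
  define dd where "dd j = euler s t j \<omega> - ds j" for j
  have dd: "\<bar>dd j\<bar> \<le> e * (t - s)" if j: "j < n" for j
  proof -
    have 1: "ln (X j t \<omega>) = ln (x0 j) - integral {0..t} (\<lambda>s. g (\<mu> j s \<omega>)) + W j t \<omega>"
      by (rule regular_log[OF \<omega>(1)]) (use st good j in auto)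
    have 2: "ln (X j s \<omega>) = ln (x0 j) - integral {0..s} (\<lambda>s. g (\<mu> j s \<omega>)) + W j s \<omega>"
      by (rule regular_log[OF \<omega>(1)]) (use st good j in auto)
    have "integral {0..s} (\<lambda>s. g (\<mu> j s \<omega>)) + integral {s..t} (\<lambda>s. g (\<mu> j s \<omega>)) = integral {0..t} (\<lambda>s. g (\<mu> j s \<omega>))"
      using st gc[OF j] by (intro Henstock_Kurzweil_Integration.integral_combine integrable_continuous_interval) auto
    then have "dd j = integral {s..t} (\<lambda>r. g (\<mu> j r \<omega>)) - g_clamp K (\<mu> j s \<omega>) * (t - s)"
      unfolding dd_def ds_def euler_def incr_def using 1 2 by simp
    also have "g_clamp K (\<mu> j s \<omega>) * (t - s) = integral {s..t} (\<lambda>r. g_clamp K (\<mu> j s \<omega>))" using st by simp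
    also have "integral {s..t} (\<lambda>r. g (\<mu> j r \<omega>)) - integral {s..t} (\<lambda>r. g_clamp K (\<mu> j s \<omega>))
       = integral {s..t} (\<lambda>r. g (\<mu> j r \<omega>) - g_clamp K (\<mu> j s \<omega>))"
      by (intro integral_diff[symmetric] integrable_continuous_interval continuous_on_subset[OF gc[OF j]] continuous_on_const)
        (use st in auto)
    finally have "dd j = integral {s..t} (\<lambda>r. g (\<mu> j r \<omega>) - g_clamp K (\<mu> j s \<omega>))" .
    moreover have "norm (integral {s..t} (\<lambda>r. g (\<mu> j r \<omega>) - g_clamp K (\<mu> j s \<omega>))) \<le> e * (t - s)"
    proof (rule integral_bound)
      show "continuous_on {s..t} (\<lambda>r. g (\<mu> j r \<omega>) - g_clamp K (\<mu> j s \<omega>))"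
        by (intro continuous_intros continuous_on_subset[OF gc[OF j]]) (use st in auto)
      fix r assume r: "r \<in> {s..t}"
      have "g_clamp K (\<mu> j r \<omega>) = g (\<mu> j r \<omega>)"
        using alive_weights(2)[OF K0 al j, of r] r st by (intro g_clamp_eq) auto
      then show "norm (g (\<mu> j r \<omega>) - g_clamp K (\<mu> j s \<omega>)) \<le> e" using e[of r j] r j by simp
    qed (use st in auto)
    ultimately show ?thesis by simp
  qed
  have Xs: "0 < X j s \<omega>" "0 < X j t \<omega>" if "j < n" for j using good(1)[of _ j] st that by auto
  have Ss: "0 < total_cap n X s \<omega>" "0 < total_cap n X t \<omega>"
    unfolding total_cap_def using in_region_sum_pos[OF K0 alive_in_region[OF al]] st by auto
  have ws: "weights n (\<lambda>j. \<mu> j s \<omega>)" by (rule alive_weights(1)[OF K0 al]) (use st in auto)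
  \<comment> \<open>The ratio of the totals cancels in the normalization, so tilting by the true log
    increments gives exactly the weights at time \<open>t\<close>.\<close>
  have "\<mu> j s \<omega> * exp (ds j) = X j t \<omega> / total_cap n X s \<omega>" if "j < n" for j
    using Xs[OF that] by (simp add: ds_def exp_diff mkt_weight_def)
  then have w: "softmax n j (\<lambda>j. \<mu> j s \<omega>) ds = \<mu> j t \<omega>" if "j < n" for j
    using that Ss by (simp add: softmax_def mkt_weight_def flip: sum_divide_distrib total_cap_def)
  have "next_weight s t \<omega> = softmax n i (\<lambda>j. \<mu> j s \<omega>) (\<lambda>j. ds j + dd j)"
    by (simp add: next_weight_def dd_def)
  also have "\<dots> = softmax n i (\<lambda>j. softmax n j (\<lambda>j. \<mu> j s \<omega>) ds) dd"
    by (rule softmax_softmax[OF ws, symmetric])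
  finally have "next_weight s t \<omega> = softmax n i (\<lambda>j. softmax n j (\<lambda>j. \<mu> j s \<omega>) ds) dd" .
  then show ?thesis
    using softmax_lipschitz[OF weights_softmax[OF ws, of ds] i dd] w[OF i] by simp
qed

text \<open>The first indicator is known at \<open>s\<close>, as independence demands; the second
  refers to the end of the step, as telescoping demands. They disagree only in the exit step, where
  the Euler increment has no counterpart.\<close>

definition step_error :: "real \<Rightarrow> real \<Rightarrow> 'a \<Rightarrow> real" where
  "step_error s t \<omega> = indicator (alive K s) \<omega> * (f (next_weight s t \<omega>) - f (\<mu> i s \<omega>))
     - indicator (alive K t) \<omega> * (f (\<mu> i t \<omega>) - f (\<mu> i s \<omega>))"

definition grid :: "real \<Rightarrow> nat \<Rightarrow> nat \<Rightarrow> real" where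
  "grid T N k = real k * (T / real N)"

definition error_sum :: "real \<Rightarrow> nat \<Rightarrow> 'a \<Rightarrow> real" where
  "error_sum T N \<omega> = (\<Sum>k<N. step_error (grid T N k) (grid T N (Suc k)) \<omega>)"

lemma grid_step: "grid T N (Suc k) - grid T N k = T / real N"
  by (simp add: grid_def distrib_right add_divide_distrib)

lemma grid_bounds:
  assumes "0 < T" "k \<le> N"
  shows "0 \<le> grid T N k" "grid T N k \<le> T"
  using assms by (cases "N = 0"; auto simp: grid_def field_simps)+

lemma grid_less: "0 < T \<Longrightarrow> 0 < N \<Longrightarrow> grid T N k < grid T N (Suc k)"
  using grid_step[of T N k] by (metis diff_gt_0_iff_gt divide_pos_pos of_nat_0_less_iff)

lemma step_error_measurable [measurable]:
  assumes "0 \<le> s" "0 \<le> t" shows "step_error s t \<in> borel_measurable M"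
proof -
  have [measurable]: "next_weight s t \<in> borel_measurable M" "\<mu> i s \<in> borel_measurable M" "\<mu> i t \<in> borel_measurable M"
    using assms i by (auto intro: next_weight_measurable weight_measurable)
  show ?thesis unfolding step_error_def[abs_def] using assms by measurable
qed

lemma error_sum_measurable: "0 < T \<Longrightarrow> error_sum T N \<in> borel_measurable M"
  unfolding error_sum_def[abs_def] by (intro borel_measurable_sum step_error_measurable grid_bounds) auto

lemma f_lipschitz:
  assumes B: "\<And>x. x \<in> {0..1} \<Longrightarrow> \<bar>f1 x\<bar> \<le> B" and xy: "x \<in> {0..1}" "y \<in> {0..1}"
  shows "\<bar>f x - f y\<bar> \<le> B * \<bar>x - y\<bar>"
proof -
  have "\<bar>f x - f y\<bar> \<le> B * \<bar>x - y\<bar>" if xy: "x \<in> {0..1}" "y \<in> {0..1}" "x < y" for x y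
  proof -
    obtain z where z: "x < z" "z < y" "f y - f x = (y - x) * f1 z" using MVT2[OF xy(3) df] by auto
    have "\<bar>f y - f x\<bar> = \<bar>y - x\<bar> * \<bar>f1 z\<bar>" unfolding z(3) by (rule abs_mult)
    then have "\<bar>f x - f y\<bar> = \<bar>f1 z\<bar> * \<bar>x - y\<bar>" by (simp only: abs_minus_commute mult.commute)
    also have "\<dots> \<le> B * \<bar>x - y\<bar>" using B[of z] z xy by (intro mult_right_mono) auto
    finally show ?thesis .
  qed
  from this[of x y] this[of y x] xy show ?thesis
    by (cases x y rule: linorder_cases) (auto simp: abs_minus_commute)
qed

text \<open>Each step that ends inside the region contributes at most \<open>2 * B * e\<close> times
  its length, and the exit step at most \<open>b\<close>.\<close>

lemma error_sum_bound:
  assumes \<omega>: "regular \<omega>" "\<omega> \<in> space M" and T: "0 < T" "0 < N"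
    and B: "0 \<le> B" "\<And>x. x \<in> {0..1} \<Longrightarrow> \<bar>f1 x\<bar> \<le> B"
    and e: "\<And>s r j. s \<in> {0..T} \<Longrightarrow> r \<in> {0..T} \<Longrightarrow> \<bar>r - s\<bar> \<le> T / real N \<Longrightarrow> j < n \<Longrightarrow>
       \<bar>g_clamp K (clamped_weight K \<omega> j r) - g_clamp K (clamped_weight K \<omega> j s)\<bar> \<le> e"
    and b: "\<And>k. k < N \<Longrightarrow> \<omega> \<in> alive K (grid T N k) \<Longrightarrow>
       \<bar>f (next_weight (grid T N k) (grid T N (Suc k)) \<omega>) - f (\<mu> i (grid T N k) \<omega>)\<bar> \<le> b"
    and nn: "0 \<le> e" "0 \<le> b"
  shows "\<bar>error_sum T N \<omega>\<bar> \<le> 2 * B * e * T + b"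
proof -
  define P where "P k \<longleftrightarrow> \<omega> \<in> alive K (grid T N k)" for k
  have g0: "0 \<le> grid T N k" for k using T by (simp add: grid_def)
  have anti: "P k" if "P (Suc k)" for k
    using alive_antimono[OF \<omega>(1) that[unfolded P_def] g0] grid_less[OF T, of k] by (simp add: P_def)
  have "\<bar>error_sum T N \<omega>\<bar> \<le> real N * (B * (2 * (e * (T / real N)))) + b"
    unfolding error_sum_def
  proof (rule antimono_sum_bound[of P])
    show "P k" if "P (Suc k)" for k by (rule anti[OF that])
    show "0 \<le> B * (2 * (e * (T / real N)))" using B nn T by simp
    show "0 \<le> b" by fact
    show "step_error (grid T N k) (grid T N (Suc k)) \<omega> = 0" if "\<not> P k" for k
      using that anti[of k] by (cases "P (Suc k)") (auto simp: step_error_def P_def)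
    show "\<bar>step_error (grid T N k) (grid T N (Suc k)) \<omega>\<bar> \<le> b" if "k < N" "P k" "\<not> P (Suc k)" for k
      using that b[of k] by (auto simp: step_error_def P_def)
    show "\<bar>step_error (grid T N k) (grid T N (Suc k)) \<omega>\<bar> \<le> B * (2 * (e * (T / real N)))" if k: "k < N" "P (Suc k)" for k
    proof -
      let ?s = "grid T N k" and ?t = "grid T N (Suc k)"
      have al: "\<omega> \<in> alive K ?t" "\<omega> \<in> alive K ?s" using k anti[of k] by (auto simp: P_def)
      have b2: "0 \<le> ?s" "?s < ?t" "?t \<le> T" using grid_bounds[OF T(1), of "Suc k" N] k(1) g0 grid_less[OF T] by auto
      have "\<bar>next_weight ?s ?t \<omega> - \<mu> i ?t \<omega>\<bar> \<le> 2 * (e * (?t - ?s))"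
      proof (rule next_weight_close[OF \<omega>(1) al(1) b2(1,2)])
        fix r j assume r: "?s \<le> r" "r \<le> ?t" "j < n"
        have "\<omega> \<in> alive K r" by (rule alive_antimono[OF \<omega>(1) al(1)]) (use r b2 in auto)
        then show "\<bar>g_clamp K (\<mu> j r \<omega>) - g_clamp K (\<mu> j ?s \<omega>)\<bar> \<le> e"
          using e[of ?s r j] r b2 al(2) grid_step[of T N k] by (simp add: clamped_weight_eq)
      qed
      moreover have "next_weight ?s ?t \<omega> \<in> {0..1}" "\<mu> i ?t \<omega> \<in> {0..1}"
        using weights_le_1[OF weights_softmax[OF alive_weights(1)[OF K0 al(2)]] i]
          weights_le_1[OF alive_weights(1)[OF K0 al(1)] i] by (auto simp: next_weight_def)
      ultimately have "\<bar>f (next_weight ?s ?t \<omega>) - f (\<mu> i ?t \<omega>)\<bar> \<le> B * (2 * (e * (T / real N)))"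
        using f_lipschitz[OF B(2), of "next_weight ?s ?t \<omega>" "\<mu> i ?t \<omega>"] B(1)
          mult_left_mono[of "\<bar>next_weight ?s ?t \<omega> - \<mu> i ?t \<omega>\<bar>" "2 * (e * (?t - ?s))" B]
        unfolding grid_step by linarith
      then show ?thesis using al by (simp add: step_error_def)
    qed
  qed
  also have "real N * (B * (2 * (e * (T / real N)))) = 2 * B * e * T" using T by simp
  finally show ?thesis .
qed

lemma alive_unit:
  assumes "\<omega> \<in> alive K s"
  shows "next_weight s t \<omega> \<in> {0..1}" "\<mu> i s \<omega> \<in> {0..1}"
  using weights_le_1[OF weights_softmax[OF alive_weights(1)[OF K0 assms]] i]
    weights_le_1[OF alive_weights(1)[OF K0 assms] i] by (auto simp: next_weight_def)

text \<open>Uniform continuity of the clamped weights makes the steps inside the region accurate,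
  and that of \<open>W\<close> makes the exit step small.\<close>

lemma error_sum_tendsto:
  assumes \<omega>: "regular \<omega>" "\<omega> \<in> space M" and T: "0 < T"
  shows "(\<lambda>N. error_sum T N \<omega>) \<longlonglongrightarrow> 0"
proof (rule LIMSEQ_I)
  fix r :: real assume r: "0 < r"
  obtain B where B: "0 \<le> B" "\<And>x. x \<in> {0..1} \<Longrightarrow> \<bar>f1 x\<bar> \<le> B" "\<And>x. \<bar>g_clamp K x\<bar> \<le> B" using unit_bounds by metis
  \<comment> \<open>The total error is at most \<open>(2 * B * T + 4 * B) * e\<close>; the added 1
    makes the bound strict even for \<open>B = 0\<close>.\<close>
  define e where "e = r / (2 * B * T + 4 * B + 1)"
  have den: "0 < 2 * B * T + 4 * B + 1" using B(1) T by (intro add_nonneg_pos add_nonneg_nonneg) auto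
  then have e: "0 < e" using r by (simp add: e_def)
  have "\<forall>\<^sub>F N in sequentially. \<forall>j\<in>{..<n}. \<forall>s\<in>{0..T}. \<forall>r\<in>{0..T}. \<bar>r - s\<bar> \<le> T / real N \<longrightarrow>
      \<bar>g_clamp K (clamped_weight K \<omega> j r) - g_clamp K (clamped_weight K \<omega> j s)\<bar> \<le> e"
    by (intro eventually_ball_finite ballI uniform_modulus e
        continuous_on_compose2[OF g_clamp_continuous[OF K4] continuous_on_subset[OF clamped_weight_continuous[OF K0 \<omega>(1)]]]) auto
  moreover have "\<forall>\<^sub>F N in sequentially. \<forall>j\<in>{..<n}. \<forall>s\<in>{0..T}. \<forall>r\<in>{0..T}. \<bar>r - s\<bar> \<le> T / real N \<longrightarrow> \<bar>W j r \<omega> - W j s \<omega>\<bar> \<le> e"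
    by (intro eventually_ball_finite ballI uniform_modulus e continuous_on_subset[OF regular_W(1)[OF \<omega>(1)]]) auto
  moreover have "\<forall>\<^sub>F N in sequentially. B * T / real N < e"
    by (rule order_tendstoD(2)[OF lim_const_over_n e])
  moreover have "\<forall>\<^sub>F N in sequentially. 0 < N" by (rule eventually_gt_at_top)
  ultimately have "\<forall>\<^sub>F N in sequentially. \<bar>error_sum T N \<omega>\<bar> < r"
  proof eventually_elim
    case (elim N)
    have "\<bar>error_sum T N \<omega>\<bar> \<le> 2 * B * e * T + B * (2 * (2 * e))"
    proof (rule error_sum_bound[OF \<omega> T elim(4) B(1,2)])
      fix k assume k: "k < N" and al: "\<omega> \<in> alive K (grid T N k)"
      let ?s = "grid T N k" and ?t = "grid T N (Suc k)"
      have gb: "?s \<in> {0..T}" "?t \<in> {0..T}" using grid_bounds[OF T, of k N] grid_bounds[OF T, of "Suc k" N] k by auto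
      have "\<bar>euler ?s ?t j \<omega>\<bar> \<le> 2 * e" if j: "j < n" for j
      proof -
        have "\<bar>- g_clamp K (\<mu> j ?s \<omega>) * (T / real N)\<bar> \<le> B * (T / real N)"
          unfolding abs_mult using B(3)[of "\<mu> j ?s \<omega>"] T by (intro mult_mono) auto
        moreover have "\<bar>incr ?s ?t j \<omega>\<bar> \<le> e"
          unfolding incr_def using elim(2) gb j grid_step[of T N k] T by auto
        moreover have "B * (T / real N) \<le> e" using elim(3) by simp
        ultimately have "\<bar>- g_clamp K (\<mu> j ?s \<omega>) * (T / real N)\<bar> + \<bar>incr ?s ?t j \<omega>\<bar> \<le> e + e"
          by (intro add_mono) (erule order_trans)
        then show ?thesis
          unfolding euler_def grid_step mult_2 by (rule order_trans[OF abs_triangle_ineq])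
      qed
      then have "\<bar>next_weight ?s ?t \<omega> - \<mu> i ?s \<omega>\<bar> \<le> 2 * (2 * e)"
        unfolding next_weight_def by (intro softmax_lipschitz[OF alive_weights(1)[OF K0 al] i])
      then show "\<bar>f (next_weight ?s ?t \<omega>) - f (\<mu> i ?s \<omega>)\<bar> \<le> B * (2 * (2 * e))"
        using f_lipschitz[OF B(2) alive_unit[OF al], of ?t] B(1)
          mult_left_mono[of "\<bar>next_weight ?s ?t \<omega> - \<mu> i ?s \<omega>\<bar>" "2 * (2 * e)" B] by linarith
    qed (use elim(1) e B in auto)
    also have "\<dots> = (2 * B * T + 4 * B) * e" by (simp add: algebra_simps)
    also have "\<dots> < (2 * B * T + 4 * B + 1) * e" using e by simp
    also have "\<dots> = r" using den by (simp add: e_def)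
    finally show ?case .
  qed
  then show "\<exists>no. \<forall>N\<ge>no. norm (error_sum T N \<omega> - 0) < r" by (simp add: eventually_sequentially)
qed

text \<open>The same estimate with the trivial oscillation \<open>2 * B\<close> is uniform in
  \<open>N\<close> and in the path, as dominated convergence requires.\<close>

lemma error_sum_dominated:
  assumes T: "0 < T"
  obtains D where "\<And>N \<omega>. regular \<omega> \<Longrightarrow> \<omega> \<in> space M \<Longrightarrow> \<bar>error_sum T N \<omega>\<bar> \<le> D"
proof -
  obtain B where B: "0 \<le> B" "\<And>x. x \<in> {0..1} \<Longrightarrow> \<bar>f1 x\<bar> \<le> B" "\<And>x. \<bar>g_clamp K x\<bar> \<le> B"
    "\<And>x. x \<in> {0..1} \<Longrightarrow> \<bar>f x\<bar> \<le> B" using unit_bounds by metis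
  show thesis
  proof (rule that[of "2 * B * (2 * B) * T + 2 * B"])
    fix N \<omega> assume \<omega>: "regular \<omega>" "\<omega> \<in> space M"
    show "\<bar>error_sum T N \<omega>\<bar> \<le> 2 * B * (2 * B) * T + 2 * B"
    proof (cases "N = 0")
      case True
      then show ?thesis using B T by (simp add: error_sum_def)
    next
      case False
      show ?thesis
      proof (rule error_sum_bound[OF \<omega> T _ B(1,2)])
        show "\<bar>g_clamp K (clamped_weight K \<omega> j r) - g_clamp K (clamped_weight K \<omega> j s)\<bar> \<le> 2 * B" for j r s
          using B(3)[of "clamped_weight K \<omega> j r"] B(3)[of "clamped_weight K \<omega> j s"] by linarith
        fix k assume "\<omega> \<in> alive K (grid T N k)"
        from alive_unit[OF this] show "\<bar>f (next_weight (grid T N k) (grid T N (Suc k)) \<omega>) - f (\<mu> i (grid T N k) \<omega>)\<bar> \<le> 2 * B"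
          using B(4) abs_triangle_ineq4 by (smt (verit, best))
      qed (use False B in auto)
    qed
  qed
qed

text \<open>Counting only steps that end inside the region makes this \<open>f\<close> of the weight
  at the last alive grid time, or at time 0. The exit step, which could overshoot
  \<open>max_weight K\<close>, is left out.\<close>

definition stopped :: "real \<Rightarrow> nat \<Rightarrow> 'a \<Rightarrow> real" where
  "stopped T N \<omega> = f (init_weight i) + (\<Sum>k<N. indicator (alive K (grid T N (Suc k))) \<omega> * (f (\<mu> i (grid T N (Suc k)) \<omega>) - f (\<mu> i (grid T N k) \<omega>)))"

lemma stopped_value:
  assumes \<omega>: "regular \<omega>" "\<omega> \<in> space M" and T: "0 < T"
  obtains m where "m \<le> N" "stopped T N \<omega> = f (\<mu> i (grid T N m) \<omega>)" "m = 0 \<or> \<omega> \<in> alive K (grid T N m)"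
    "m < N \<Longrightarrow> \<omega> \<notin> alive K (grid T N (Suc m))"
proof -
  define P where "P k \<longleftrightarrow> \<omega> \<in> alive K (grid T N k)" for k
  have anti: "P k" if "P (Suc k)" for k
  proof -
    have "0 \<le> grid T N k" "grid T N k \<le> grid T N (Suc k)"
      using T grid_step[of T N k] by (simp_all add: grid_def divide_right_mono mult_right_mono)
    then show ?thesis using alive_antimono[OF \<omega>(1) that[unfolded P_def]] by (simp add: P_def)
  qed
  obtain m where m: "m \<le> N" "(\<Sum>k<N. if P (Suc k) then f (\<mu> i (grid T N (Suc k)) \<omega>) - f (\<mu> i (grid T N k) \<omega>) else 0)
      = f (\<mu> i (grid T N m) \<omega>) - f (\<mu> i (grid T N 0) \<omega>)"
    "m = 0 \<or> P m" "m < N \<Longrightarrow> \<not> P (Suc m)"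
    using antimono_telescope[of P N "\<lambda>k. f (\<mu> i (grid T N k) \<omega>)", OF anti] by blast
  have "stopped T N \<omega> = f (init_weight i) + (\<Sum>k<N. if P (Suc k) then f (\<mu> i (grid T N (Suc k)) \<omega>) - f (\<mu> i (grid T N k) \<omega>) else 0)"
    unfolding stopped_def by (intro arg_cong2[where f="(+)"] sum.cong refl) (auto simp: P_def)
  also have "\<dots> = f (\<mu> i (grid T N m) \<omega>)"
    unfolding m(2) using regular_weight_0[OF \<omega>(1) i] by (simp add: grid_def)
  finally show thesis using that[of m] m by (simp add: P_def)
qed

lemma stopped_measurable [measurable]:
  assumes "0 < T" shows "stopped T N \<in> borel_measurable M"
proof -
  have [measurable]: "\<mu> i (grid T N k) \<in> borel_measurable M" for k
    using assms i by (intro weight_measurable) (auto simp: grid_def)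
  have [measurable]: "alive K (grid T N k) \<in> sets M" for k
    using assms by (intro alive_measurable) (auto simp: grid_def)
  show ?thesis unfolding stopped_def[abs_def] by measurable
qed

text \<open>Sum the one-step bounds and remove the Euler error, whose mean tends to 0. The factor of
  \<open>c\<close> is a Riemann sum for the expected time in the region; it can stay discrete, being
  later bounded below by monotonicity and above by \<open>T\<close>.\<close>

lemma dynkin_lower:
  assumes T: "0 < T" and e: "0 < e"
  shows "\<forall>\<^sub>F N in sequentially. integrable M (stopped T N) \<and>
    f (init_weight i) + c * (T / real N * (\<Sum>k<N. prob (alive K (grid T N k)))) - e \<le> expectation (stopped T N)"
proof -
  \<comment> \<open>One third each for the second-order error \<open>e' * T\<close>, the mesh error
    \<open>C * T * T / real N\<close> and the mean Euler error.\<close>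
  define e' where "e' = e / (3 * T)"
  have e': "0 < e'" "e' * T = e / 3" using e T by (auto simp: e'_def)
  obtain C where C: "0 \<le> C" "\<And>s t. 0 \<le> s \<Longrightarrow> s < t \<Longrightarrow> t - s \<le> 1 \<Longrightarrow>
    integrable M (\<lambda>\<omega>. indicator (alive K s) \<omega> * (f (next_weight s t \<omega>) - f (\<mu> i s \<omega>))) \<and>
    c * (t - s) * prob (alive K s) - e' * (t - s) - C * (t - s)\<^sup>2
     \<le> expectation (\<lambda>\<omega>. indicator (alive K s) \<omega> * (f (next_weight s t \<omega>) - f (\<mu> i s \<omega>)))"
    using step_expectation[OF e'(1)] by blast
  obtain D where D: "\<And>N \<omega>. regular \<omega> \<Longrightarrow> \<omega> \<in> space M \<Longrightarrow> \<bar>error_sum T N \<omega>\<bar> \<le> D"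
    using error_sum_dominated[OF T] by blast
  have Dae: "AE \<omega> in M. norm (error_sum T N \<omega>) \<le> D" for N
    using AE_regular AE_space by eventually_elim (use D in auto)
  have ei: "integrable M (error_sum T N)" for N
    by (rule integrable_const_bound[OF Dae error_sum_measurable[OF T]])
  have "(\<lambda>N. expectation (error_sum T N)) \<longlonglongrightarrow> expectation (\<lambda>\<omega>. 0)"
  proof (rule integral_dominated_convergence[where w="\<lambda>_. D"])
    show "AE \<omega> in M. (\<lambda>N. error_sum T N \<omega>) \<longlonglongrightarrow> 0"
      using AE_regular AE_space by eventually_elim (use error_sum_tendsto T in auto)
  qed (use Dae error_sum_measurable[OF T] in auto)
  then have "(\<lambda>N. expectation (error_sum T N)) \<longlonglongrightarrow> 0" by simp
  then have "\<forall>\<^sub>F N in sequentially. expectation (error_sum T N) < e / 3" using e by (intro order_tendstoD(2)[of _ 0]) auto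
  moreover have "\<forall>\<^sub>F N in sequentially. C * T * T / real N < e / 3"
    using e by (intro order_tendstoD(2)[OF lim_const_over_n]) auto
  moreover have "\<forall>\<^sub>F N in sequentially. T / real N < 1"
    by (intro order_tendstoD(2)[OF lim_const_over_n]) auto
  moreover have "\<forall>\<^sub>F N in sequentially. 0 < N" by (rule eventually_gt_at_top)
  ultimately show ?thesis
  proof eventually_elim
    case (elim N)
    let ?h = "T / real N"
    define G where "G k \<omega> = indicator (alive K (grid T N k)) \<omega> * (f (next_weight (grid T N k) (grid T N (Suc k)) \<omega>) - f (\<mu> i (grid T N k) \<omega>))" for k \<omega>
    have G: "integrable M (G k)" "c * ?h * prob (alive K (grid T N k)) - e' * ?h - C * ?h\<^sup>2 \<le> expectation (G k)" for k
      using C(2)[of "grid T N k" "grid T N (Suc k)"] grid_less[OF T elim(4), of k] grid_step[of T N k] elim(3) T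
      by (auto simp: G_def[abs_def] grid_def)
    have "stopped T N \<omega> = f (init_weight i) + (\<Sum>k<N. G k \<omega>) - error_sum T N \<omega>" for \<omega>
      unfolding stopped_def error_sum_def step_error_def G_def sum_subtractf by simp
    then have st: "stopped T N = (\<lambda>\<omega>. f (init_weight i) + (\<Sum>k<N. G k \<omega>) - error_sum T N \<omega>)" by (rule ext)
    have Gs: "integrable M (\<lambda>\<omega>. \<Sum>k<N. G k \<omega>)" using G(1) by (rule Bochner_Integration.integrable_sum)
    have I: "integrable M (stopped T N)" unfolding st using Gs ei by auto
    have "expectation (stopped T N) = f (init_weight i) + (\<Sum>k<N. expectation (G k)) - expectation (error_sum T N)"
      unfolding st using Gs ei G(1) by (simp add: prob_space)
    moreover have "(\<Sum>k<N. c * ?h * prob (alive K (grid T N k)) - e' * ?h - C * ?h\<^sup>2) \<le> (\<Sum>k<N. expectation (G k))"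
      by (intro sum_mono G(2))
    moreover have "(\<Sum>k<N. c * ?h * prob (alive K (grid T N k)) - e' * ?h - C * ?h\<^sup>2)
      = c * (?h * (\<Sum>k<N. prob (alive K (grid T N k)))) - real N * (e' * ?h) - real N * (C * ?h\<^sup>2)"
      by (simp only: sum_subtractf sum_distrib_left sum_constant card_lessThan mult.assoc)
    moreover have "real N * (e' * ?h) = e / 3" using elim(4) e'(2) by simp
    moreover have "real N * (C * ?h\<^sup>2) = C * T * T / real N" using elim(4) by (simp add: power2_eq_square)
    ultimately show ?case using elim(1,2) I by linarith
  qed
qed

end

section \<open>Positivity at the first exit\<close>

locale market_limits = market M n W \<delta> g x0 X for M :: "'a measure" and n W \<delta> g x0 X +
  assumes liminf: "Liminf (at_right 0) (\<lambda>x. ereal (x * g x)) > -\<infinity>"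
    and limsup: "Limsup (at_right 0) (\<lambda>x. ereal (x * g x)) < 0"
begin

section \<open>Bounds on the drift function\<close>

lemma g_near_0:
  obtains c r where "0 < c" "0 < r" "r < 1 / 2" "\<And>x. 0 < x \<Longrightarrow> x < r \<Longrightarrow> x * g x \<le> - c"
proof -
  obtain y where y: "Limsup (at_right 0) (\<lambda>x. ereal (x * g x)) < y" "y < 0" using dense[OF limsup] by blast
  obtain y' where y': "y < ereal y'" "ereal y' < 0" using ereal_dense2[OF y(2)] by blast
  have "\<forall>\<^sub>F x in at_right 0. ereal (x * g x) < ereal y'" using less_trans[OF y(1) y'(1)] by (rule Limsup_lessD)
  then obtain b where b: "0 < b" "\<forall>x>0. x < b \<longrightarrow> x * g x < y'" by (auto simp: eventually_at_right_field)
  show thesis by (rule that[of "- y'" "min b (1 / 4)"]) (use y' b in \<open>auto intro: less_imp_le\<close>)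
qed

text \<open>Near 0 the lower limit bounds the product, near \<open>1 - \<delta>\<close> it is
  nonnegative by admissibility, and compactness covers the middle.\<close>

lemma g_bounded_below:
  obtains C where "0 \<le> C" "\<And>x. 0 < x \<Longrightarrow> x < 1 - \<delta> \<Longrightarrow> - C \<le> x * g x"
proof -
  obtain y where y: "- \<infinity> < ereal y" "ereal y < Liminf (at_right 0) (\<lambda>x. ereal (x * g x))"
    using ereal_dense2[OF liminf] by blast
  have "\<forall>\<^sub>F x in at_right 0. ereal y < ereal (x * g x)" by (rule less_LiminfD[OF y(2)])
  then obtain b where b: "0 < b" "\<forall>x>0. x < b \<longrightarrow> y < x * g x" by (auto simp: eventually_at_right_field)
  have "\<forall>\<^sub>F x in at_left (1 - \<delta>). 0 \<le> g x" using adm by (auto simp: admissible_def filterlim_at_top)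
  then obtain a where a: "a < 1 - \<delta>" "\<forall>x>a. x < 1 - \<delta> \<longrightarrow> 0 \<le> g x" by (auto simp: eventually_at_left_field)
  define b' where "b' = min b ((1 - \<delta>) / 2)"
  have b': "0 < b'" "max a b' < 1 - \<delta>" using a b delta by (auto simp: b'_def min_less_iff_disj)
  have "continuous_on {b'..max a b'} (\<lambda>x. x * g x)"
    by (intro continuous_intros continuous_on_subset[OF g_continuous]) (use b' in auto)
  then have "bounded ((\<lambda>x. x * g x) ` {b'..max a b'})" by (intro compact_imp_bounded compact_continuous_image) auto
  then obtain B where B: "\<forall>x\<in>{b'..max a b'}. \<bar>x * g x\<bar> \<le> B" by (auto simp: bounded_iff)
  show thesis
  proof (rule that[of "max \<bar>y\<bar> \<bar>B\<bar>"])
    fix x assume x: "0 < x" "x < 1 - \<delta>"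
    consider "x < b'" | "x \<in> {b'..max a b'}" | "a < x" by force
    then show "- max \<bar>y\<bar> \<bar>B\<bar> \<le> x * g x"
    proof cases
      case 1 then have "y < x * g x" using b x by (auto simp: b'_def)
      then show ?thesis by linarith
    next
      case 2 then have "\<bar>x * g x\<bar> \<le> B" using B by blast
      then show ?thesis by linarith
    next
      case 3 then have "0 \<le> x * g x" using a x by auto
      then show ?thesis by linarith
    qed
  qed auto
qed

text \<open>The upper limit makes \<open>g\<close> negative near 0, so compactness is only called
  for on an interval away from 0.\<close>

lemma g_bounded_above:
  assumes "b < 1 - \<delta>"
  obtains C where "0 \<le> C" "\<And>x. 0 < x \<Longrightarrow> x \<le> b \<Longrightarrow> g x \<le> C"
proof -
  obtain c r where r: "0 < c" "0 < r" "\<And>x. 0 < x \<Longrightarrow> x < r \<Longrightarrow> x * g x \<le> - c" using g_near_0 by metis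
  have "continuous_on {r..b} g" by (rule continuous_on_subset[OF g_continuous]) (use r assms in auto)
  then have "bounded (g ` {r..b})" by (intro compact_imp_bounded compact_continuous_image) auto
  then obtain B where B: "\<forall>x\<in>{r..b}. \<bar>g x\<bar> \<le> B" by (auto simp: bounded_iff)
  show thesis
  proof (rule that[of "\<bar>B\<bar>"])
    fix x assume x: "0 < x" "x \<le> b"
    show "g x \<le> \<bar>B\<bar>"
    proof (cases "x < r")
      case True
      then have "x * g x < 0" using r(1,3) x by fastforce
      then show ?thesis using x by (simp add: mult_less_0_iff)
    next
      case False
      then have "\<bar>g x\<bar> \<le> B" using B x by auto
      then show ?thesis by linarith
    qed
  qed auto
qed

text \<open>A small weight sees negative \<open>g\<close>, hence upward drift, so no single
  capitalization can vanish while the total stays positive. The difficulty is that all of them might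
  vanish together, when the weights need not have a limit; therefore the total is treated before the
  individual capitalizations.\<close>

lemma positive_at_first_exit:
  assumes \<omega>: "regular \<omega>" and \<zeta>: "0 < \<zeta>"
    and good: "\<And>t j. 0 \<le> t \<Longrightarrow> t < \<zeta> \<Longrightarrow> j < n \<Longrightarrow> 0 < X j t \<omega> \<and> \<mu> j t \<omega> < 1 - \<delta>"
    and j: "j < n"
  shows "0 < X j \<zeta> \<omega>"
proof -
  have Xc: "continuous_on {0..\<zeta>} (\<lambda>t. X j t \<omega>)" if "j < n" for j
    by (rule continuous_on_subset[OF regular_X(1)[OF \<omega> that]]) auto
  have Wc: "continuous_on {0..\<zeta>} (\<lambda>t. W j t \<omega>)" if "j < n" for j
    by (rule continuous_on_subset[OF regular_W(1)[OF \<omega> that]]) auto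
  have S: "0 < total_cap n X t \<omega>" if "0 \<le> t" "t < \<zeta>" for t
    unfolding total_cap_def using good[OF that] n2 lessThan_empty_iff[of n] by (intro sum_pos) auto
  have \<mu>0: "0 < \<mu> j t \<omega>" if "0 \<le> t" "t < \<zeta>" "j < n" for j t
    using good[OF that] S[OF that(1,2)] by (simp add: mkt_weight_def)
  have \<mu>c: "continuous_on {0..<\<zeta>} (\<lambda>t. \<mu> j t \<omega>)" if "j < n" for j
    unfolding mkt_weight_def total_cap_def
  proof -
    have "(\<Sum>l<n. X l t \<omega>) \<noteq> 0" if "t \<in> {0..<\<zeta>}" for t
      using S[of t] that unfolding total_cap_def by auto
    then show "continuous_on {0..<\<zeta>} (\<lambda>t. X j t \<omega> / (\<Sum>i<n. X i t \<omega>))"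
      by (intro continuous_intros continuous_on_subset[OF Xc]) (use \<open>j < n\<close> in auto)
  qed
  have gc: "continuous_on {0..<\<zeta>} (\<lambda>t. g (\<mu> j t \<omega>))" if "j < n" for j
    by (rule continuous_on_compose2[OF g_continuous \<mu>c[OF that]]) (use that good \<mu>0 in auto)
  \<comment> \<open>Integrating factor for the noise: \<open>Z j\<close> solves a linear
    differential equation pathwise, although \<open>W j\<close> need not be differentiable.
    Normalizing by \<open>W j \<zeta> \<omega>\<close> makes \<open>Z\<close> and \<open>X\<close>
    agree at \<open>\<zeta>\<close>.\<close>
  define Z where "Z j t = X j t \<omega> * exp (W j \<zeta> \<omega> - W j t \<omega>)" for j t
  have Zc: "continuous_on {0..\<zeta>} (Z j)" if "j < n" for j
    unfolding Z_def by (intro continuous_intros Xc Wc that)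
  have Zp: "0 < Z j t" if "0 \<le> t" "t < \<zeta>" "j < n" for j t using good[OF that] by (simp add: Z_def)
  have Z\<zeta>: "Z j \<zeta> = X j \<zeta> \<omega>" for j by (simp add: Z_def)
  have Zd: "(Z j has_real_derivative - g (\<mu> j t \<omega>) * Z j t) (at t)" if t: "0 < t" "t < \<zeta>" and j: "j < n" for j t
  proof -
    let ?I = "\<lambda>s. integral {0..s} (\<lambda>s. g (\<mu> j s \<omega>))"
    have Zeq: "exp (ln (x0 j) - ?I s + W j \<zeta> \<omega>) = Z j s" if s: "0 \<le> s" "s < \<zeta>" for s
    proof -
      have "ln (X j s \<omega>) = ln (x0 j) - ?I s + W j s \<omega>" by (rule regular_log[OF \<omega> s(1) _ j]) (use good s in auto)
      then have "ln (x0 j) - ?I s + W j \<zeta> \<omega> = ln (X j s \<omega>) + (W j \<zeta> \<omega> - W j s \<omega>)" by simp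
      then show ?thesis using good[OF s j] by (simp only: exp_add exp_ln Z_def)
    qed
    have "(?I has_real_derivative g (\<mu> j t \<omega>)) (at t within {0..(t + \<zeta>) / 2})"
      by (rule integral_has_real_derivative[OF continuous_on_subset[OF gc[OF j]]]) (use t in auto)
    then have "(?I has_real_derivative g (\<mu> j t \<omega>)) (at t)"
      using t by (subst (asm) at_within_Icc_at) auto
    then have "((\<lambda>s. exp (ln (x0 j) - ?I s + W j \<zeta> \<omega>)) has_real_derivative
       exp (ln (x0 j) - ?I t + W j \<zeta> \<omega>) * - g (\<mu> j t \<omega>)) (at t)"
      by (auto intro!: derivative_eq_intros)
    then have "((\<lambda>s. exp (ln (x0 j) - ?I s + W j \<zeta> \<omega>)) has_real_derivative - g (\<mu> j t \<omega>) * Z j t) (at t)"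
      using Zeq[of t] t by (simp add: mult.commute)
    then show ?thesis
      by (rule has_field_derivative_transform_within_open[where S="{0<..<\<zeta>}"]) (use t Zeq in auto)
  qed
  text \<open>Barrier: the sum of all but the largest \<open>Z j\<close> decays at most exponentially, because an asset that is
    not the largest has weight bounded away from \<open>1 - \<delta>\<close>.\<close>
  have S\<zeta>: "0 < total_cap n X \<zeta> \<omega>"
  proof -
    \<comment> \<open>If \<open>X i\<close> is at least \<open>\<rho> = (1 - b) / b\<close> times
      \<open>X j\<close>, then asset \<open>j\<close> has weight at most \<open>b\<close>. Comparing
      \<open>Z\<close> in place of \<open>X\<close> costs two factors \<open>exp e\<close>, which is
      why \<open>e\<close> is half of \<open>- ln \<rho>\<close>; choosing \<open>b\<close> above
      \<open>1 / 2\<close> leaves room for them.\<close>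
    define b where "b = (1 / 2 + (1 - \<delta>)) / 2"
    have b: "1 / 2 < b" "b < 1 - \<delta>" "b < 1" using delta by (auto simp: b_def)
    obtain C where C: "0 \<le> C" "\<And>x. 0 < x \<Longrightarrow> x \<le> b \<Longrightarrow> g x \<le> C" using g_bounded_above[OF b(2)] by metis
    define \<rho> where "\<rho> = (1 - b) / b"
    have \<rho>: "0 < \<rho>" "\<rho> < 1" using b by (auto simp: \<rho>_def)
    define e where "e = - ln \<rho> / 2"
    have e: "0 < e" using \<rho> by (simp add: e_def)
    have ee: "exp (- e) * exp (- e) = \<rho>" using \<rho> by (simp add: e_def flip: exp_add)
    have "\<forall>\<^sub>F t in at_left \<zeta>. \<forall>j\<in>{..<n}. \<bar>W j t \<omega> - W j \<zeta> \<omega>\<bar> < e"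
    proof (intro eventually_ball_finite ballI)
      fix j assume "j \<in> {..<n}"
      then have "((\<lambda>t. W j t \<omega>) \<longlongrightarrow> W j \<zeta> \<omega>) (at \<zeta> within {0..\<zeta>})"
        using Wc[of j] \<zeta> by (auto simp: continuous_on_def)
      then have "((\<lambda>t. W j t \<omega>) \<longlongrightarrow> W j \<zeta> \<omega>) (at_left \<zeta>)" using \<zeta> by (simp add: at_within_Icc_at_left)
      from tendstoD[OF this e] show "\<forall>\<^sub>F t in at_left \<zeta>. \<bar>W j t \<omega> - W j \<zeta> \<omega>\<bar> < e"
        by (simp add: dist_real_def)
    qed auto
    moreover have "\<forall>\<^sub>F t in at_left \<zeta>. 0 < t" using eventually_at_left_real[OF \<zeta>] by eventually_elim auto
    ultimately have "\<forall>\<^sub>F t in at_left \<zeta>. 0 < t \<and> (\<forall>j<n. \<bar>W j t \<omega> - W j \<zeta> \<omega>\<bar> < e)" by eventually_elim auto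
    then obtain t' where t': "t' < \<zeta>" "\<forall>t>t'. t < \<zeta> \<longrightarrow> 0 < t \<and> (\<forall>j<n. \<bar>W j t \<omega> - W j \<zeta> \<omega>\<bar> < e)"
      by (auto simp: eventually_at_left_field)
    define t0 where "t0 = (t' + \<zeta>) / 2"
    have t0: "t' < t0" "t0 < \<zeta>" using t' by (auto simp: t0_def)
    have t00: "0 < t0" using t' t0 by auto
    have osc: "\<bar>W j t \<omega> - W j \<zeta> \<omega>\<bar> \<le> e" if "t0 \<le> t" "t < \<zeta>" "j < n" for t j
      using t'(2) t0 that by (auto intro!: less_imp_le)
    have small: "\<mu> j t \<omega> \<le> b" if t: "t0 \<le> t" "t < \<zeta>" and ij: "i < n" "j < n" "i \<noteq> j" and le: "Z j t \<le> Z i t" for i j t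
    proof -
      have p: "0 < X i t \<omega>" "0 < X j t \<omega>" using good[of t] t t00 ij by auto
      have "X j t \<omega> = Z j t * exp (W j t \<omega> - W j \<zeta> \<omega>)" by (simp add: Z_def flip: exp_add)
      then have "exp (- e) * X j t \<omega> \<le> exp (- e) * (Z j t * exp e)"
        using osc[OF t ij(2)] Zp[of t j] t t00 ij by (auto intro!: mult_left_mono)
      also have "\<dots> = Z j t" by (simp flip: exp_add)
      finally have 1: "exp (- e) * X j t \<omega> \<le> Z i t" using le by simp
      have "X i t \<omega> = Z i t * exp (W i t \<omega> - W i \<zeta> \<omega>)" by (simp add: Z_def flip: exp_add)
      then have "Z i t * exp (- e) \<le> X i t \<omega>"
        using osc[OF t ij(1)] Zp[of t i] t t00 ij by (auto intro!: mult_left_mono)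
      moreover have "exp (- e) * X j t \<omega> * exp (- e) \<le> Z i t * exp (- e)" using 1 by (rule mult_right_mono) simp
      moreover have "\<rho> * X j t \<omega> = exp (- e) * X j t \<omega> * exp (- e)" unfolding ee[symmetric] by simp
      ultimately have "\<rho> * X j t \<omega> \<le> X i t \<omega>" by linarith
      then have "(1 - b) * X j t \<omega> \<le> b * X i t \<omega>" using b by (simp add: \<rho>_def field_simps)
      moreover have "X i t \<omega> + X j t \<omega> \<le> total_cap n X t \<omega>"
      proof -
        have "(\<Sum>l\<in>{i, j}. X l t \<omega>) \<le> total_cap n X t \<omega>"
          unfolding total_cap_def using ij good[of t] t t00 by (intro sum_mono2) (auto intro: less_imp_le)
        then show ?thesis using ij by simp
      qed
      then have "b * (X i t \<omega> + X j t \<omega>) \<le> b * total_cap n X t \<omega>" using b by (intro mult_left_mono) auto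
      ultimately have "X j t \<omega> \<le> b * total_cap n X t \<omega>" by (simp add: algebra_simps)
      then show ?thesis using S[of t] t t00 by (simp add: mkt_weight_def pos_divide_le_eq)
    qed
    \<comment> \<open>Proving the barrier for every excluded asset avoids tracking which one is the
      largest. The exponent \<open>C + 1\<close> exceeds the decay rate \<open>C\<close>, so that
      the derivative at the barrier is strictly positive.\<close>
    define F where "F i t = (\<Sum>j\<in>{..<n} - {i}. Z j t)" for i t
    define E where "E i t = exp ((C + 1) * (t - t0)) * F i t" for i t
    have Fp: "0 < F i t" if "0 \<le> t" "t < \<zeta>" "i < n" for i t
    proof -
      have "(if i = 0 then 1 else 0) \<in> {..<n} - {i}" using n2 by auto
      then have "{..<n} - {i} \<noteq> {}" by blast
      then show ?thesis unfolding F_def using Zp[OF that(1,2)] by (intro sum_pos) auto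
    qed
    have Ec: "continuous_on {t0..\<zeta>} (E i)" if "i < n" for i
    proof -
      have "continuous_on {t0..\<zeta>} (Z j)" if "j \<in> {..<n} - {i}" for j
        by (rule continuous_on_subset[OF Zc]) (use t00 that in auto)
      then have "continuous_on {t0..\<zeta>} (\<lambda>t. \<Sum>j\<in>{..<n} - {i}. Z j t)" by (rule continuous_on_sum)
      then show ?thesis unfolding E_def F_def by (intro continuous_on_mult) (auto intro!: continuous_intros)
    qed
    obtain b0 where b0: "0 < b0" "\<And>i. i < n \<Longrightarrow> b0 < E i t0"
    proof -
      have ne: "(\<lambda>i. E i t0) ` {..<n} \<noteq> {}" using n2 lessThan_empty_iff[of n] by auto
      have "0 < Min ((\<lambda>i. E i t0) ` {..<n})"
        using Fp[of t0] t00 t0 ne by (subst Min_gr_iff) (auto simp: E_def)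
      then show thesis
      proof (intro that[of "Min ((\<lambda>i. E i t0) ` {..<n}) / 2"])
        fix i assume "i < n"
        then have "Min ((\<lambda>i. E i t0) ` {..<n}) \<le> E i t0" by (intro Min_le) auto
        then show "Min ((\<lambda>i. E i t0) ` {..<n}) / 2 < E i t0"
          using \<open>0 < Min ((\<lambda>i. E i t0) ` {..<n})\<close> by linarith
      qed simp
    qed
    have barrier: "b0 < E i t" if t: "t0 \<le> t" "t < \<zeta>" and i: "i < n" for i t
    proof (rule ccontr)
      assume "\<not> b0 < E i t"
      \<comment> \<open>First contact with the barrier. The touching sum \<open>F l\<close> is then
        the smallest of all, so \<open>Z l\<close> is the largest of all \<open>Z\<close>, and every
        term of \<open>F l\<close> belongs to an asset of weight at most \<open>b\<close>.\<close>
      define Bad where "Bad = (\<Union>i\<in>{..<n}. {s \<in> {t0..t}. E i s \<le> b0})"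
      have "closed Bad" unfolding Bad_def
        by (intro closed_UN ballI continuous_on_closed_Collect_le continuous_on_subset[OF Ec] continuous_on_const)
          (use t in auto)
      moreover have ne: "t \<in> Bad" using \<open>\<not> b0 < E i t\<close> t i by (auto simp: Bad_def intro!: bexI[of _ i])
      moreover have bb: "bdd_below Bad" by (rule bdd_belowI[of _ t0]) (auto simp: Bad_def)
      ultimately have "Inf Bad \<in> Bad" by (intro closed_contains_Inf) auto
      then obtain l where l: "l < n" "Inf Bad \<in> {t0..t}" "E l (Inf Bad) \<le> b0" by (auto simp: Bad_def)
      define t1 where "t1 = Inf Bad"
      have t1: "t0 \<le> t1" "t1 \<le> t" "E l t1 \<le> b0" using l by (auto simp: t1_def)
      have "t1 \<noteq> t0" using t1(3) b0(2)[OF l(1)] by auto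
      then have t01: "t0 < t1" "t1 < \<zeta>" using t1 t by auto
      have before: "b0 < E k s" if "t0 \<le> s" "s < t1" "k < n" for k s
      proof (rule ccontr)
        assume "\<not> b0 < E k s"
        then have "s \<in> Bad" using that t1 by (auto simp: Bad_def intro!: bexI[of _ k])
        then have "t1 \<le> s" unfolding t1_def by (rule cInf_lower[OF _ bb])
        then show False using that by simp
      qed
      have at: "b0 \<le> E k t1" if k: "k < n" for k
      proof (rule tendsto_lowerbound)
        show "(E k \<longlongrightarrow> E k t1) (at t1 within {t0..t1})"
          using continuous_on_subset[OF Ec[OF k], of "{t0..t1}"] t01 by (auto simp: continuous_on_def)
        show "\<forall>\<^sub>F x in at t1 within {t0..t1}. b0 \<le> E k x"
          unfolding eventually_at_filter using before k by (auto intro!: always_eventually less_imp_le)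
        show "at t1 within {t0..t1} \<noteq> bot" using t01 by (simp add: at_within_Icc_at_left trivial_limit_at_left_real)
      qed
      have Zle: "Z k t1 \<le> Z l t1" if k: "k < n" for k
      proof -
        have "E l t1 \<le> E k t1" using at[OF k] t1(3) by simp
        then have "F l t1 \<le> F k t1" by (simp add: E_def)
        moreover have "F l t1 = (\<Sum>j<n. Z j t1) - Z l t1" "F k t1 = (\<Sum>j<n. Z j t1) - Z k t1"
          using l(1) k by (auto simp: F_def sum_diff1)
        ultimately show ?thesis by simp
      qed
      have dE: "(E l has_real_derivative exp ((C + 1) * (t1 - t0)) * ((C + 1) * F l t1 + (\<Sum>j\<in>{..<n} - {l}. - g (\<mu> j t1 \<omega>) * Z j t1))) (at t1)"
      proof -
        have "(F l has_real_derivative (\<Sum>j\<in>{..<n} - {l}. - g (\<mu> j t1 \<omega>) * Z j t1)) (at t1)"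
          unfolding F_def by (rule DERIV_sum) (use Zd t01 t00 in auto)
        then show ?thesis unfolding E_def
          by (auto intro!: derivative_eq_intros simp: algebra_simps)
      qed
      have "(\<Sum>j\<in>{..<n} - {l}. - C * Z j t1) \<le> (\<Sum>j\<in>{..<n} - {l}. - g (\<mu> j t1 \<omega>) * Z j t1)"
      proof (intro sum_mono mult_right_mono)
        fix j assume "j \<in> {..<n} - {l}"
        then have j: "j < n" "l \<noteq> j" by auto
        show "0 \<le> Z j t1" using Zp[of t1 j] t01 t00 j by simp
        have "g (\<mu> j t1 \<omega>) \<le> C" using small[of t1 l j] Zle[OF j(1)] \<mu>0[of t1 j] j l t01 t00 by (intro C) auto
        then show "- C \<le> - g (\<mu> j t1 \<omega>)" by simp
      qed
      moreover have "(\<Sum>j\<in>{..<n} - {l}. - C * Z j t1) = - C * F l t1" by (simp add: F_def sum_distrib_left)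
      ultimately have "0 < (C + 1) * F l t1 + (\<Sum>j\<in>{..<n} - {l}. - g (\<mu> j t1 \<omega>) * Z j t1)"
        using Fp[of t1 l] t01 t00 l(1) by (simp add: distrib_right)
      then obtain d where d: "0 < d" "\<And>h. 0 < h \<Longrightarrow> h < d \<Longrightarrow> E l (t1 - h) < E l t1"
        using DERIV_pos_inc_left[OF dE] by auto
      define h where "h = min (d / 2) (t1 - t0)"
      have "0 < h" "h < d" "t0 \<le> t1 - h" "t1 - h < t1" using d t01 by (auto simp: h_def)
      then show False using d(2)[of h] before[of "t1 - h" l] l(1) t1(3) by simp
    qed
    have "b0 \<le> E 0 \<zeta>"
    proof (rule tendsto_lowerbound)
      show "(E 0 \<longlongrightarrow> E 0 \<zeta>) (at \<zeta> within {t0..\<zeta>})"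
        using Ec[of 0] n2 t0 by (auto simp: continuous_on_def)
      show "\<forall>\<^sub>F x in at \<zeta> within {t0..\<zeta>}. b0 \<le> E 0 x"
        unfolding eventually_at_filter using barrier[of _ 0] n2 by (auto intro!: always_eventually less_imp_le)
      show "at \<zeta> within {t0..\<zeta>} \<noteq> bot" using t0 by (simp add: at_within_Icc_at_left trivial_limit_at_left_real)
    qed
    then have "0 < E 0 \<zeta>" using b0 by simp
    then have "0 < F 0 \<zeta>" by (simp add: E_def zero_less_mult_iff)
    moreover have X0: "0 \<le> X j \<zeta> \<omega>" if j: "j < n" for j
    proof (rule tendsto_lowerbound)
      show "((\<lambda>t. X j t \<omega>) \<longlongrightarrow> X j \<zeta> \<omega>) (at \<zeta> within {0..\<zeta>})"
        using Xc[OF j] \<zeta> by (auto simp: continuous_on_def)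
      show "\<forall>\<^sub>F x in at \<zeta> within {0..\<zeta>}. 0 \<le> X j x \<omega>"
        unfolding eventually_at_filter using good j by (auto intro!: always_eventually less_imp_le)
      show "at \<zeta> within {0..\<zeta>} \<noteq> bot" using \<zeta> by (simp add: at_within_Icc_at_left trivial_limit_at_left_real)
    qed
    moreover have "F 0 \<zeta> \<le> total_cap n X \<zeta> \<omega>"
      unfolding F_def total_cap_def Z\<zeta> using X0 by (intro sum_mono2) auto
    ultimately show ?thesis by simp
  qed
  \<comment> \<open>With a positive total the weights are continuous up to \<open>\<zeta>\<close>.
    If the weight of \<open>j\<close> ends below \<open>r\<close>, then \<open>Z j\<close> is
    nondecreasing near \<open>\<zeta>\<close>; otherwise that weight is positive anyway.\<close>
  obtain c r where r: "0 < c" "0 < r" "\<And>x. 0 < x \<Longrightarrow> x < r \<Longrightarrow> x * g x \<le> - c" using g_near_0 by metis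
  show ?thesis
  proof (cases "\<mu> j \<zeta> \<omega> < r")
    case False
    then have "0 < \<mu> j \<zeta> \<omega>" using r by simp
    then show ?thesis using S\<zeta> by (simp add: mkt_weight_def zero_less_divide_iff)
  next
    case True
    have SS: "total_cap n X t \<omega> \<noteq> 0" if "t \<in> {0..\<zeta>}" for t
      using S\<zeta> S[of t] that by (cases "t = \<zeta>") auto
    have "continuous_on {0..\<zeta>} (\<lambda>t. \<mu> j t \<omega>)"
      unfolding mkt_weight_def using SS unfolding total_cap_def by (intro continuous_intros Xc j) auto
    then have "((\<lambda>t. \<mu> j t \<omega>) \<longlongrightarrow> \<mu> j \<zeta> \<omega>) (at \<zeta> within {0..\<zeta>})"
      using \<zeta> by (auto simp: continuous_on_def)
    then have "((\<lambda>t. \<mu> j t \<omega>) \<longlongrightarrow> \<mu> j \<zeta> \<omega>) (at_left \<zeta>)" using \<zeta> by (simp add: at_within_Icc_at_left)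
    then have "\<forall>\<^sub>F t in at_left \<zeta>. \<mu> j t \<omega> < r" using True by (rule order_tendstoD)
    then obtain t' where t': "t' < \<zeta>" "\<forall>t>t'. t < \<zeta> \<longrightarrow> \<mu> j t \<omega> < r" by (auto simp: eventually_at_left_field)
    define t0 where "t0 = (max t' 0 + \<zeta>) / 2"
    have t0: "t' < t0" "0 < t0" "t0 < \<zeta>" using t' \<zeta> by (auto simp: t0_def max_def)
    have inc: "Z j t0 \<le> Z j t" if t: "t0 \<le> t" "t < \<zeta>" for t
    proof (rule DERIV_nonneg_imp_nondecreasing[OF t(1)])
      fix s assume s: "t0 \<le> s" "s \<le> t"
      have m: "0 < \<mu> j s \<omega>" using \<mu>0[of s j] s t t0 j by auto
      moreover have "\<mu> j s \<omega> < r" using t' s t t0 by auto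
      ultimately have "\<mu> j s \<omega> * g (\<mu> j s \<omega>) < 0" using r by fastforce
      then have "g (\<mu> j s \<omega>) < 0" using m by (simp add: mult_less_0_iff)
      moreover have "0 < Z j s" using Zp[of s j] s t t0 j by auto
      ultimately have "0 \<le> - g (\<mu> j s \<omega>) * Z j s" by (simp add: mult_nonpos_nonneg)
      moreover have "(Z j has_real_derivative - g (\<mu> j s \<omega>) * Z j s) (at s)" using Zd[of s j] s t t0 j by auto
      ultimately show "\<exists>y. (Z j has_real_derivative y) (at s) \<and> 0 \<le> y" by blast
    qed
    have "Z j t0 \<le> Z j \<zeta>"
    proof (rule tendsto_lowerbound)
      show "(Z j \<longlongrightarrow> Z j \<zeta>) (at \<zeta> within {t0..\<zeta>})"
        using continuous_on_subset[OF Zc[OF j], of "{t0..\<zeta>}"] t0 by (auto simp: continuous_on_def)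
      show "\<forall>\<^sub>F x in at \<zeta> within {t0..\<zeta>}. Z j t0 \<le> Z j x"
        unfolding eventually_at_filter using inc by (auto intro!: always_eventually)
      show "at \<zeta> within {t0..\<zeta>} \<noteq> bot" using t0 by (simp add: at_within_Icc_at_left trivial_limit_at_left_real)
    qed
    moreover have "0 < Z j t0" using Zp[of t0 j] t0 j by auto
    ultimately show ?thesis by (simp add: Z\<zeta>)
  qed
qed

end

section \<open>Antiderivatives\<close>

lemma antiderivative_lessThan:
  fixes a :: "real \<Rightarrow> real"
  assumes "continuous_on {..<b} a" "y < b"
  obtains E where "\<And>x. x < b \<Longrightarrow> (E has_real_derivative a x) (at x)" "E y = 0"
proof -
  have "\<exists>F. \<forall>x::real. -\<infinity> < ereal x \<longrightarrow> ereal x < ereal b \<longrightarrow> (F has_vector_derivative a x) (at x)"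
    by (rule einterval_antiderivative) (use assms in \<open>auto simp: continuous_on_eq_continuous_at\<close>)
  then obtain F where F: "\<And>x. x < b \<Longrightarrow> (F has_real_derivative a x) (at x)"
    by (auto simp: has_real_derivative_iff_has_vector_derivative)
  show thesis
    by (rule that[of "\<lambda>x. F x - F y"]) (auto intro!: derivative_eq_intros F)
qed

lemma antiderivative_UNIV:
  fixes a :: "real \<Rightarrow> real"
  assumes "continuous_on UNIV a"
  obtains E where "\<And>x. (E has_real_derivative a x) (at x)" "E y = 0"
proof -
  have "\<exists>F. \<forall>x::real. -\<infinity> < ereal x \<longrightarrow> ereal x < \<infinity> \<longrightarrow> (F has_vector_derivative a x) (at x)"
    by (rule einterval_antiderivative) (use assms in \<open>auto simp: continuous_on_eq_continuous_at\<close>)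
  then obtain F where F: "\<And>x. (F has_real_derivative a x) (at x)"
    by (auto simp: has_real_derivative_iff_has_vector_derivative)
  show thesis
    by (rule that[of "\<lambda>x. F x - F y"]) (auto intro!: derivative_eq_intros F)
qed

lemma equal_derivatives_imp_equal:
  fixes F G :: "real \<Rightarrow> real"
  assumes "x \<le> k" "\<And>z. x \<le> z \<Longrightarrow> z \<le> k \<Longrightarrow> (F has_real_derivative h z) (at z)"
    "\<And>z. x \<le> z \<Longrightarrow> z \<le> k \<Longrightarrow> (G has_real_derivative h z) (at z)"
  shows "F x - F k = G x - G k"
proof (cases "x = k")
  case False
  have "((\<lambda>z. F z - G z) has_real_derivative h z - h z) (at z)" if "x \<le> z" "z \<le> k" for z
    using that assms by (intro DERIV_diff) auto
  then obtain z where "(F k - G k) - (F x - G x) = (k - x) * (h z - h z)"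
    using MVT2[of x k "\<lambda>z. F z - G z" "\<lambda>z. h z - h z"] False assms(1) by auto
  then show ?thesis by simp
qed simp

text \<open>Freeze the second derivative at \<open>k\<close> and integrate twice. The Taylor bound
  wants smooth functions on all of \<open>{0..1}\<close>, while the test functions exist only below
  \<open>1 - \<delta>\<close>; the stopped path is evaluated only up to \<open>k\<close>.\<close>

lemma C2_extension:
  fixes f f1 f2 :: "real \<Rightarrow> real"
  assumes k: "k < b"
    and f: "\<And>x. x < b \<Longrightarrow> (f has_real_derivative f1 x) (at x)"
    and f1: "\<And>x. x < b \<Longrightarrow> (f1 has_real_derivative f2 x) (at x)"
    and f2: "continuous_on {..<b} f2"
  obtains F F1 F2 where "\<And>x. (F has_real_derivative F1 x) (at x)"
    "\<And>x. (F1 has_real_derivative F2 x) (at x)" "continuous_on UNIV F2"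
    "\<And>x. x \<le> k \<Longrightarrow> F x = f x" "\<And>x. x \<le> k \<Longrightarrow> F1 x = f1 x" "\<And>x. x \<le> k \<Longrightarrow> F2 x = f2 x"
proof -
  define F2 where "F2 x = f2 (min x k)" for x
  have F2: "continuous_on UNIV F2" unfolding F2_def
    by (intro continuous_on_compose2[OF f2] continuous_intros) (use k in auto)
  have F2e: "F2 x = f2 x" if "x \<le> k" for x using that by (simp add: F2_def)
  obtain G1 where G1: "\<And>x. (G1 has_real_derivative F2 x) (at x)" "G1 k = 0" using antiderivative_UNIV[OF F2] by blast
  define F1 where "F1 x = G1 x + f1 k" for x
  have F1: "(F1 has_real_derivative F2 x) (at x)" for x
    unfolding F1_def by (auto intro!: derivative_eq_intros G1(1))
  have F1e: "F1 x = f1 x" if x: "x \<le> k" for x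
  proof -
    have "F1 x - F1 k = f1 x - f1 k"
    proof (rule equal_derivatives_imp_equal[OF x F1])
      fix z assume "x \<le> z" "z \<le> k"
      then show "(f1 has_real_derivative F2 z) (at z)" using f1[of z] F2e[of z] k by simp
    qed
    then show ?thesis using G1(2) by (simp add: F1_def)
  qed
  have "continuous_on UNIV F1" using F1 by (auto intro!: continuous_at_imp_continuous_on intro: DERIV_isCont)
  then obtain G where G: "\<And>x. (G has_real_derivative F1 x) (at x)" "G k = 0" using antiderivative_UNIV by blast
  define F where "F x = G x + f k" for x
  have F: "(F has_real_derivative F1 x) (at x)" for x
    unfolding F_def by (auto intro!: derivative_eq_intros G(1))
  have Fe: "F x = f x" if x: "x \<le> k" for x
  proof -
    have "F x - F k = f x - f k"
    proof (rule equal_derivatives_imp_equal[OF x F])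
      fix z assume "x \<le> z" "z \<le> k"
      then show "(f has_real_derivative F1 z) (at z)" using f[of z] F1e[of z] k by simp
    qed
    then show ?thesis using G(2) by (simp add: F_def)
  qed
  show thesis using F F1 F2 Fe F1e F2e by (rule that)
qed

section \<open>Integrals of a nonnegative derivative\<close>

lemma nn_integral_derivative_Icc:
  fixes F f :: "real \<Rightarrow> real"
  assumes F: "\<And>x. x < b \<Longrightarrow> (F has_real_derivative f x) (at x)"
    and f: "continuous_on {..<b} f" "\<And>x. m \<le> x \<Longrightarrow> x < b \<Longrightarrow> 0 \<le> f x"
    and x: "m \<le> x" "x < b"
  shows "(\<integral>\<^sup>+ y \<in> {m..x}. ennreal (f y) \<partial>lborel) = ennreal (F x - F m)"
proof -
  \<comment> \<open>Freezing \<open>f\<close> beyond \<open>x\<close> gives a function that is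
    continuous, hence measurable, on the whole line, without changing the integral.\<close>
  define h where "h y = f (min y x)" for y
  have "continuous_on UNIV h" unfolding h_def
    by (intro continuous_on_compose2[OF f(1)] continuous_intros) (use x in auto)
  then have hm: "h \<in> borel_measurable borel" by (rule borel_measurable_continuous_onI)
  have "(\<integral>\<^sup>+ y \<in> {m..x}. ennreal (f y) \<partial>lborel) = (\<integral>\<^sup>+ y. ennreal (h y) * indicator {m..x} y \<partial>lborel)"
    by (intro nn_integral_cong) (auto simp: h_def indicator_def)
  also have "\<dots> = ennreal (F x - F m)"
    by (rule nn_integral_FTC_Icc[OF hm]) (use F f x in \<open>auto simp: h_def has_real_derivative_iff_has_vector_derivative[symmetric] intro: has_field_derivative_at_within\<close>)
  finally show ?thesis .
qed

text \<open>Fatou's lemma along right ends \<open>r k\<close> tending to \<open>b\<close>; at each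
  of them the integral is an increment of \<open>F\<close>, which \<open>L\<close> controls.\<close>

lemma nn_integral_le_bound:
  fixes F f :: "real \<Rightarrow> real"
  assumes F: "\<And>x. x < b \<Longrightarrow> (F has_real_derivative f x) (at x)"
    and f: "continuous_on {..<b} f" "\<And>x. m \<le> x \<Longrightarrow> x < b \<Longrightarrow> 0 \<le> f x"
    and m: "m < b" and L: "\<And>x. m \<le> x \<Longrightarrow> x < b \<Longrightarrow> F x \<le> L"
  shows "(\<integral>\<^sup>+ y \<in> {m..<b}. ennreal (f y) \<partial>lborel) \<le> ennreal (L - F m)"
proof -
  define r where "r k = b - (b - m) * inverse (real (Suc k))" for k
  have r: "m \<le> r k" "r k < b" for k
  proof -
    have "inverse (real (Suc k)) \<le> 1" "0 < inverse (real (Suc k))" by (auto simp: inverse_eq_divide)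
    then have "(b - m) * inverse (real (Suc k)) \<le> (b - m) * 1"
      using m by (intro mult_left_mono) auto
    moreover have "0 < (b - m) * inverse (real (Suc k))" using m by (intro mult_pos_pos) auto
    moreover define z where "z = (b - m) * inverse (real (Suc k))"
    ultimately have "m \<le> b - z \<and> b - z < b" unfolding mult_1_right z_def[symmetric] by linarith
    then have "m \<le> r k \<and> r k < b" by (simp add: r_def z_def)
    then show "m \<le> r k" "r k < b" by auto
  qed
  have rl: "r \<longlonglongrightarrow> b" unfolding r_def
    by (rule tendsto_eq_intros LIMSEQ_inverse_real_of_nat refl | simp)+
  define u where "u k y = ennreal (indicator {..<b} y * f y) * indicator {m..r k} y" for k y
  have "(\<lambda>x. indicator {..<b} x * f x) \<in> borel_measurable borel"
    using borel_measurable_continuous_on_indicator[OF _ f(1)] by (simp add: mult.commute)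
  then have um: "u k \<in> borel_measurable lborel" for k
    unfolding u_def by measurable
  have "(\<integral>\<^sup>+ y \<in> {m..<b}. ennreal (f y) \<partial>lborel) \<le> (\<integral>\<^sup>+ y. liminf (\<lambda>k. u k y) \<partial>lborel)"
  proof (intro nn_integral_mono)
    fix y
    show "ennreal (f y) * indicator {m..<b} y \<le> liminf (\<lambda>k. u k y)"
    proof (cases "y \<in> {m..<b}")
      case True
      then have "\<forall>\<^sub>F k in sequentially. y < r k" using rl by (intro order_tendstoD(1)[of _ b]) auto
      then have "\<forall>\<^sub>F k in sequentially. ennreal (f y) \<le> u k y"
        by eventually_elim (use True in \<open>auto simp: u_def\<close>)
      then show ?thesis using True by (auto intro: Liminf_bounded)
    qed auto
  qed
  also have "\<dots> \<le> liminf (\<lambda>k. integral\<^sup>N lborel (u k))" by (rule nn_integral_liminf[OF um])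
  also have "\<dots> \<le> liminf (\<lambda>k. ennreal (L - F m))"
  proof (rule Liminf_mono, rule always_eventually, rule allI)
    fix k
    have "integral\<^sup>N lborel (u k) = (\<integral>\<^sup>+ y \<in> {m..r k}. ennreal (f y) \<partial>lborel)"
      using r[of k] by (intro nn_integral_cong) (auto simp: u_def indicator_def)
    also have "\<dots> = ennreal (F (r k) - F m)"
      by (rule nn_integral_derivative_Icc[OF F f r])
    also have "\<dots> \<le> ennreal (L - F m)" using L[OF r] by (intro ennreal_leI) auto
    finally show "integral\<^sup>N lborel (u k) \<le> ennreal (L - F m)" .
  qed
  also have "\<dots> = ennreal (L - F m)" by (simp add: Liminf_const)
  finally show ?thesis .
qed

section \<open>Lyapunov functions\<close>

text \<open>The squares of the other weights sum to at least
  \<open>(1 - p i)\<^sup>2 / (n - 1)\<close> by Cauchy-Schwarz and to at most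
  \<open>(1 - p i)\<^sup>2\<close>. The extremes are equal other weights and a single other
  asset.\<close>

lemma weights_others:
  assumes w: "weights n p" and i: "i < n"
  shows "(\<Sum>j\<in>{..<n} - {i}. p j) = 1 - p i"
    "(1 - p i)\<^sup>2 * (1 + 1 / (real n - 1)) \<le> 1 - 2 * p i + (\<Sum>j<n. (p j)\<^sup>2)"
    "1 - 2 * p i + (\<Sum>j<n. (p j)\<^sup>2) \<le> 2 * (1 - p i)\<^sup>2"
    "(\<Sum>j<n. (p j)\<^sup>2) \<le> 1"
proof -
  let ?J = "{..<n} - {i}"
  have nonneg: "0 \<le> p j" if "j < n" for j using w that by (auto simp: weights_def)
  show s: "(\<Sum>j\<in>?J. p j) = 1 - p i" using w i by (simp add: sum_diff1 weights_def)
  have q: "(\<Sum>j<n. (p j)\<^sup>2) = (p i)\<^sup>2 + (\<Sum>j\<in>?J. (p j)\<^sup>2)"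
    using i by (simp add: sum_diff1)
  have le: "p j \<le> 1 - p i" if "j \<in> ?J" for j
    unfolding s[symmetric] using that nonneg by (intro member_le_sum) auto
  have "(\<Sum>j\<in>?J. (p j)\<^sup>2) \<le> (\<Sum>j\<in>?J. p j * (1 - p i))"
    unfolding power2_eq_square using le nonneg by (intro sum_mono mult_left_mono) auto
  also have "\<dots> = (1 - p i)\<^sup>2" by (simp add: s power2_eq_square flip: sum_distrib_right)
  finally have u: "(\<Sum>j\<in>?J. (p j)\<^sup>2) \<le> (1 - p i)\<^sup>2" .
  then show "1 - 2 * p i + (\<Sum>j<n. (p j)\<^sup>2) \<le> 2 * (1 - p i)\<^sup>2"
    unfolding q by (simp add: power2_eq_square algebra_simps)
  show "(\<Sum>j<n. (p j)\<^sup>2) \<le> 1"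
  proof -
    have "(\<Sum>j<n. (p j)\<^sup>2) \<le> (\<Sum>j<n. p j)"
      using weights_le_1[OF w] by (intro sum_mono) (auto simp: power2_eq_square mult_left_le_one_le)
    then show ?thesis using w by (simp add: weights_def)
  qed
  have "(\<Sum>j\<in>?J. p j)\<^sup>2 \<le> (\<Sum>j\<in>?J. (p j)\<^sup>2) * real (card ?J)" by (rule sum_squared_le_sum_of_squares)
  moreover have "real (card ?J) = real n - 1" using i by (simp add: of_nat_diff)
  ultimately have c: "(1 - p i)\<^sup>2 \<le> (\<Sum>j\<in>?J. (p j)\<^sup>2) * (real n - 1)" unfolding s by simp
  have "(1 - p i)\<^sup>2 / (real n - 1) \<le> (\<Sum>j\<in>?J. (p j)\<^sup>2)"
  proof (cases "n = 1")
    case False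
    then have "0 < real n - 1" using i by simp
    then show ?thesis using c by (simp add: pos_divide_le_eq)
  qed (auto intro: sum_nonneg)
  then show "(1 - p i)\<^sup>2 * (1 + 1 / (real n - 1)) \<le> 1 - 2 * p i + (\<Sum>j<n. (p j)\<^sup>2)"
  proof -
    have "1 - 2 * p i + (\<Sum>j<n. (p j)\<^sup>2) = (1 - p i)\<^sup>2 + (\<Sum>j\<in>?J. (p j)\<^sup>2)"
      unfolding q by (simp add: power2_eq_square algebra_simps)
    then show ?thesis using \<open>(1 - p i)\<^sup>2 / (real n - 1) \<le> _\<close> by (simp add: distrib_left)
  qed
qed

text \<open>The asset's own drift is isolated because it has to be cancelled exactly near
  \<open>1 - \<delta>\<close>. The sum over the others is only estimated: from below by the bound on
  \<open>x * g x\<close>, from above where all the others have weight at most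
  \<open>1 / 2\<close>.\<close>

lemma generator_eq:
  assumes "weights n p" "i < n"
  shows "(\<Sum>j<n. grad f1 i p j * - g (p j)) + (\<Sum>j<n. hess f1 f2 i p j j)
    = f1 (p i) * p i * (- (1 - p i) * g (p i) + (\<Sum>j\<in>{..<n} - {i}. p j * g (p j)) + (\<Sum>j<n. (p j)\<^sup>2) - p i)
      + f2 (p i) * (p i)\<^sup>2 / 2 * (1 - 2 * p i + (\<Sum>j<n. (p j)\<^sup>2))"
proof -
  have "(\<Sum>j<n. grad f1 i p j * - g (p j)) = (\<Sum>j<n. f1 (p i) * p i * (p j * g (p j)) - f1 (p i) * p i * (kron j i * g (p j)))"
    by (intro sum.cong refl) (simp add: grad_def algebra_simps)
  also have "\<dots> = f1 (p i) * p i * ((\<Sum>j<n. p j * g (p j)) - g (p i))"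
    by (simp add: sum_subtractf sum_kron assms(2) right_diff_distrib flip: sum_distrib_left)
  also have "(\<Sum>j<n. p j * g (p j)) = p i * g (p i) + (\<Sum>j\<in>{..<n} - {i}. p j * g (p j))"
    using assms(2) by (simp add: sum_diff1)
  finally show ?thesis unfolding hess_trace[OF assms(2,1)] by (simp add: algebra_simps)
qed

section \<open>Generator bounds for the two test functions\<close>

context market_limits
begin

lemma p_range:
  assumes "4 \<le> K" "i < n" "min_weight K \<le> p i \<and> p i \<le> max_weight K"
  shows "0 < p i" "p i < 1 - \<delta>"
  using assms min_max_weight[OF assms(1)] by auto

definition C2_on :: "(real \<Rightarrow> real) \<Rightarrow> (real \<Rightarrow> real) \<Rightarrow> (real \<Rightarrow> real) \<Rightarrow> bool" where
  "C2_on f f1 f2 \<longleftrightarrow> (\<forall>x<1 - \<delta>. (f has_real_derivative f1 x) (at x)) \<and>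
     (\<forall>x<1 - \<delta>. (f1 has_real_derivative f2 x) (at x)) \<and> continuous_on {..<1 - \<delta>} f2"

text \<open>The bound ranges over all weights below \<open>1 - \<delta>\<close>, not just a compact
  region, so that \<open>c\<close> stays fixed while \<open>K\<close> grows.\<close>

definition drift_ge :: "real \<Rightarrow> nat \<Rightarrow> (real \<Rightarrow> real) \<Rightarrow> (real \<Rightarrow> real) \<Rightarrow> bool" where
  "drift_ge c i f1 f2 \<longleftrightarrow> (\<forall>p. weights n p \<longrightarrow> (\<forall>j<n. 0 < p j \<and> p j < 1 - \<delta>) \<longrightarrow>
     c \<le> (\<Sum>j<n. grad f1 i p j * - g (p j)) + (\<Sum>j<n. hess f1 f2 i p j j))"

text \<open>With \<open>E' = a\<close> and \<open>f1 = exp E\<close> the generator is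
  \<open>exp E\<close> times an expression to be kept above a positive constant. The quadratic
  variation is bounded from below, which helps only if \<open>f2\<close> is nonnegative; hence the
  positive part of \<open>g\<close>. Near 0 the negative \<open>g\<close> itself supplies upward
  drift, elsewhere the extra curvature \<open>C'\<close> does the work.\<close>

lemma lower_function:
  assumes y: "0 < y" "y < 1 - \<delta>"
  shows "\<exists>f f1 f2 c D. 0 < c \<and> C2_on f f1 f2 \<and> (\<forall>i<n. drift_ge c i f1 f2) \<and> (\<forall>x. 0 \<le> f1 x) \<and>
     (\<forall>x. y \<le> x \<longrightarrow> x < 1 - \<delta> \<longrightarrow> f1 x \<le> exp D * exp (integral {y..x} (\<lambda>z. A1 n z * g z)))"
proof -
  obtain c0 r where r: "0 < c0" "0 < r" "r < 1 / 2" "\<And>x. 0 < x \<Longrightarrow> x < r \<Longrightarrow> x * g x \<le> - c0" using g_near_0 by metis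
  obtain C where C: "0 \<le> C" "\<And>x. 0 < x \<Longrightarrow> x < 1 - \<delta> \<Longrightarrow> - C \<le> x * g x" using g_bounded_below by metis
  \<comment> \<open>Drift that may be lost: \<open>n * C\<close> through the other assets and 1
    through the term \<open>- q\<close>.\<close>
  define C2 where "C2 = real n * C + 1"
  have C2: "1 \<le> C2" using C by (simp add: C2_def)
  \<comment> \<open>Below \<open>r2\<close> the drift gained from \<open>x * g x \<le> - c0\<close>
    is at least \<open>c0 * \<delta>\<close>, twice what \<open>C2 * q\<close> can take
    away.\<close>
  define r2 where "r2 = min r (c0 * \<delta> / (2 * C2))"
  have r2: "0 < r2" "r2 \<le> r" using r C2 delta by (auto simp: r2_def)
  have C2r2: "C2 * r2 \<le> c0 * \<delta> / 2"
  proof -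
    have "C2 * r2 \<le> C2 * (c0 * \<delta> / (2 * C2))" using C2 by (intro mult_left_mono) (auto simp: r2_def)
    also have "\<dots> = c0 * \<delta> / 2" using C2 by simp
    finally show ?thesis .
  qed
  \<comment> \<open>From \<open>r2\<close> on the curvature contributes at least
    \<open>2 * C2 * q\<close>: one half offsets the loss \<open>C2 * q\<close>, the other leaves at
    least \<open>C2 * r2\<close>, which is the constant \<open>c\<close>.\<close>
  define C' where "C' = 4 * C2 / (r2 * \<delta>\<^sup>2)"
  have C': "0 < C'" using C2 r2 delta by (simp add: C'_def)
  \<comment> \<open>For \<open>x < r\<close> the positive part vanishes, so \<open>a\<close> is
    constant there and continues across 0; antiderivatives can then be taken on all of
    \<open>{..<1 - \<delta>}\<close>.\<close>
  define a where "a x = C' + (if x \<le> 0 then 0 else A1 n x * max 0 (g x))" for x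
  have A1p: "0 < A1 n x" if "0 < x" "x < 1 - \<delta>" for x
    using that n2 delta by (auto simp: A1_def intro!: mult_pos_pos divide_pos_pos add_pos_nonneg)
  have gneg: "g x < 0" if "0 < x" "x < r" for x
  proof -
    have "x * g x < 0" using r(1) r(4)[OF that] by linarith
    then show ?thesis using that by (simp add: mult_less_0_iff)
  qed
  have az: "a x = C'" if "x < r" for x using that gneg[of x] by (cases "x \<le> 0") (auto simp: a_def max_def)
  have A1c: "continuous_on {0<..<1 - \<delta>} (A1 n)"
    unfolding A1_def[abs_def] using delta by (intro continuous_intros) auto
  have ac: "continuous_on {..<1 - \<delta>} a"
  proof -
    have 1: "continuous_on {..<r} a"
      by (rule continuous_on_cong[THEN iffD2, OF refl _ continuous_on_const[of _ C']]) (use az in auto)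
    have 2: "continuous_on {0<..<1 - \<delta>} a"
      by (rule continuous_on_cong[THEN iffD2, OF refl, of _ _ "\<lambda>x. C' + A1 n x * max 0 (g x)"])
        (auto simp: a_def intro!: continuous_intros A1c g_continuous)
    have "continuous_on ({..<r} \<union> {0<..<1 - \<delta>}) a" by (rule continuous_on_open_Un[OF _ _ 1 2]) auto
    moreover have "{..<r} \<union> {0<..<1 - \<delta>} = {..<1 - \<delta>}" using r delta by auto
    ultimately show ?thesis by simp
  qed
  have a0: "0 \<le> a x" if "x < 1 - \<delta>" for x using A1p[of x] C' that by (auto simp: a_def)
  define c where "c = C2 * r2"
  have c0: "0 < c" using C2 r2 by (simp add: c_def)
  have b0: "0 < 1 - \<delta>" using delta by simp
  obtain E where E: "\<And>x. x < 1 - \<delta> \<Longrightarrow> (E has_real_derivative a x) (at x)" "E 0 = 0"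
    using antiderivative_lessThan[OF ac b0] by blast
  define f1 where "f1 x = exp (E x)" for x
  define f2 where "f2 x = exp (E x) * a x" for x
  have f1: "(f1 has_real_derivative f2 x) (at x)" if "x < 1 - \<delta>" for x
    unfolding f1_def[abs_def] f2_def by (auto intro!: derivative_eq_intros E(1)[OF that])
  have Ec: "continuous_on {..<1 - \<delta>} E"
    using E(1) by (intro continuous_at_imp_continuous_on ballI) (blast intro: DERIV_isCont)
  have f1c: "continuous_on {..<1 - \<delta>} f1" unfolding f1_def by (intro continuous_intros Ec)
  have f2c: "continuous_on {..<1 - \<delta>} f2" unfolding f2_def by (intro continuous_intros Ec ac)
  obtain f where f: "\<And>x. x < 1 - \<delta> \<Longrightarrow> (f has_real_derivative f1 x) (at x)"
    using antiderivative_lessThan[OF f1c b0] by blast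
  \<comment> \<open>\<open>a\<close> exceeds \<open>A1 n x * g x\<close> by exactly
    \<open>C'\<close> where \<open>g\<close> is nonnegative and by a bounded amount on the compact
    rest, so \<open>E\<close> exceeds the integral in the hypothesis by at most a constant.\<close>
  have growth: "\<exists>D. \<forall>x. y \<le> x \<longrightarrow> x < 1 - \<delta> \<longrightarrow> E x \<le> D + integral {y..x} (\<lambda>z. A1 n z * g z)"
  proof -
    have "\<forall>\<^sub>F x in at_left (1 - \<delta>). 0 \<le> g x" using adm by (auto simp: admissible_def filterlim_at_top)
    then obtain x3 where x3: "x3 < 1 - \<delta>" "\<forall>x>x3. x < 1 - \<delta> \<longrightarrow> 0 \<le> g x" by (auto simp: eventually_at_left_field)
    define h where "h x = a x - A1 n x * g x" for x
    have hc: "continuous_on {y..max y x3} h" unfolding h_def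
      by (intro continuous_intros continuous_on_subset[OF ac] continuous_on_subset[OF A1c] continuous_on_subset[OF g_continuous])
        (use y x3 in auto)
    then have "bounded (h ` {y..max y x3})" by (intro compact_imp_bounded compact_continuous_image) auto
    then obtain B where B: "\<forall>x\<in>{y..max y x3}. \<bar>h x\<bar> \<le> B" by (auto simp: bounded_iff)
    define B' where "B' = max B C'"
    have hB: "h x \<le> B'" if x: "y \<le> x" "x < 1 - \<delta>" for x
    proof (cases "x \<le> x3")
      case True then have "\<bar>h x\<bar> \<le> B" using B x by auto
      then show ?thesis by (simp add: B'_def)
    next
      case False then have "h x = C'" using x3 x y by (auto simp: h_def a_def max_def)
      then show ?thesis by (simp add: B'_def)
    qed
    have B'0: "0 \<le> B'" using C' by (simp add: B'_def)
    show "\<exists>D. \<forall>x. y \<le> x \<longrightarrow> x < 1 - \<delta> \<longrightarrow> E x \<le> D + integral {y..x} (\<lambda>z. A1 n z * g z)"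
    proof (intro exI allI impI)
      fix x assume x: "y \<le> x" "x < 1 - \<delta>"
      have cI: "continuous_on {y..x} (\<lambda>z. A1 n z * g z)"
        by (intro continuous_intros continuous_on_subset[OF A1c] continuous_on_subset[OF g_continuous]) (use x y in auto)
      have "(a has_integral (E x - E y)) {y..x}"
        by (rule fundamental_theorem_of_calculus[OF x(1)])
          (use E x in \<open>auto simp: has_real_derivative_iff_has_vector_derivative[symmetric] intro: has_field_derivative_at_within\<close>)
      then have "(h has_integral (E x - E y - integral {y..x} (\<lambda>z. A1 n z * g z))) {y..x}"
        unfolding h_def by (intro has_integral_diff integrable_integral integrable_continuous_interval cI)
      moreover have "((\<lambda>_. B') has_integral (B' * (x - y))) {y..x}"
        using has_integral_const_real[of B' y x] x by (simp add: mult.commute)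
      ultimately have "E x - E y - integral {y..x} (\<lambda>z. A1 n z * g z) \<le> B' * (x - y)"
        by (rule has_integral_le) (use hB x in auto)
      also have "\<dots> \<le> B' * (1 - \<delta>)" using B'0 x y by (intro mult_left_mono) auto
      finally show "E x \<le> (E y + B' * (1 - \<delta>)) + integral {y..x} (\<lambda>z. A1 n z * g z)" by simp
    qed
  qed
  have drift: "drift_ge c i f1 f2" if i: "i < n" for i
    unfolding drift_ge_def
  proof (intro allI impI)
    fix p assume w: "weights n p" and "\<forall>j<n. 0 < p j \<and> p j < 1 - \<delta>"
    then have pr: "\<And>j. j < n \<Longrightarrow> 0 < p j \<and> p j < 1 - \<delta>" by blast
    define q where "q = p i"
    have q: "0 < q" "q < 1 - \<delta>" using pr[OF i] by (auto simp: q_def)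
    \<comment> \<open>\<open>E\<close> is nondecreasing and vanishes at 0, so the factor
      \<open>exp (E q)\<close> cannot shrink the lower bound.\<close>
    have e1: "1 \<le> exp (E q)"
    proof -
      have "E 0 \<le> E q"
      proof (rule DERIV_nonneg_imp_nondecreasing[where f=E])
        fix x assume "0 \<le> x" "x \<le> q"
        then show "\<exists>z. (E has_real_derivative z) (at x) \<and> 0 \<le> z" using E(1)[of x] a0[of x] q by auto
      qed (use q in auto)
      then show ?thesis using E(2) by simp
    qed
    have oth: "- (real n * C) \<le> (\<Sum>j\<in>{..<n} - {i}. p j * g (p j))"
    proof -
      have "(\<Sum>j\<in>{..<n} - {i}. - C) \<le> (\<Sum>j\<in>{..<n} - {i}. p j * g (p j))"
        using C(2) pr by (intro sum_mono) auto
      moreover have "(real n - 1) * C \<le> real n * C" using C(1) by (intro mult_right_mono) auto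
      ultimately show ?thesis using i by (simp add: of_nat_diff)
    qed
    define \<kappa> where "\<kappa> = 1 + 1 / (real n - 1)"
    have \<kappa>: "1 \<le> \<kappa>" using n2 by (simp add: \<kappa>_def)
    \<comment> \<open>At the smallest possible quadratic variation the second-order term reproduces
      the downward drift \<open>q * (1 - q) * g q\<close> wherever \<open>g q\<close> is positive,
      and the \<open>C'\<close> term is left over as gain.\<close>
    have ga: "a q * q\<^sup>2 / 2 * ((1 - q)\<^sup>2 * \<kappa>) = q * (1 - q) * max 0 (g q) + C' * \<kappa> / 2 * (q\<^sup>2 * (1 - q)\<^sup>2)"
    proof -
      define u where "u = q * (1 - q)"
      have u: "u \<noteq> 0" using q delta by (simp add: u_def)
      have aq: "a q = C' + (2 / \<kappa>) * (1 / u) * max 0 (g q)" using q by (simp add: a_def A1_def \<kappa>_def u_def)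
      have "(2 / \<kappa>) * (1 / u) * max 0 (g q) * (u\<^sup>2 * \<kappa> / 2) = u * max 0 (g q)"
        using u \<kappa> by (simp add: power2_eq_square)
      then have "a q * (u\<^sup>2 * \<kappa> / 2) = u * max 0 (g q) + C' * \<kappa> / 2 * u\<^sup>2"
        unfolding aq distrib_right by simp
      moreover have "a q * q\<^sup>2 / 2 * ((1 - q)\<^sup>2 * \<kappa>) = a q * (u\<^sup>2 * \<kappa> / 2)"
        by (simp add: u_def power_mult_distrib)
      ultimately show ?thesis by (simp add: u_def power_mult_distrib)
    qed
    have "a q * q\<^sup>2 / 2 * ((1 - q)\<^sup>2 * \<kappa>) \<le> a q * q\<^sup>2 / 2 * (1 - 2 * q + (\<Sum>j<n. (p j)\<^sup>2))"
      using weights_others(2)[OF w i] a0[OF q(2)] unfolding \<kappa>_def q_def by (intro mult_left_mono) auto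
    then have h1: "q * (1 - q) * max 0 (g q) + C' * \<kappa> / 2 * (q\<^sup>2 * (1 - q)\<^sup>2) \<le> a q * q\<^sup>2 / 2 * (1 - 2 * q + (\<Sum>j<n. (p j)\<^sup>2))"
      using ga by simp
    have "C' * 1 / 2 * (q\<^sup>2 * \<delta>\<^sup>2) \<le> C' * \<kappa> / 2 * (q\<^sup>2 * (1 - q)\<^sup>2)"
      using C' \<kappa> q delta by (intro mult_mono divide_right_mono mult_left_mono power_mono) auto
    have dr: "- (1 - q) * g q - C2 \<le> - (1 - q) * g q + (\<Sum>j\<in>{..<n} - {i}. p j * g (p j)) + (\<Sum>j<n. (p j)\<^sup>2) - q"
      using oth q delta sum_nonneg[of "{..<n}" "\<lambda>j. (p j)\<^sup>2"] unfolding C2_def by simp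
    have "q * (- (1 - q) * g q - C2) \<le> q * (- (1 - q) * g q + (\<Sum>j\<in>{..<n} - {i}. p j * g (p j)) + (\<Sum>j<n. (p j)\<^sup>2) - q)"
      using q by (intro mult_left_mono dr) auto
    then have h2: "q * (1 - q) * (max 0 (g q) - g q) - C2 * q + C' * 1 / 2 * (q\<^sup>2 * \<delta>\<^sup>2)
      \<le> q * (- (1 - q) * g q + (\<Sum>j\<in>{..<n} - {i}. p j * g (p j)) + (\<Sum>j<n. (p j)\<^sup>2) - q) + a q * q\<^sup>2 / 2 * (1 - 2 * q + (\<Sum>j<n. (p j)\<^sup>2))"
    proof -
      have i1: "q * (1 - q) * (max 0 (g q) - g q) = q * (1 - q) * max 0 (g q) - q * (1 - q) * g q"
        by (simp add: right_diff_distrib)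
      have i2: "q * (- (1 - q) * g q - C2) = - (q * (1 - q) * g q) - C2 * q" by (simp add: algebra_simps)
      have arith: "(x - y) - z + v \<le> l + s" if "x + w \<le> s" "v \<le> w" "- y - z \<le> l" for x y z v w l s :: real
        using that by linarith
      show ?thesis unfolding i1
        by (rule arith[OF h1 \<open>C' * 1 / 2 * (q\<^sup>2 * \<delta>\<^sup>2) \<le> _\<close>
            \<open>q * (- (1 - q) * g q - C2) \<le> _\<close>[unfolded i2]])
    qed
    have h3: "c \<le> q * (1 - q) * (max 0 (g q) - g q) - C2 * q + C' * 1 / 2 * (q\<^sup>2 * \<delta>\<^sup>2)"
    proof (cases "q < r2")
      case True
      have gq: "g q < 0" "q * g q \<le> - c0" using gneg[OF q(1)] r(4)[OF q(1)] True r2 by auto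
      then have "c0 * \<delta> \<le> - (q * g q) * (1 - q)" using q delta r by (intro mult_mono) auto
      moreover have "q * (1 - q) * (max 0 (g q) - g q) = - (q * g q) * (1 - q)" using gq by (simp add: max_def)
      moreover have "C2 * q \<le> C2 * r2" using True C2 by (intro mult_left_mono) auto
      moreover have "0 \<le> C' * 1 / 2 * (q\<^sup>2 * \<delta>\<^sup>2)" using C' by simp
      ultimately show ?thesis using C2r2 unfolding c_def by linarith
    next
      case False
      have "0 \<le> q * (1 - q) * (max 0 (g q) - g q)" using q delta by (intro mult_nonneg_nonneg) auto
      moreover have "C2 * r2 \<le> C2 * q" using False C2 by (intro mult_left_mono) auto
      moreover have "C' * 1 / 2 * (q * r2 * \<delta>\<^sup>2) \<le> C' * 1 / 2 * (q\<^sup>2 * \<delta>\<^sup>2)"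
        using False q C' unfolding power2_eq_square[of q] by (intro mult_left_mono mult_right_mono) auto
      moreover have "C' * 1 / 2 * (q * r2 * \<delta>\<^sup>2) = 2 * C2 * q"
        using r2 delta by (simp add: C'_def field_simps)
      ultimately show ?thesis unfolding c_def by linarith
    qed
    have "c \<le> exp (E q) * c" using e1 C2 r2 by (simp add: c_def)
    also have "\<dots> \<le> exp (E q) * (q * (- (1 - q) * g q + (\<Sum>j\<in>{..<n} - {i}. p j * g (p j)) + (\<Sum>j<n. (p j)\<^sup>2) - q) + a q * q\<^sup>2 / 2 * (1 - 2 * q + (\<Sum>j<n. (p j)\<^sup>2)))"
      using h2 h3 by (intro mult_left_mono) auto
    also have "\<dots> = (\<Sum>j<n. grad f1 i p j * - g (p j)) + (\<Sum>j<n. hess f1 f2 i p j j)"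
      unfolding generator_eq[OF w i] f1_def f2_def by (simp add: q_def distrib_left mult.assoc)
    finally show "c \<le> (\<Sum>j<n. grad f1 i p j * - g (p j)) + (\<Sum>j<n. hess f1 f2 i p j j)" .
  qed
  obtain D where "\<And>x. y \<le> x \<Longrightarrow> x < 1 - \<delta> \<Longrightarrow> E x \<le> D + integral {y..x} (\<lambda>z. A1 n z * g z)"
    using growth by blast
  then have "f1 x \<le> exp D * exp (integral {y..x} (\<lambda>z. A1 n z * g z))" if "y \<le> x" "x < 1 - \<delta>" for x
    using that by (simp add: f1_def flip: exp_add)
  moreover have "C2_on f f1 f2" using f f1 f2c by (simp add: C2_on_def)
  moreover have "0 \<le> f1 x" for x by (simp add: f1_def)
  ultimately show ?thesis using c0 drift by blast
qed

text \<open>Now the generator needs an upper bound, so the quadratic variation is replaced by its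
  largest value. Keeping \<open>f\<close> at 0 up to some \<open>u > 1 / 2\<close> forces all other
  weights to be at most \<open>1 / 2\<close> wherever \<open>f\<close> matters, and there
  \<open>g\<close> is bounded above. The drift is stated for \<open>- f\<close>, to be fed to the
  same Dynkin inequality.\<close>

lemma upper_function:
  assumes y: "0 < y" "y < 1 - \<delta>"
  shows "\<exists>f f1 f2 B m D. 0 \<le> B \<and> C2_on f f1 f2 \<and> (\<forall>x. 0 \<le> f1 x) \<and> (\<forall>x<1 - \<delta>. 0 \<le> f x) \<and>
     (\<forall>i<n. drift_ge (- B) i (\<lambda>x. - f1 x) (\<lambda>x. - f2 x)) \<and> y \<le> m \<and> m < 1 - \<delta> \<and> 0 \<le> D \<and>
     (\<forall>x. m \<le> x \<longrightarrow> x < 1 - \<delta> \<longrightarrow> exp (integral {y..x} (\<lambda>z. A2 z * g z)) \<le> D * f1 x)"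
proof -
  obtain Cg where Cg: "0 \<le> Cg" "\<And>x. 0 < x \<Longrightarrow> x \<le> 1 / 2 \<Longrightarrow> g x \<le> Cg"
    using g_bounded_above[of "1 / 2"] delta by auto
  define C2 where "C2 = real n * Cg + 1"
  have C2: "1 \<le> C2" using Cg by (simp add: C2_def)
  \<comment> \<open>Makes \<open>C' * (q * \<delta>)\<^sup>2 = 2 * C2 * q\<^sup>2\<close>, which is
    at least \<open>C2 * q\<close> for \<open>q \<ge> 1 / 2\<close>; so the subtracted
    \<open>C'\<close> absorbs the drift of the other assets.\<close>
  define C' where "C' = 2 * C2 / \<delta>\<^sup>2"
  have C': "0 < C'" using C2 delta by (simp add: C'_def)
  have "\<forall>\<^sub>F x in at_left (1 - \<delta>). C' \<le> g x" using adm by (auto simp: admissible_def filterlim_at_top)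
  then obtain x3 where x3: "x3 < 1 - \<delta>" "\<forall>x>x3. x < 1 - \<delta> \<longrightarrow> C' \<le> g x" by (auto simp: eventually_at_left_field)
  \<comment> \<open>From \<open>u\<close> on, \<open>g\<close> is at least \<open>C'\<close>, which
    together with \<open>A2 \<ge> 1\<close> makes \<open>a\<close> nonnegative, and the weight
    exceeds \<open>1 / 2\<close>.\<close>
  define u where "u = (max x3 (1 / 2) + (1 - \<delta>)) / 2"
  have u: "x3 < u" "1 / 2 < u" "u < 1 - \<delta>" using x3 delta by (auto simp: u_def max_def)
  have gu: "C' \<le> g x" if "u \<le> x" "x < 1 - \<delta>" for x using that u x3 by auto
  define v where "v = (u + (1 - \<delta>)) / 2"
  have v: "u < v" "v < 1 - \<delta>" using u by (auto simp: v_def)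
  have A2c: "continuous_on {0<..<1 - \<delta>} A2"
    unfolding A2_def[abs_def] using delta by (intro continuous_intros) auto
  have A2g: "1 \<le> A2 x" if "0 < x" "x < 1 - \<delta>" for x
  proof -
    have "x * (1 - x) \<le> 1 * 1" using that delta by (intro mult_mono) auto
    then show ?thesis using that delta by (simp add: A2_def)
  qed
  define a where "a x = A2 (max x u) * g (max x u) - C'" for x
  have ac: "continuous_on {..<1 - \<delta>} a" unfolding a_def
    by (intro continuous_intros continuous_on_compose2[OF A2c] continuous_on_compose2[OF g_continuous]) (use u in auto)
  have a0: "0 \<le> a x" if "x < 1 - \<delta>" for x
  proof -
    have "C' \<le> g (max x u)" using gu[of "max x u"] that u by auto
    moreover have "1 \<le> A2 (max x u)" using A2g[of "max x u"] that u by auto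
    ultimately have "1 * C' \<le> A2 (max x u) * g (max x u)" using C' by (intro mult_mono) auto
    then show ?thesis by (simp add: a_def)
  qed
  obtain E where E: "\<And>x. x < 1 - \<delta> \<Longrightarrow> (E has_real_derivative a x) (at x)" "E u = 0"
    using antiderivative_lessThan[OF ac u(3)] by blast
  have Emono: "E x \<le> E z" if "x \<le> z" "z < 1 - \<delta>" for x z
  proof (rule DERIV_nonneg_imp_nondecreasing[where f=E, OF that(1)])
    fix w assume "x \<le> w" "w \<le> z"
    then show "\<exists>y. (E has_real_derivative y) (at w) \<and> 0 \<le> y" using E(1)[of w] a0[of w] that by auto
  qed
  \<comment> \<open>The slope of the ramp is a continuous bump on \<open>{u..v}\<close>, so the ramp
    is continuously differentiable and \<open>f\<close> is twice so.\<close>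
  define r' where "r' x = max 0 ((x - u) * (v - x))" for x
  have r'c: "continuous_on UNIV r'" unfolding r'_def by (intro continuous_intros)
  obtain r where r: "\<And>x. (r has_real_derivative r' x) (at x)" "r u = 0" using antiderivative_UNIV[OF r'c] by blast
  have r'0: "0 \<le> r' x" for x by (simp add: r'_def)
  have r'z: "r' x = 0" if "x \<le> u \<or> v \<le> x" for x
    using that v by (auto simp: r'_def max_def zero_le_mult_iff)
  have rmono: "r x \<le> r z" if "x \<le> z" for x z
    by (rule DERIV_nonneg_imp_nondecreasing[where f=r, OF that]) (use r(1) r'0 in blast)
  have rz: "r x = 0" if "x \<le> u" for x
  proof -
    have "r x - r u = 0 - (0::real)"
      by (rule equal_derivatives_imp_equal[OF that r(1)]) (use r'z in auto)
    then show ?thesis using r(2) by simp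
  qed
  have r0: "0 \<le> r x" for x using rz[of x] rmono[of u x] r(2) by (cases "x \<le> u") auto
  have rv: "0 < r v"
  proof -
    obtain z where "u < z" "z < v" "r v - r u = (v - u) * r' z" using MVT2[OF v(1) r(1)] by auto
    moreover have "0 < r' z" using calculation by (simp add: r'_def)
    ultimately show ?thesis using r(2) v by simp
  qed
  have r'1: "r' x \<le> 1" for x
  proof (cases "u \<le> x \<and> x \<le> v")
    case True
    then have "(x - u) * (v - x) \<le> 1 * 1" using u v delta by (intro mult_mono) auto
    then show ?thesis by (simp add: r'_def)
  next
    case False then show ?thesis using r'z[of x] by auto
  qed
  define f1 where "f1 x = r x * exp (E x)" for x
  define f2 where "f2 x = r' x * exp (E x) + a x * f1 x" for x
  have f1: "(f1 has_real_derivative f2 x) (at x)" if "x < 1 - \<delta>" for x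
    unfolding f1_def[abs_def] f2_def by (auto intro!: derivative_eq_intros r(1) E(1)[OF that] simp: f1_def)
  have f1c: "continuous_on {..<1 - \<delta>} f1"
    using f1 by (intro continuous_at_imp_continuous_on ballI) (blast intro: DERIV_isCont)
  have Ec: "continuous_on {..<1 - \<delta>} E"
    using E(1) by (intro continuous_at_imp_continuous_on ballI) (blast intro: DERIV_isCont)
  have f2c: "continuous_on {..<1 - \<delta>} f2" unfolding f2_def
    by (intro continuous_intros continuous_on_subset[OF r'c] ac f1c Ec) auto
  obtain f where f: "\<And>x. x < 1 - \<delta> \<Longrightarrow> (f has_real_derivative f1 x) (at x)" "f u = 0"
    using antiderivative_lessThan[OF f1c u(3)] by blast
  have f10: "0 \<le> f1 x" for x using r0 by (simp add: f1_def)
  have fz: "f x = 0" if "x \<le> u" for x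
  proof -
    have "f x - f u = 0 - (0::real)"
    proof (rule equal_derivatives_imp_equal[OF that])
      fix z assume "x \<le> z" "z \<le> u"
      then show "(f has_real_derivative f1 z) (at z)" "((\<lambda>_. 0) has_real_derivative f1 z) (at z)"
        using f(1)[of z] rz[of z] u by (auto simp: f1_def)
    qed
    then show ?thesis using f(2) by simp
  qed
  have f0: "0 \<le> f x" if "x < 1 - \<delta>" for x
  proof (cases "x \<le> u")
    case False
    then have "u \<le> x" by simp
    then have "f u \<le> f x"
    proof (rule DERIV_nonneg_imp_nondecreasing[where f=f])
      fix z assume "u \<le> z" "z \<le> x"
      then show "\<exists>y. (f has_real_derivative y) (at z) \<and> 0 \<le> y" using f(1)[of z] f10[of z] that by auto
    qed
    then show ?thesis using f(2) by simp
  qed (use fz in auto)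
  \<comment> \<open>Only the slope of the ramp escapes the cancellation; it lives on
    \<open>{u..v}\<close>, where \<open>exp E\<close> is at most \<open>exp (E v)\<close> and the
    remaining factors are at most 1.\<close>
  define B where "B = exp (E v)"
  have B0: "0 \<le> B" by (simp add: B_def)
  have growth: "\<exists>m D. y \<le> m \<and> m < 1 - \<delta> \<and> 0 \<le> D \<and> (\<forall>x. m \<le> x \<longrightarrow> x < 1 - \<delta> \<longrightarrow> exp (integral {y..x} (\<lambda>z. A2 z * g z)) \<le> D * f1 x)"
  proof (intro exI conjI allI impI)
      define m where "m = max y v"
      define I where "I x = integral {y..x} (\<lambda>z. A2 z * g z)" for x
      \<comment> \<open>Beyond \<open>m\<close> the ramp is at least \<open>r v\<close>, and
        \<open>A2 z * g z\<close> exceeds \<open>a z\<close> by \<open>C'\<close>, which integrates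
        to at most \<open>C' * (1 - \<delta>)\<close>.\<close>
      define D where "D = exp (I m + C' * (1 - \<delta>) - E m) / r v"
      show "y \<le> m" "m < 1 - \<delta>" using y v by (auto simp: m_def)
      show "0 \<le> D" using rv by (simp add: D_def)
      fix x assume x: "m \<le> x" "x < 1 - \<delta>"
      have cI: "continuous_on {y..x} (\<lambda>z. A2 z * g z)"
        by (intro continuous_intros continuous_on_subset[OF A2c] continuous_on_subset[OF g_continuous]) (use x y in auto)
      have "I m + integral {m..x} (\<lambda>z. A2 z * g z) = I x"
        unfolding I_def using x y by (intro Henstock_Kurzweil_Integration.integral_combine integrable_continuous_interval cI) (auto simp: m_def)
      moreover have ai: "(a has_integral (E x - E m)) {m..x}"
        by (rule fundamental_theorem_of_calculus[OF x(1)])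
          (use E x in \<open>auto simp: has_real_derivative_iff_has_vector_derivative[symmetric] intro: has_field_derivative_at_within\<close>)
      moreover have "E x - E m = integral {m..x} a" using ai by (simp add: integral_unique)
      moreover have "integral {m..x} a = integral {m..x} (\<lambda>z. A2 z * g z - C')"
        by (intro Henstock_Kurzweil_Integration.integral_cong) (use v in \<open>auto simp: a_def m_def max_def split: if_splits\<close>)
      moreover have "integral {m..x} (\<lambda>z. A2 z * g z - C') = integral {m..x} (\<lambda>z. A2 z * g z) - integral {m..x} (\<lambda>z. C')"
        by (intro integral_diff integrable_continuous_interval continuous_on_subset[OF cI] continuous_on_const) (auto simp: m_def)
      moreover have "integral {m..x} (\<lambda>z. C') = C' * (x - m)" using x by simp
      moreover have "C' * (x - m) \<le> C' * (1 - \<delta>)" using C' x y by (intro mult_left_mono) (auto simp: m_def)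
      ultimately have "I x \<le> I m + C' * (1 - \<delta>) - E m + E x" by linarith
      then have "exp (I x) \<le> exp (I m + C' * (1 - \<delta>) - E m + E x)" by simp
      also have "\<dots> = D * (r v * exp (E x))" using rv unfolding exp_add[of _ "E x"] by (simp add: D_def)
      also have "\<dots> \<le> D * f1 x"
        unfolding f1_def using rmono[of v x] x \<open>0 \<le> D\<close> by (intro mult_left_mono mult_right_mono) (auto simp: m_def)
      finally show "exp (integral {y..x} (\<lambda>z. A2 z * g z)) \<le> D * f1 x" by (simp add: I_def)
    qed
  have drift: "drift_ge (- B) i (\<lambda>x. - f1 x) (\<lambda>x. - f2 x)" if i: "i < n" for i
    unfolding drift_ge_def
  proof (intro allI impI)
    fix p assume w: "weights n p" and "\<forall>j<n. 0 < p j \<and> p j < 1 - \<delta>"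
    then have pr: "\<And>j. j < n \<Longrightarrow> 0 < p j \<and> p j < 1 - \<delta>" by blast
    define q where "q = p i"
    have q: "0 < q" "q < 1 - \<delta>" using pr[OF i] by (auto simp: q_def)
    define G where "G = f1 q * q * (- (1 - q) * g q + (\<Sum>j\<in>{..<n} - {i}. p j * g (p j)) + (\<Sum>j<n. (p j)\<^sup>2) - q)
        + f2 q * q\<^sup>2 / 2 * (1 - 2 * q + (\<Sum>j<n. (p j)\<^sup>2))"
    have "G \<le> B"
    proof (cases "q \<le> u")
      case True
      then have "f1 q = 0" "f2 q = 0" using rz[of q] r'z[of q] by (auto simp: f1_def f2_def)
      then show ?thesis by (simp add: G_def B_def)
    next
      case False
      have small: "p j \<le> 1 / 2" if "j \<in> {..<n} - {i}" for j
      proof -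
        have "p j \<le> (\<Sum>j\<in>{..<n} - {i}. p j)" using that pr by (intro member_le_sum) (auto intro: less_imp_le)
        then show ?thesis using weights_others(1)[OF w i] False u by (simp add: q_def)
      qed
      have "(\<Sum>j\<in>{..<n} - {i}. p j * g (p j)) \<le> (\<Sum>j\<in>{..<n} - {i}. Cg)"
      proof (rule sum_mono)
        fix j assume j: "j \<in> {..<n} - {i}"
        have "p j * g (p j) \<le> p j * Cg" using Cg(2)[of "p j"] small[OF j] pr[of j] j by (intro mult_left_mono) auto
        also have "\<dots> \<le> 1 * Cg" using Cg(1) small[OF j] by (intro mult_right_mono) auto
        finally show "p j * g (p j) \<le> Cg" by simp
      qed
      also have "\<dots> \<le> real n * Cg" using i Cg(1) by (simp add: of_nat_diff mult_right_mono)
      finally have oth: "(\<Sum>j\<in>{..<n} - {i}. p j * g (p j)) \<le> real n * Cg" .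
      have aq: "a q = A2 q * g q - C'" using False by (simp add: a_def max_def)
      have f2q: "0 \<le> f2 q" using r'0 a0[OF q(2)] f10 by (simp add: f2_def)
      have "f1 q * q * (- (1 - q) * g q + (\<Sum>j\<in>{..<n} - {i}. p j * g (p j)) + (\<Sum>j<n. (p j)\<^sup>2) - q) \<le> f1 q * q * (- (1 - q) * g q + C2)"
        using oth weights_others(4)[OF w i] q f10 unfolding C2_def by (intro mult_left_mono) auto
      moreover have "f2 q * q\<^sup>2 / 2 * (1 - 2 * q + (\<Sum>j<n. (p j)\<^sup>2)) \<le> f2 q * q\<^sup>2 / 2 * (2 * (1 - q)\<^sup>2)"
        using weights_others(3)[OF w i] f2q unfolding q_def by (intro mult_left_mono) auto
      moreover have "f2 q * q\<^sup>2 / 2 * (2 * (1 - q)\<^sup>2) = r' q * exp (E q) * (q * (1 - q))\<^sup>2 + f1 q * (q * (1 - q) * g q - C' * (q * (1 - q))\<^sup>2)"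
      proof -
        have "A2 q * (q * (1 - q))\<^sup>2 = q * (1 - q)" using q delta by (simp add: A2_def power2_eq_square)
        then have "a q * (q * (1 - q))\<^sup>2 = q * (1 - q) * g q - C' * (q * (1 - q))\<^sup>2"
          unfolding aq left_diff_distrib by (metis mult.assoc mult.commute)
        moreover have "f2 q * q\<^sup>2 / 2 * (2 * (1 - q)\<^sup>2) = r' q * exp (E q) * (q * (1 - q))\<^sup>2 + f1 q * (a q * (q * (1 - q))\<^sup>2)"
          unfolding power_mult_distrib by (simp add: f2_def distrib_left distrib_right mult_ac)
        ultimately show ?thesis by simp
      qed
      moreover have "f1 q * q * (- (1 - q) * g q + C2) + f1 q * (q * (1 - q) * g q - C' * (q * (1 - q))\<^sup>2)
         = f1 q * (C2 * q - C' * (q * (1 - q))\<^sup>2)" by (simp add: algebra_simps)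
      moreover have "f1 q * (C2 * q - C' * (q * (1 - q))\<^sup>2) \<le> 0"
      proof -
        have "(q * \<delta>)\<^sup>2 \<le> (q * (1 - q))\<^sup>2" using q delta by (intro power_mono mult_left_mono) auto
        then have "C' * (q * \<delta>)\<^sup>2 \<le> C' * (q * (1 - q))\<^sup>2" using C' by (intro mult_left_mono) auto
        moreover have "C' * (q * \<delta>)\<^sup>2 = 2 * C2 * q\<^sup>2" using delta by (simp add: C'_def power_mult_distrib)
        moreover have "C2 * q * 1 \<le> C2 * q * (2 * q)" using False u C2 q by (intro mult_left_mono) auto
        moreover have "C2 * q * (2 * q) = 2 * C2 * q\<^sup>2" by (simp add: power2_eq_square)
        ultimately have "C2 * q - C' * (q * (1 - q))\<^sup>2 \<le> 0" unfolding mult_1_right by linarith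
        then show ?thesis using f10[of q] by (simp add: mult_nonneg_nonpos)
      qed
      moreover have "r' q * exp (E q) * (q * (1 - q))\<^sup>2 \<le> B"
      proof (cases "v \<le> q")
        case True then show ?thesis using r'z by (simp add: B_def)
      next
        case False
        have "q * (1 - q) \<le> 1 * 1" using q delta by (intro mult_mono) auto
        then have "(q * (1 - q))\<^sup>2 \<le> 1" using q delta by (intro power_le_one) auto
        then have "r' q * exp (E q) * (q * (1 - q))\<^sup>2 \<le> 1 * exp (E v) * 1"
          using False Emono[of q v] v r'1[of q] r'0[of q] by (intro mult_mono) auto
        then show ?thesis by (simp add: B_def)
      qed
      ultimately show ?thesis unfolding G_def by linarith
    qed
    moreover have "(\<Sum>j<n. grad (\<lambda>x. - f1 x) i p j * - g (p j)) + (\<Sum>j<n. hess (\<lambda>x. - f1 x) (\<lambda>x. - f2 x) i p j j) = - G"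
      unfolding generator_eq[OF w i] G_def q_def by simp
    ultimately show "- B \<le> (\<Sum>j<n. grad (\<lambda>x. - f1 x) i p j * - g (p j)) + (\<Sum>j<n. hess (\<lambda>x. - f1 x) (\<lambda>x. - f2 x) i p j j)" by simp
  qed
  have "C2_on f f1 f2" using f f1 f2c by (simp add: C2_on_def)
  moreover obtain m D where "y \<le> m" "m < 1 - \<delta>" "0 \<le> D"
    "\<And>x. m \<le> x \<Longrightarrow> x < 1 - \<delta> \<Longrightarrow> exp (integral {y..x} (\<lambda>z. A2 z * g z)) \<le> D * f1 x"
    using growth by blast
  ultimately show ?thesis using B0 f10 f0 drift by blast
qed

end

section \<open>Non-diversity\<close>

lemma eventually_lower_bound_compact:
  fixes \<phi> :: "real \<Rightarrow> real"
  assumes "continuous_on {0..T} \<phi>" "0 \<le> T" "\<And>s. s \<in> {0..T} \<Longrightarrow> 0 < \<phi> s"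
  shows "\<forall>\<^sub>F k in sequentially. \<forall>s\<in>{0..T}. 1 / real k \<le> \<phi> s"
proof -
  obtain s0 where s0: "s0 \<in> {0..T}" "\<And>s. s \<in> {0..T} \<Longrightarrow> \<phi> s0 \<le> \<phi> s"
    using continuous_attains_inf[OF _ _ assms(1)] assms(2) by auto
  have "\<forall>\<^sub>F k in sequentially. 1 / real k < \<phi> s0"
    using assms(3)[OF s0(1)] by (rule order_tendstoD(2)[OF lim_const_over_n])
  then show ?thesis by eventually_elim (use s0(2) in force)
qed

lemma eventually_upper_bound_compact:
  fixes \<phi> :: "real \<Rightarrow> real"
  assumes "continuous_on {0..T} \<phi>" "0 \<le> T"
  shows "\<forall>\<^sub>F k in sequentially. \<forall>s\<in>{0..T}. \<phi> s \<le> real k"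
proof -
  obtain s0 where s0: "s0 \<in> {0..T}" "\<And>s. s \<in> {0..T} \<Longrightarrow> \<phi> s \<le> \<phi> s0"
    using continuous_attains_sup[OF _ _ assms(1)] assms(2) by auto
  have "\<forall>\<^sub>F k in sequentially. \<phi> s0 \<le> real k"
    using filterlim_real_sequentially by (auto simp: filterlim_at_top)
  then show ?thesis by eventually_elim (use s0(2) in force)
qed

text \<open>Continuity of the inner integral is a local matter: around each point a compact interval
  ending strictly before \<open>b\<close> is enough, although \<open>h\<close> may blow up at
  \<open>b\<close>.\<close>

lemma measurable_exp_integral:
  fixes h :: "real \<Rightarrow> real"
  assumes h: "continuous_on {0<..<b} h" and y: "0 < y" "y < b"
  shows "(\<lambda>x. ennreal (exp (integral {y..x} h)) * indicator {y<..<b} x) \<in> borel_measurable lborel"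
proof -
  have "continuous_on {y..<b} (\<lambda>x. integral {y..x} h)"
    unfolding continuous_on_eq_continuous_within
  proof
    fix w assume w: "w \<in> {y..<b}"
    define w' where "w' = (w + b) / 2"
    have w': "w < w'" "w' < b" using w by (auto simp: w'_def)
    have "continuous_on {y..w'} h" by (rule continuous_on_subset[OF h]) (use y w' in auto)
    then have "continuous_on {y..w'} (\<lambda>x. integral {y..x} h)"
      by (intro indefinite_integral_continuous_1 integrable_continuous_interval)
    then have "continuous (at w within {y..w'}) (\<lambda>x. integral {y..x} h)"
      using w w' by (auto simp: continuous_on_eq_continuous_within)
    moreover have "at w within {y..w'} = at w within {y..<b}"
      by (rule at_within_nhd[of _ "{..<w'}"]) (use w w' in auto)
    ultimately show "continuous (at w within {y..<b}) (\<lambda>x. integral {y..x} h)" by simp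
  qed
  then have "continuous_on {y<..<b} (\<lambda>x. exp (integral {y..x} h))"
    by (intro continuous_on_exp) (rule continuous_on_subset, auto)
  then have "(\<lambda>x. indicator {y<..<b} x *\<^sub>R exp (integral {y..x} h)) \<in> borel_measurable borel"
    by (intro borel_measurable_continuous_on_indicator) auto
  then have "(\<lambda>x. ennreal (indicator {y<..<b} x *\<^sub>R exp (integral {y..x} h))) \<in> borel_measurable lborel"
    by measurable
  then show ?thesis
    by (rule measurable_cong[THEN iffD1, rotated]) (simp add: indicator_def)
qed

section \<open>Exhaustion of the state space by compact regions\<close>

context market_limits
begin

lemma total_cap_pos: "(\<And>j. j < n \<Longrightarrow> 0 < X j s \<omega>) \<Longrightarrow> 0 < total_cap n X s \<omega>"
  unfolding total_cap_def using n2 lessThan_empty_iff[of n] by (intro sum_pos) auto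

lemma init_weight_range:
  assumes "i < n" shows "0 < init_weight i" "init_weight i < 1 - \<delta>"
proof -
  have "0 < (\<Sum>j<n. x0 j)" using init n2 lessThan_empty_iff[of n] by (intro sum_pos) auto
  then show "0 < init_weight i" "init_weight i < 1 - \<delta>" using init assms by (auto simp: init_weight_def)
qed

lemma eventually_init_weight_le: "\<forall>\<^sub>F k in sequentially. \<forall>i\<in>{..<n}. init_weight i \<le> max_weight (real k)"
proof (intro eventually_ball_finite ballI)
  fix i assume "i \<in> {..<n}"
  then have "0 < 1 - \<delta> - init_weight i" using init_weight_range by auto
  then have "\<forall>\<^sub>F k in sequentially. 1 / real k < 1 - \<delta> - init_weight i"
    by (rule order_tendstoD(2)[OF lim_const_over_n])
  then show "\<forall>\<^sub>F k in sequentially. init_weight i \<le> max_weight (real k)"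
    by eventually_elim (simp add: max_weight_def)
qed simp

lemma weight_continuous:
  assumes \<omega>: "regular \<omega>" and X: "\<And>s j. s \<in> {0..T} \<Longrightarrow> j < n \<Longrightarrow> 0 < X j s \<omega>" and j: "j < n"
  shows "continuous_on {0..T} (\<lambda>s. \<mu> j s \<omega>)"
proof -
  have "continuous_on {0..T} (\<lambda>s. X j s \<omega>)" if "j < n" for j
    by (rule continuous_on_subset[OF regular_X(1)[OF \<omega> that]]) auto
  moreover have "(\<Sum>l<n. X l s \<omega>) \<noteq> 0" if "s \<in> {0..T}" for s
    using total_cap_pos[of s \<omega>] X[OF that] unfolding total_cap_def by force
  ultimately show ?thesis unfolding mkt_weight_def total_cap_def using j by (intro continuous_intros) auto
qed

lemma eventually_in_region:
  assumes \<omega>: "regular \<omega>" and T: "0 \<le> T" and X: "\<And>s j. s \<in> {0..T} \<Longrightarrow> j < n \<Longrightarrow> 0 < X j s \<omega>"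
  shows "\<forall>\<^sub>F k in sequentially. \<forall>j\<in>{..<n}. \<forall>s\<in>{0..T}. 1 / real k \<le> X j s \<omega> \<and> X j s \<omega> \<le> real k"
proof (rule eventually_ball_finite[OF finite_lessThan], rule ballI)
  fix j assume "j \<in> {..<n}"
  then have j: "j < n" by simp
  have c: "continuous_on {0..T} (\<lambda>s. X j s \<omega>)"
    by (rule continuous_on_subset[OF regular_X(1)[OF \<omega> j]]) auto
  show "\<forall>\<^sub>F k in sequentially. \<forall>s\<in>{0..T}. 1 / real k \<le> X j s \<omega> \<and> X j s \<omega> \<le> real k"
  proof -
    have "\<forall>\<^sub>F k in sequentially. \<forall>s\<in>{0..T}. 1 / real k \<le> X j s \<omega>"
      by (rule eventually_lower_bound_compact[OF c T]) (use X j in auto)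
    with eventually_upper_bound_compact[OF c T] show ?thesis by eventually_elim auto
  qed
qed

text \<open>Interface to the Euler scheme for a function that is smooth only below
  \<open>1 - \<delta>\<close>. For fixed \<open>K\<close> it is extended beyond
  \<open>max_weight K\<close>; the conclusion speaks of \<open>f\<close> alone because the stopped
  weight never exceeds that level.\<close>

lemma dynkin_C2_on:
  assumes C2: "C2_on f f1 f2" and drift: "drift_ge c i f1 f2"
    and i: "i < n" and K: "4 \<le> K" "init_weight i \<le> max_weight K" and T: "0 < T"
  obtains V :: "nat \<Rightarrow> 'a \<Rightarrow> real" where "\<And>N. V N \<in> borel_measurable M"
    "\<And>e. 0 < e \<Longrightarrow> \<forall>\<^sub>F N in sequentially. integrable M (V N) \<and>
       f (init_weight i) + c * (T / real N * (\<Sum>k<N. prob (alive K (real k * (T / real N))))) - e \<le> expectation (V N)"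
    "\<And>N \<omega>. regular \<omega> \<Longrightarrow> \<omega> \<in> space M \<Longrightarrow> \<exists>m\<le>N. V N \<omega> = f (\<mu> i (real m * (T / real N)) \<omega>) \<and>
       \<mu> i (real m * (T / real N)) \<omega> \<le> max_weight K \<and>
       (m = 0 \<or> \<omega> \<in> alive K (real m * (T / real N))) \<and> (m < N \<longrightarrow> \<omega> \<notin> alive K (real (Suc m) * (T / real N)))"
proof -
  obtain F F1 F2 where F: "\<And>x. (F has_real_derivative F1 x) (at x)"
    "\<And>x. (F1 has_real_derivative F2 x) (at x)" "continuous_on UNIV F2"
    "\<And>x. x \<le> max_weight K \<Longrightarrow> F x = f x" "\<And>x. x \<le> max_weight K \<Longrightarrow> F1 x = f1 x" "\<And>x. x \<le> max_weight K \<Longrightarrow> F2 x = f2 x"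
    using C2_extension[OF min_max_weight(3)[OF K(1)], of f f1 f2] C2 by (auto simp: C2_on_def)
  interpret MF: market_test_function M n W \<delta> g x0 X K F F1 F2 i c
  proof (unfold_locales)
    fix p assume p: "weights n p" "\<And>j. j < n \<Longrightarrow> min_weight K \<le> p j \<and> p j \<le> max_weight K"
    have "c \<le> (\<Sum>j<n. grad f1 i p j * - g (p j)) + (\<Sum>j<n. hess f1 f2 i p j j)"
      using p_range[OF K(1)] p drift by (auto simp: drift_ge_def)
    also have "\<dots> = (\<Sum>j<n. grad F1 i p j * - g (p j)) + (\<Sum>j<n. hess F1 F2 i p j j)"
      using F(5,6)[of "p i"] p(2)[OF i] by (simp add: grad_def hess_def)
    finally show "c \<le> (\<Sum>j<n. grad F1 i p j * - g (p j)) + (\<Sum>j<n. hess F1 F2 i p j j)" .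
  qed (use K i F in auto)
  show thesis
  proof (rule that[of "MF.stopped T"])
    show "MF.stopped T N \<in> borel_measurable M" for N by (rule MF.stopped_measurable[OF T])
    show "\<forall>\<^sub>F N in sequentially. integrable M (MF.stopped T N) \<and>
       f (init_weight i) + c * (T / real N * (\<Sum>k<N. prob (alive K (real k * (T / real N))))) - e \<le> expectation (MF.stopped T N)"
      if "0 < e" for e
      using MF.dynkin_lower[OF T that] F(4)[OF K(2)] by (simp add: MF.grid_def)
    fix N \<omega> assume \<omega>: "regular \<omega>" "\<omega> \<in> space M"
    obtain m where m: "m \<le> N" "MF.stopped T N \<omega> = F (\<mu> i (MF.grid T N m) \<omega>)" "m = 0 \<or> \<omega> \<in> alive K (MF.grid T N m)"
      "m < N \<Longrightarrow> \<omega> \<notin> alive K (MF.grid T N (Suc m))" by (rule MF.stopped_value[OF \<omega> T, of N]) blast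
    have "\<mu> i (MF.grid T N m) \<omega> \<le> max_weight K"
    proof (cases "m = 0")
      case True then show ?thesis using regular_weight_0[OF \<omega>(1) i] K(2) by (simp add: MF.grid_def)
    next
      case False then show ?thesis using m(3) alive_weights(2)[OF _ _ i] K(1) by auto
    qed
    then show "\<exists>m\<le>N. MF.stopped T N \<omega> = f (\<mu> i (real m * (T / real N)) \<omega>) \<and>
       \<mu> i (real m * (T / real N)) \<omega> \<le> max_weight K \<and>
       (m = 0 \<or> \<omega> \<in> alive K (real m * (T / real N))) \<and> (m < N \<longrightarrow> \<omega> \<notin> alive K (real (Suc m) * (T / real N)))"
      using m F(4) by (intro exI[of _ m]) (simp add: MF.grid_def)
  qed
qed

text \<open>On a diverse path the capitalizations, and the distances of the weights from
  \<open>1 - \<delta>\<close>, are continuous and positive on the compact interval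
  \<open>{0..T}\<close>, so the path lies in all sufficiently large regions.\<close>

lemma alive_prob_tendsto:
  assumes div: "delta_diverse M n \<delta> X" and T: "0 < T"
  shows "(\<lambda>k. prob (alive (real k) T)) \<longlonglongrightarrow> 1"
proof -
  have "AE \<omega> in M. \<forall>t\<ge>0. \<forall>i<n. 0 < X i t \<omega> \<and> \<mu> i t \<omega> < 1 - \<delta>" using div by (simp add: delta_diverse_def)
  with AE_regular AE_space have ae: "AE \<omega> in M. \<forall>\<^sub>F k in sequentially. \<omega> \<in> alive (real k) T"
  proof eventually_elim
    case (elim \<omega>)
    have X: "0 < X j s \<omega>" if "s \<in> {0..T}" "j < n" for s j using elim(3) that by auto
    have "\<forall>\<^sub>F k in sequentially. \<forall>j\<in>{..<n}. \<forall>s\<in>{0..T}. 1 / real k \<le> 1 - \<delta> - \<mu> j s \<omega>"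
    proof (rule eventually_ball_finite[OF finite_lessThan], rule ballI)
      fix j assume j: "j \<in> {..<n}"
      show "\<forall>\<^sub>F k in sequentially. \<forall>s\<in>{0..T}. 1 / real k \<le> 1 - \<delta> - \<mu> j s \<omega>"
        by (rule eventually_lower_bound_compact)
          (use j elim(3) T in \<open>auto intro!: continuous_intros weight_continuous[OF elim(1) X]\<close>)
    qed
    moreover have "\<forall>\<^sub>F k in sequentially. \<forall>j\<in>{..<n}. \<forall>s\<in>{0..T}. 1 / real k \<le> X j s \<omega> \<and> X j s \<omega> \<le> real k"
      by (rule eventually_in_region[OF elim(1)]) (use X T in auto)
    ultimately show ?case
    proof eventually_elim
      case (elim k)
      have "in_region (real k) (\<lambda>j. X j s \<omega>)" if s: "s \<in> {0..T}" for s
        unfolding in_region_def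
      proof (intro allI impI conjI)
        fix j assume j: "j < n"
        show "1 / real k \<le> X j s \<omega>" "X j s \<omega> \<le> real k" using elim(2) s j by auto
        have "1 / real k \<le> 1 - \<delta> - \<mu> j s \<omega>" using elim(1) s j by simp
        then have "\<mu> j s \<omega> \<le> 1 - \<delta> - 1 / real k" by linarith
        then show "X j s \<omega> \<le> (1 - \<delta> - 1 / real k) * (\<Sum>l<n. X l s \<omega>)"
          using total_cap_pos[of s \<omega>] X[OF s] by (simp add: mkt_weight_def total_cap_def pos_divide_le_eq)
      qed
      then show ?case using alive_iff[OF \<open>regular \<omega>\<close> \<open>\<omega> \<in> space M\<close>] T by simp
    qed
  qed
  have "(\<lambda>k. expectation (\<lambda>\<omega>. indicator (alive (real k) T) \<omega> :: real)) \<longlonglongrightarrow> expectation (\<lambda>\<omega>. 1)"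
  proof (rule integral_dominated_convergence[where w="\<lambda>_. 1"])
    show "AE \<omega> in M. (\<lambda>k. indicator (alive (real k) T) \<omega> :: real) \<longlonglongrightarrow> 1"
      using ae by eventually_elim (auto intro!: tendsto_eventually elim: eventually_mono)
  qed (use T in auto)
  then show ?thesis using T by (simp add: prob_space)
qed

text \<open>A bounded function cannot gain at rate \<open>c\<close> for ever. Finiteness of the
  integral bounds \<open>f\<close> from above, while diversity would let the path survive up to any
  \<open>T\<close> with probability near 1. A single asset, with index 0, yields the
  contradiction.\<close>

lemma not_diverse:
  assumes y: "0 < y" "y < 1 - \<delta>"
    and fin: "(\<integral>\<^sup>+ x \<in> {y<..<1 - \<delta>}. ennreal (exp (integral {y..x} (\<lambda>z. A1 n z * g z))) \<partial>lborel) < \<infinity>"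
  shows "\<not> delta_diverse M n \<delta> X"
proof
  assume div: "delta_diverse M n \<delta> X"
  let ?b = "1 - \<delta>"
  obtain f' f1 f2 c D where c: "0 < c" and C2': "C2_on f' f1 f2" and drift: "\<forall>i<n. drift_ge c i f1 f2"
    and f10: "\<forall>x. 0 \<le> f1 x"
    and D: "\<forall>x. y \<le> x \<longrightarrow> x < ?b \<longrightarrow> f1 x \<le> exp D * exp (integral {y..x} (\<lambda>z. A1 n z * g z))"
    using lower_function[OF y] by blast
  \<comment> \<open>Normalized to vanish at \<open>y\<close>, so that the hypothesis bounds
    \<open>f\<close> directly by \<open>L\<close>.\<close>
  define f where "f x = f' x - f' y" for x
  have f: "(f has_real_derivative f1 x) (at x)" if "x < ?b" for x
    using C2' that unfolding f_def C2_on_def by (auto intro!: derivative_eq_intros)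
  have C2: "C2_on f f1 f2" using C2' f by (simp add: C2_on_def)
  have f1c: "continuous_on {..<?b} f1"
    using C2 unfolding C2_on_def by (intro continuous_at_imp_continuous_on ballI) (blast intro: DERIV_isCont)
  let ?I = "\<integral>\<^sup>+ x \<in> {y<..<?b}. ennreal (exp (integral {y..x} (\<lambda>z. A1 n z * g z))) \<partial>lborel"
  have mono: "f x \<le> f z" if "x \<le> z" "z < ?b" for x z
  proof (rule DERIV_nonneg_imp_nondecreasing[where f=f, OF that(1)])
    fix w assume "x \<le> w" "w \<le> z"
    then show "\<exists>d. (f has_real_derivative d) (at w) \<and> 0 \<le> d" using f[of w] f10 that by auto
  qed
  define L where "L = exp D * enn2real ?I"
  have L: "f x \<le> L" if x: "x < ?b" for x
  proof (cases "x \<le> y")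
    case True
    then have "f x \<le> 0" using mono[OF True y(2)] by (simp add: f_def)
    also have "0 \<le> L" by (simp add: L_def)
    finally show ?thesis .
  next
    case False
    then have yx: "y \<le> x" by simp
    have "ennreal (f x) = (\<integral>\<^sup>+ z \<in> {y..x}. ennreal (f1 z) \<partial>lborel)"
      using nn_integral_derivative_Icc[OF f f1c _ yx x] f10 by (simp add: f_def)
    also have "\<dots> = (\<integral>\<^sup>+ z \<in> {y<..x}. ennreal (f1 z) \<partial>lborel)"
    proof (rule nn_integral_cong_AE)
      show "AE z in lborel. ennreal (f1 z) * indicator {y..x} z = ennreal (f1 z) * indicator {y<..x} z"
        using AE_lborel_singleton[of y] by eventually_elim (auto simp: indicator_def)
    qed
    also have "\<dots> \<le> (\<integral>\<^sup>+ z. ennreal (exp D) * (ennreal (exp (integral {y..z} (\<lambda>z. A1 n z * g z))) * indicator {y<..<?b} z) \<partial>lborel)"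
    proof (rule nn_integral_mono)
      fix z
      show "ennreal (f1 z) * indicator {y<..x} z \<le> ennreal (exp D) * (ennreal (exp (integral {y..z} (\<lambda>z. A1 n z * g z))) * indicator {y<..<?b} z)"
      proof (cases "z \<in> {y<..x}")
        case True
        then have "f1 z \<le> exp D * exp (integral {y..z} (\<lambda>z. A1 n z * g z))"
          using D x by auto
        then have "ennreal (f1 z) \<le> ennreal (exp D * exp (integral {y..z} (\<lambda>z. A1 n z * g z)))" by (rule ennreal_leI)
        also have "\<dots> = ennreal (exp D) * ennreal (exp (integral {y..z} (\<lambda>z. A1 n z * g z)))" by (rule ennreal_mult) auto
        finally show ?thesis using True x by simp
      qed simp
    qed
    also have "\<dots> = ennreal (exp D) * ?I"
    proof (rule nn_integral_cmult)
      show "(\<lambda>x. ennreal (exp (integral {y..x} (\<lambda>z. A1 n z * g z))) * indicator {y<..<?b} x) \<in> borel_measurable lborel"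
      proof (rule measurable_exp_integral[OF _ y])
        show "continuous_on {0<..<?b} (\<lambda>z. A1 n z * g z)"
          unfolding A1_def using delta by (intro continuous_intros g_continuous) auto
      qed
    qed
    also have "\<dots> = ennreal (exp D) * ennreal (enn2real ?I)" using fin by (subst ennreal_enn2real) auto
    also have "\<dots> = ennreal L" unfolding L_def by (rule ennreal_mult[symmetric]) auto
    finally show ?thesis by (simp add: L_def)
  qed
  have i: "0 < n" using n2 by simp
  have bound: "f (init_weight 0) + c * (T * prob (alive K T)) \<le> L" if K: "4 \<le> K" "init_weight 0 \<le> max_weight K" and T: "0 < T" for K T
  proof (rule field_le_epsilon)
    fix e :: real assume e: "0 < e"
    obtain V where V: "\<And>N. V N \<in> borel_measurable M"
      "\<And>e. 0 < e \<Longrightarrow> \<forall>\<^sub>F N in sequentially. integrable M (V N) \<and>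
       f (init_weight 0) + c * (T / real N * (\<Sum>k<N. prob (alive K (real k * (T / real N))))) - e \<le> expectation (V N)"
      "\<And>N \<omega>. regular \<omega> \<Longrightarrow> \<omega> \<in> space M \<Longrightarrow> \<exists>m\<le>N. V N \<omega> = f (\<mu> 0 (real m * (T / real N)) \<omega>) \<and>
       \<mu> 0 (real m * (T / real N)) \<omega> \<le> max_weight K \<and>
       (m = 0 \<or> \<omega> \<in> alive K (real m * (T / real N))) \<and> (m < N \<longrightarrow> \<omega> \<notin> alive K (real (Suc m) * (T / real N)))"
      using dynkin_C2_on[OF C2 drift[rule_format, OF i] i K T] by blast
    obtain N where N: "0 < N" "integrable M (V N)"
       "f (init_weight 0) + c * (T / real N * (\<Sum>k<N. prob (alive K (real k * (T / real N))))) - e \<le> expectation (V N)"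
      using eventually_happens'[OF _ eventually_conj[OF V(2)[OF e] eventually_gt_at_top[of 0]]] by auto
    have "AE \<omega> in M. V N \<omega> \<le> L" using AE_regular AE_space
    proof eventually_elim
      case (elim \<omega>)
      then show ?case using V(3)[of \<omega> N] L min_max_weight(3)[OF K(1)] by force
    qed
    then have "expectation (V N) \<le> expectation (\<lambda>_. L)" using N(2) by (intro integral_mono_AE) auto
    then have "expectation (V N) \<le> L" by (simp add: prob_space)
    \<comment> \<open>Survival becomes less likely with time, so every probability in the Riemann
      sum is at least the one at \<open>T\<close>.\<close>
    moreover have "T * prob (alive K T) \<le> T / real N * (\<Sum>k<N. prob (alive K (real k * (T / real N))))"
    proof -
      have "prob (alive K T) \<le> prob (alive K (real k * (T / real N)))" if "k < N" for k
      proof (rule finite_measure_mono_AE)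
        have "real k * T \<le> real N * T" using that T by (intro mult_right_mono) auto
        then have kT: "0 \<le> real k * (T / real N)" "real k * (T / real N) \<le> T"
          using T N(1) by (auto simp: field_simps)
        show "AE \<omega> in M. \<omega> \<in> alive K T \<longrightarrow> \<omega> \<in> alive K (real k * (T / real N))"
          using AE_regular by eventually_elim (use alive_antimono kT in blast)
        show "alive K (real k * (T / real N)) \<in> events" using kT by (intro alive_measurable)
      qed
      then have "(\<Sum>k<N. prob (alive K T)) \<le> (\<Sum>k<N. prob (alive K (real k * (T / real N))))" by (intro sum_mono) auto
      then have "T / real N * (real N * prob (alive K T)) \<le> T / real N * (\<Sum>k<N. prob (alive K (real k * (T / real N))))"
        using T by (intro mult_left_mono) auto
      then show ?thesis using N(1) by simp
    qed
    then have "c * (T * prob (alive K T)) \<le> c * (T / real N * (\<Sum>k<N. prob (alive K (real k * (T / real N)))))"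
      using c by (intro mult_left_mono) auto
    ultimately show "f (init_weight 0) + c * (T * prob (alive K T)) \<le> L + e" using N(3) by linarith
  qed
  \<comment> \<open>Already at survival probability \<open>1 / 2\<close> the gain
    \<open>c * T / 2\<close> exceeds the room between the initial value and
    \<open>L\<close>.\<close>
  define T where "T = 2 * (\<bar>L - f (init_weight 0)\<bar> + 1) / c"
  have T: "0 < T" using c unfolding T_def by (intro divide_pos_pos mult_pos_pos add_nonneg_pos) auto
  have "\<forall>\<^sub>F k in sequentially. 1 / 2 < prob (alive (real k) T)"
    using alive_prob_tendsto[OF div T] by (rule order_tendstoD) simp
  moreover have "\<forall>\<^sub>F k in sequentially. 4 \<le> real k" using filterlim_real_sequentially by (auto simp: filterlim_at_top)
  ultimately have "\<forall>\<^sub>F k in sequentially. 1 / 2 < prob (alive (real k) T) \<and> 4 \<le> real k \<and> init_weight 0 \<le> max_weight (real k)"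
    using eventually_init_weight_le by eventually_elim (use i in auto)
  then obtain k :: nat where k: "1 / 2 < prob (alive (real k) T)" "4 \<le> real k" "init_weight 0 \<le> max_weight (real k)"
    using eventually_happens'[OF sequentially_bot] by blast
  have "c * (T * (1 / 2)) < c * (T * prob (alive (real k) T))"
    using k(1) T c by (intro mult_strict_left_mono) auto
  also have "\<dots> \<le> L - f (init_weight 0)" using bound[OF k(2,3) T] by simp
  finally have "\<bar>L - f (init_weight 0)\<bar> + 1 < L - f (init_weight 0)" using c by (simp add: T_def)
  then show False by simp
qed

end

section \<open>Diversity\<close>

context market_limits
begin

text \<open>If \<open>f\<close> stayed bounded, \<open>f1\<close> would be integrable up to
  \<open>1 - \<delta>\<close>. Beyond \<open>m\<close> the exponential is at most \<open>D\<close>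
  times \<open>f1\<close>, and before \<open>m\<close> it is bounded by compactness, so its integral
  would be finite.\<close>

lemma upper_function_unbounded:
  assumes y: "0 < y" "y < 1 - \<delta>"
    and inf: "(\<integral>\<^sup>+ x \<in> {y<..<1 - \<delta>}. ennreal (exp (integral {y..x} (\<lambda>z. A2 z * g z))) \<partial>lborel) = \<infinity>"
    and C2: "C2_on f f1 f2" and f1: "\<forall>x. 0 \<le> f1 x" and m: "y \<le> m" "m < 1 - \<delta>" "0 \<le> D"
    and D: "\<forall>x. m \<le> x \<longrightarrow> x < 1 - \<delta> \<longrightarrow> exp (integral {y..x} (\<lambda>z. A2 z * g z)) \<le> D * f1 x"
  shows "\<exists>x. m \<le> x \<and> x < 1 - \<delta> \<and> L < f x"
proof (rule ccontr)
  assume "\<not> ?thesis"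
  then have L: "\<And>x. m \<le> x \<Longrightarrow> x < 1 - \<delta> \<Longrightarrow> f x \<le> L" by force
  let ?b = "1 - \<delta>" and ?h = "\<lambda>x. exp (integral {y..x} (\<lambda>z. A2 z * g z))"
  have f: "\<And>x. x < ?b \<Longrightarrow> (f has_real_derivative f1 x) (at x)" using C2 by (simp add: C2_on_def)
  have f1c: "continuous_on {..<?b} f1"
    using C2 unfolding C2_on_def by (intro continuous_at_imp_continuous_on ballI) (blast intro: DERIV_isCont)
  have fin: "(\<integral>\<^sup>+ x \<in> {m..<?b}. ennreal (f1 x) \<partial>lborel) < \<infinity>"
    using nn_integral_le_bound[OF f f1c _ m(2) L] f1 by (auto intro: le_less_trans)
  have A2c: "continuous_on {0<..<?b} (\<lambda>z. A2 z * g z)"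
    unfolding A2_def using delta by (intro continuous_intros g_continuous) auto
  have "continuous_on {y..m} (\<lambda>x. integral {y..x} (\<lambda>z. A2 z * g z))"
    by (intro indefinite_integral_continuous_1 integrable_continuous_interval continuous_on_subset[OF A2c]) (use y m in auto)
  then have "continuous_on {y..m} ?h" by (intro continuous_intros)
  then have "bounded (?h ` {y..m})" by (intro compact_imp_bounded compact_continuous_image) auto
  then obtain C where C: "\<forall>x\<in>{y..m}. \<bar>?h x\<bar> \<le> C" by (auto simp: bounded_iff)
  have "y \<in> {y..m}" using m(1) by simp
  with C have "\<bar>?h y\<bar> \<le> C" by (rule bspec)
  then have C0: "0 \<le> C" using abs_ge_zero[of "?h y"] by linarith
  have m1: "(\<lambda>x. ennreal C * indicator {y..m} x) \<in> borel_measurable lborel" by measurable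
  have "(\<lambda>x. indicator {..<?b} x *\<^sub>R f1 x) \<in> borel_measurable borel"
    using f1c by (intro borel_measurable_continuous_on_indicator) auto
  then have "(\<lambda>x. ennreal (indicator {..<?b} x *\<^sub>R f1 x) * indicator {m..} x) \<in> borel_measurable lborel" by measurable
  then have m2: "(\<lambda>x. ennreal (f1 x) * indicator {m..<?b} x) \<in> borel_measurable lborel"
    by (rule measurable_cong[THEN iffD1, rotated]) (auto simp: indicator_def)
  have "(\<integral>\<^sup>+ x \<in> {y<..<?b}. ennreal (?h x) \<partial>lborel)
     \<le> (\<integral>\<^sup>+ x. ennreal C * indicator {y..m} x + ennreal D * (ennreal (f1 x) * indicator {m..<?b} x) \<partial>lborel)"
  proof (rule nn_integral_mono)
    fix x
    consider "x \<in> {y<..<?b}" "x < m" | "x \<in> {y<..<?b}" "m \<le> x" | "x \<notin> {y<..<?b}" by fastforce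
    then show "ennreal (?h x) * indicator {y<..<?b} x \<le> ennreal C * indicator {y..m} x + ennreal D * (ennreal (f1 x) * indicator {m..<?b} x)"
    proof cases
      case 1
      then have "?h x \<le> C" using C by auto
      then have "ennreal (?h x) \<le> ennreal C" by (rule ennreal_leI)
      then show ?thesis using 1 by (simp add: add_increasing2)
    next
      case 2
      then have "ennreal (?h x) \<le> ennreal (D * f1 x)" using D by (intro ennreal_leI) auto
      also have "\<dots> = ennreal D * ennreal (f1 x)" using m(3) f1 by (intro ennreal_mult) auto
      finally show ?thesis using 2 by (simp add: add_increasing)
    qed simp
  qed
  also have "\<dots> = ennreal C * emeasure lborel {y..m} + ennreal D * (\<integral>\<^sup>+ x \<in> {m..<?b}. ennreal (f1 x) \<partial>lborel)"
    using m1 m2 by (simp add: nn_integral_add nn_integral_cmult nn_integral_cmult_indicator)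
  also have "\<dots> < \<infinity>"
    using fin m(1) by (simp add: ennreal_mult_less_top less_top ennreal_mult[symmetric] C0)
  finally show False using inf by simp
qed

text \<open>As the grid is refined, its last alive points converge to the exit time of the region, where some
  weight equals \<open>max_weight K\<close>.\<close>
lemma exit_value:
  assumes \<omega>: "regular \<omega>" "\<omega> \<in> space M" and \<zeta>: "0 < \<zeta>" "\<zeta> \<le> T"
    and X: "\<And>s j. s \<in> {0..\<zeta>} \<Longrightarrow> j < n \<Longrightarrow> 0 < X j s \<omega>"
    and good: "\<And>s j. 0 \<le> s \<Longrightarrow> s < \<zeta> \<Longrightarrow> j < n \<Longrightarrow> \<mu> j s \<omega> < 1 - \<delta>"
    and bad: "i0 < n" "1 - \<delta> \<le> \<mu> i0 \<zeta> \<omega>"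
    and K: "4 \<le> K" "\<And>j. j < n \<Longrightarrow> init_weight j \<le> max_weight K"
      "\<And>s j. s \<in> {0..\<zeta>} \<Longrightarrow> j < n \<Longrightarrow> 1 / K \<le> X j s \<omega> \<and> X j s \<omega> \<le> K"
    and fc: "continuous_on {..<1 - \<delta>} f" and fm: "\<And>x z. x \<le> z \<Longrightarrow> z < 1 - \<delta> \<Longrightarrow> f x \<le> (f z :: real)"
    and V: "\<And>i N. i < n \<Longrightarrow> \<exists>m\<le>N. V i N = f (\<mu> i (real m * (T / real N)) \<omega>) \<and>
       (m = 0 \<or> \<omega> \<in> alive K (real m * (T / real N))) \<and> (m < N \<longrightarrow> \<omega> \<notin> alive K (real (Suc m) * (T / real N)))"
  obtains j where "j < n" "\<forall>\<^sub>F N in sequentially. f (max_weight K) - 1 \<le> V j N"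
proof -
  have T: "0 < T" using \<zeta> by simp
  have \<mu>c: "continuous_on {0..\<zeta>} (\<lambda>s. \<mu> j s \<omega>)" if "j < n" for j
    by (rule weight_continuous[OF \<omega>(1) X that])
  have okI: "in_region K (\<lambda>j. X j s \<omega>) \<longleftrightarrow> (\<forall>j<n. \<mu> j s \<omega> \<le> max_weight K)" if s: "s \<in> {0..\<zeta>}" for s
    using K(3)[OF s] total_cap_pos[of s \<omega>, OF X[OF s]]
    by (auto simp: in_region_def mkt_weight_def total_cap_def max_weight_def pos_divide_le_eq)
  \<comment> \<open>By the choice of \<open>K\<close> the bounds on capitalizations hold up to
    \<open>\<zeta>\<close>, so the weights alone decide the exit. \<open>R\<close> contains with
    each time all earlier ones and ends at the exit time \<open>\<tau>\<close>.\<close>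
  define R where "R = {t \<in> {0..\<zeta>}. \<forall>s\<in>{0..t}. \<forall>j<n. \<mu> j s \<omega> \<le> max_weight K}"
  have alive: "\<omega> \<in> alive K t \<longleftrightarrow> t \<in> R" if t: "t \<in> {0..\<zeta>}" for t
    using alive_iff[OF \<omega>, of t K] okI t by (auto simp: R_def)
  have R0: "0 \<in> R" using \<zeta>(1) K(2) regular_weight_0[OF \<omega>(1)] by (auto simp: R_def)
  have Rbdd: "bdd_above R" by (rule bdd_aboveI[of _ \<zeta>]) (auto simp: R_def)
  define \<tau> where "\<tau> = Sup R"
  have \<tau>0: "0 \<le> \<tau>" unfolding \<tau>_def by (rule cSup_upper[OF R0 Rbdd])
  have \<tau>\<zeta>: "\<tau> \<le> \<zeta>" unfolding \<tau>_def using R0 by (intro cSup_least) (auto simp: R_def)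
  have below: "\<mu> j s \<omega> \<le> max_weight K" if s: "0 \<le> s" "s < \<tau>" "j < n" for s j
  proof -
    obtain t where "t \<in> R" "s < t" using s(2) less_cSup_iff[OF _ Rbdd] R0 unfolding \<tau>_def by blast
    then show ?thesis using s by (auto simp: R_def)
  qed
  have at\<tau>: "\<mu> j \<tau> \<omega> \<le> max_weight K" if j: "j < n" for j
  proof (cases "\<tau> = 0")
    case True then show ?thesis using K(2)[OF j] regular_weight_0[OF \<omega>(1) j] by simp
  next
    case False
    then have p: "0 < \<tau>" using \<tau>0 by simp
    show ?thesis
    proof (rule tendsto_upperbound)
      show "((\<lambda>s. \<mu> j s \<omega>) \<longlongrightarrow> \<mu> j \<tau> \<omega>) (at \<tau> within {0..\<tau>})"
        using continuous_on_subset[OF \<mu>c[OF j], of "{0..\<tau>}"] \<tau>\<zeta> p by (auto simp: continuous_on_def)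
      show "\<forall>\<^sub>F s in at \<tau> within {0..\<tau>}. \<mu> j s \<omega> \<le> max_weight K"
        unfolding eventually_at_filter using below j by (auto intro!: always_eventually)
      show "at \<tau> within {0..\<tau>} \<noteq> bot" using p by (simp add: at_within_Icc_at_left trivial_limit_at_left_real)
    qed
  qed
  have xKb: "max_weight K < 1 - \<delta>" by (rule min_max_weight(3)[OF K(1)])
  have \<tau>R: "\<tau> \<in> R"
  proof -
    have "\<mu> j s \<omega> \<le> max_weight K" if "0 \<le> s" "s \<le> \<tau>" "j < n" for s j
      using below[of s j] at\<tau>[of j] that by (cases "s = \<tau>") auto
    then show ?thesis using \<tau>0 \<tau>\<zeta> by (auto simp: R_def)
  qed
  have \<tau>lt: "\<tau> < \<zeta>" using \<tau>\<zeta> at\<tau>[OF bad(1)] bad(2) xKb by (cases "\<tau> = \<zeta>") auto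
  \<comment> \<open>If all weights were strictly below the level at \<open>\<tau>\<close>,
    continuity would extend \<open>R\<close> beyond its supremum.\<close>
  have "\<exists>j<n. max_weight K \<le> \<mu> j \<tau> \<omega>"
  proof (rule ccontr)
    assume "\<not> ?thesis"
    then have lt: "\<And>j. j < n \<Longrightarrow> \<mu> j \<tau> \<omega> < max_weight K" by force
    have "\<forall>\<^sub>F s in at_right \<tau>. \<forall>j\<in>{..<n}. \<mu> j s \<omega> < max_weight K"
    proof (rule eventually_ball_finite[OF finite_lessThan], rule ballI)
      fix j assume j: "j \<in> {..<n}"
      have "((\<lambda>s. \<mu> j s \<omega>) \<longlongrightarrow> \<mu> j \<tau> \<omega>) (at \<tau> within {\<tau>..\<zeta>})"
        using continuous_on_subset[OF \<mu>c[of j], of "{\<tau>..\<zeta>}"] \<tau>0 \<tau>lt j by (auto simp: continuous_on_def)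
      then have "((\<lambda>s. \<mu> j s \<omega>) \<longlongrightarrow> \<mu> j \<tau> \<omega>) (at_right \<tau>)" using \<tau>lt by (simp add: at_within_Icc_at_right)
      then show "\<forall>\<^sub>F s in at_right \<tau>. \<mu> j s \<omega> < max_weight K" using lt j by (auto intro: order_tendstoD)
    qed
    then obtain d where d: "\<tau> < d" "\<And>s j. \<tau> < s \<Longrightarrow> s < d \<Longrightarrow> j < n \<Longrightarrow> \<mu> j s \<omega> < max_weight K"
      unfolding eventually_at_right_field by auto
    define t where "t = (\<tau> + min d \<zeta>) / 2"
    have t: "\<tau> < t" "t < d" "t < \<zeta>" using d(1) \<tau>lt by (auto simp: t_def min_def field_simps)
    have "\<mu> j s \<omega> \<le> max_weight K" if "0 \<le> s" "s \<le> t" "j < n" for s j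
      using \<tau>R d(2)[of s j] that t by (cases "s \<le> \<tau>") (auto simp: R_def)
    then have "t \<in> R" using t \<tau>0 by (auto simp: R_def)
    then have "t \<le> \<tau>" unfolding \<tau>_def by (rule cSup_upper[OF _ Rbdd])
    then show False using t by simp
  qed
  then obtain j where j: "j < n" "max_weight K \<le> \<mu> j \<tau> \<omega>" by blast
  have fc\<mu>: "continuous_on {0..<\<zeta>} (\<lambda>s. f (\<mu> j s \<omega>))"
    by (rule continuous_on_compose2[OF fc continuous_on_subset[OF \<mu>c[OF j(1)]]]) (use good j in auto)
  have "f (max_weight K) \<le> f (\<mu> j \<tau> \<omega>)" using fm[OF j(2)] good[OF \<tau>0 \<tau>lt j(1)] by simp
  moreover obtain d where d: "0 < d" "\<And>s. s \<in> {0..<\<zeta>} \<Longrightarrow> \<bar>s - \<tau>\<bar> < d \<Longrightarrow> \<bar>f (\<mu> j s \<omega>) - f (\<mu> j \<tau> \<omega>)\<bar> < 1"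
    using fc\<mu>[unfolded continuous_on_iff, rule_format, of \<tau> 1] \<tau>0 \<tau>lt by (auto simp: dist_real_def)
  moreover have "\<forall>\<^sub>F N in sequentially. T / real N < d"
    using d(1) by (rule order_tendstoD(2)[OF lim_const_over_n])
  then have "\<forall>\<^sub>F N in sequentially. \<bar>V j N - f (\<mu> j \<tau> \<omega>)\<bar> < 1"
    using eventually_gt_at_top[of 0]
  proof eventually_elim
    case (elim N)
    obtain m where m: "m \<le> N" "V j N = f (\<mu> j (real m * (T / real N)) \<omega>)"
      "m = 0 \<or> \<omega> \<in> alive K (real m * (T / real N))" "m < N \<longrightarrow> \<omega> \<notin> alive K (real (Suc m) * (T / real N))"
      using V[OF j(1)] by blast
    let ?s = "real m * (T / real N)"
    have s0: "0 \<le> ?s" using T by simp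
    have step: "real (Suc m) * (T / real N) = ?s + T / real N" by (simp add: add_divide_distrib distrib_right)
    \<comment> \<open>Grid time \<open>m\<close> is alive or 0 and the next one is not alive, so
      \<open>\<tau>\<close> lies between them, within one mesh width; \<open>m = N\<close> is
      impossible because \<open>T\<close> lies beyond the exit.\<close>
    have s\<tau>: "?s \<le> \<tau>"
    proof (cases "m = 0")
      case False
      then have al: "\<omega> \<in> alive K ?s" using m(3) by blast
      show ?thesis
      proof (cases "?s \<le> \<zeta>")
        case True
        then have "?s \<in> R" using alive s0 al by auto
        then show ?thesis unfolding \<tau>_def by (rule cSup_upper[OF _ Rbdd])
      next
        case False
        then have "\<omega> \<in> alive K \<zeta>" using alive_antimono[OF \<omega>(1) al] \<zeta> by auto
        then have "\<zeta> \<in> R" using alive \<zeta> by auto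
        then have "\<zeta> \<le> \<tau>" unfolding \<tau>_def by (rule cSup_upper[OF _ Rbdd])
        then show ?thesis using \<tau>lt by simp
      qed
    qed (use \<tau>0 in simp)
    have "m \<noteq> N"
    proof
      assume "m = N"
      then have "?s = T" using elim(2) by simp
      then show False using s\<tau> \<tau>lt \<zeta> by simp
    qed
    then have na: "\<omega> \<notin> alive K (?s + T / real N)" using m(1,4) step by simp
    have "\<tau> < ?s + T / real N"
    proof (rule ccontr)
      assume "\<not> ?thesis"
      then have "\<omega> \<in> alive K (?s + T / real N)"
        using alive_antimono[OF \<omega>(1), of K \<tau> "?s + T / real N"] alive[of \<tau>] \<tau>R \<tau>0 \<tau>\<zeta> s0 T by auto
      then show False using na by simp
    qed
    moreover have "\<bar>a - b\<bar> < d" if "b < a + h" "a \<le> b" "h < d" for a b h :: real using that by linarith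
    ultimately have "\<bar>?s - \<tau>\<bar> < d" using s\<tau> elim(1) by blast
    then show ?case using d(2)[of ?s] s0 s\<tau> \<tau>lt m(2) by simp
  qed
  ultimately have "\<forall>\<^sub>F N in sequentially. f (max_weight K) - 1 \<le> V j N"
    by (auto elim!: eventually_mono)
  then show thesis using j(1) that by blast
qed

text \<open>The bad set is written without quotients, hence closed even where the total might
  vanish, and so has a first time. Capitalizations are still positive there, so the failure must be
  a weight that has reached \<open>1 - \<delta>\<close>.\<close>

lemma first_exit:
  assumes \<omega>: "regular \<omega>" and b: "0 \<le> t" "t \<le> T" "i < n" "\<not> (0 < X i t \<omega> \<and> \<mu> i t \<omega> < 1 - \<delta>)"
  obtains \<zeta> i0 where "0 < \<zeta>" "\<zeta> \<le> T" "\<And>s j. s \<in> {0..\<zeta>} \<Longrightarrow> j < n \<Longrightarrow> 0 < X j s \<omega>"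
    "\<And>s j. 0 \<le> s \<Longrightarrow> s < \<zeta> \<Longrightarrow> j < n \<Longrightarrow> \<mu> j s \<omega> < 1 - \<delta>" "i0 < n" "1 - \<delta> \<le> \<mu> i0 \<zeta> \<omega>"
proof -
  have c: "continuous_on {0..T} (\<lambda>s. X j s \<omega>)" if "j < n" for j
    by (rule continuous_on_subset[OF regular_X(1)[OF \<omega> that]]) auto
  define Bad where "Bad = (\<Union>j\<in>{..<n}. {s \<in> {0..T}. X j s \<omega> \<le> 0} \<union> {s \<in> {0..T}. (1 - \<delta>) * total_cap n X s \<omega> \<le> X j s \<omega>})"
  have cl: "closed Bad" unfolding Bad_def total_cap_def
    by (intro closed_UN closed_Un ballI continuous_on_closed_Collect_le continuous_intros c) auto
  have goodI: "0 < X j s \<omega> \<and> \<mu> j s \<omega> < 1 - \<delta>" if s: "s \<in> {0..T}" "s \<notin> Bad" and j: "j < n" for s j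
  proof -
    have X: "0 < X l s \<omega>" if "l < n" for l
    proof (rule ccontr)
      assume "\<not> ?thesis"
      then have "s \<in> Bad" unfolding Bad_def using s(1) that by (intro UN_I[of l]) auto
      then show False using s(2) by simp
    qed
    have "X j s \<omega> < (1 - \<delta>) * total_cap n X s \<omega>"
    proof (rule ccontr)
      assume "\<not> ?thesis"
      then have "s \<in> Bad" unfolding Bad_def using s(1) j by (intro UN_I[of j]) auto
      then show False using s(2) by simp
    qed
    then show ?thesis using X total_cap_pos[OF X] j by (simp add: mkt_weight_def pos_divide_less_eq)
  qed
  have "t \<in> Bad" using goodI[of t i] b by auto
  moreover have bdd: "bdd_below Bad" by (rule bdd_belowI[of _ 0]) (auto simp: Bad_def)
  ultimately have zB: "Inf Bad \<in> Bad" using cl by (intro closed_contains_Inf) auto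
  define \<zeta> where "\<zeta> = Inf Bad"
  have \<zeta>: "\<zeta> \<in> Bad" "\<zeta> \<in> {0..T}" using zB by (auto simp: \<zeta>_def Bad_def)
  have S0: "0 < total_cap n X 0 \<omega>" by (rule total_cap_pos) (use init regular_X(2)[OF \<omega>] in auto)
  have "0 \<notin> Bad"
  proof
    assume "0 \<in> Bad"
    then obtain j where j: "j < n" "X j 0 \<omega> \<le> 0 \<or> (1 - \<delta>) * total_cap n X 0 \<omega> \<le> X j 0 \<omega>" by (auto simp: Bad_def)
    moreover have "0 < X j 0 \<omega>" using init regular_X(2)[OF \<omega> j(1)] j by simp
    ultimately have "1 - \<delta> \<le> \<mu> j 0 \<omega>" using S0 by (simp add: mkt_weight_def pos_le_divide_eq)
    then show False using regular_weight_0[OF \<omega> j(1)] init_weight_range(2)[OF j(1)] by simp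
  qed
  then have z0: "0 < \<zeta>" using \<zeta> by (cases "\<zeta> = 0") auto
  have before: "0 < X j s \<omega> \<and> \<mu> j s \<omega> < 1 - \<delta>" if "0 \<le> s" "s < \<zeta>" "j < n" for s j
  proof (rule goodI)
    show "s \<notin> Bad" using cInf_lower[OF _ bdd, of s] that(2) by (auto simp: \<zeta>_def)
  qed (use that \<zeta> in auto)
  have Xz: "0 < X j \<zeta> \<omega>" if "j < n" for j
    by (rule positive_at_first_exit[OF \<omega> z0 before that])
  obtain i0 where i0: "i0 < n" "(1 - \<delta>) * total_cap n X \<zeta> \<omega> \<le> X i0 \<zeta> \<omega>"
    using \<zeta>(1) Xz by (auto simp: Bad_def) (meson not_le)
  show thesis
  proof (rule that[of \<zeta> i0])
    show "0 < X j s \<omega>" if "s \<in> {0..\<zeta>}" "j < n" for s j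
      using before[of s j] Xz[of j] that by (cases "s = \<zeta>") auto
    show "1 - \<delta> \<le> \<mu> i0 \<zeta> \<omega>"
      using i0 total_cap_pos[OF Xz] by (simp add: mkt_weight_def pos_le_divide_eq)
  qed (use z0 \<zeta> before i0 in auto)
qed

text \<open>The generator bound costs at most \<open>B * T\<close> in expectation, uniformly in
  \<open>K\<close>, while exit through ever higher levels drives \<open>f\<close> of some stopped
  weight to infinity. Fatou's lemma is applied twice, first as the grid is refined and then as the
  region grows.\<close>

lemma diverse:
  assumes y: "0 < y" "y < 1 - \<delta>"
    and inf: "(\<integral>\<^sup>+ x \<in> {y<..<1 - \<delta>}. ennreal (exp (integral {y..x} (\<lambda>z. A2 z * g z))) \<partial>lborel) = \<infinity>"
  shows "delta_diverse M n \<delta> X"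
proof -
  let ?b = "1 - \<delta>"
  obtain f f1 f2 B m D where B: "0 \<le> B" and C2: "C2_on f f1 f2" and f10: "\<forall>x. 0 \<le> f1 x" and f0: "\<forall>x<?b. 0 \<le> f x"
    and drift: "\<forall>i<n. drift_ge (- B) i (\<lambda>x. - f1 x) (\<lambda>x. - f2 x)" and m: "y \<le> m" "m < ?b" "0 \<le> D"
    and D: "\<forall>x. m \<le> x \<longrightarrow> x < ?b \<longrightarrow> exp (integral {y..x} (\<lambda>z. A2 z * g z)) \<le> D * f1 x"
    using upper_function[OF y] by blast
  have unbounded: "\<exists>x. m \<le> x \<and> x < ?b \<and> L < f x" for L
    by (rule upper_function_unbounded[OF y inf C2 f10 m D])
  have f: "\<And>x. x < ?b \<Longrightarrow> (f has_real_derivative f1 x) (at x)" using C2 by (simp add: C2_on_def)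
  have C2n: "C2_on (\<lambda>x. - f x) (\<lambda>x. - f1 x) (\<lambda>x. - f2 x)"
    using C2 unfolding C2_on_def by (auto intro!: derivative_eq_intros continuous_intros)
  have fm: "f x \<le> f z" if "x \<le> z" "z < ?b" for x z
  proof (rule DERIV_nonneg_imp_nondecreasing[where f=f, OF that(1)])
    fix w assume "x \<le> w" "w \<le> z"
    then show "\<exists>d. (f has_real_derivative d) (at w) \<and> 0 \<le> d" using f[of w] f10 that by auto
  qed
  have fc: "continuous_on {..<?b} f" using f by (intro continuous_at_imp_continuous_on ballI) (blast intro: DERIV_isCont)
  have "\<forall>\<^sub>F k in sequentially. 4 \<le> real k" using filterlim_real_sequentially by (auto simp: filterlim_at_top)
  then have "\<forall>\<^sub>F k in sequentially. 4 \<le> real k \<and> (\<forall>i\<in>{..<n}. init_weight i \<le> max_weight (real k))"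
    using eventually_init_weight_le by eventually_elim auto
  then obtain k0 where k0: "\<And>k. k0 \<le> k \<Longrightarrow> 4 \<le> real k \<and> (\<forall>i\<in>{..<n}. init_weight i \<le> max_weight (real k))"
    unfolding eventually_sequentially by blast
  define K where "K k = real (k0 + k)" for k
  have K: "4 \<le> K k" "\<And>i. i < n \<Longrightarrow> init_weight i \<le> max_weight (K k)" for k
    using k0[of "k0 + k"] by (auto simp: K_def)
  have upto: "AE \<omega> in M. \<forall>t. 0 \<le> t \<longrightarrow> t \<le> T \<longrightarrow> (\<forall>i<n. 0 < X i t \<omega> \<and> \<mu> i t \<omega> < ?b)" if T: "0 < T" for T
  proof -
    \<comment> \<open>Dynkin's inequality with error 1; probabilities are at most 1, so the time
      term is at most \<open>B * T\<close>. The bound does not involve \<open>k\<close>.\<close>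
    define C where "C i = f (init_weight i) + B * T + 1" for i
    define P where "P k i V \<longleftrightarrow> (\<forall>N. V N \<in> borel_measurable M) \<and>
      (\<forall>\<^sub>F N in sequentially. integrable M (V N) \<and> - C i \<le> expectation (V N)) \<and>
      (\<forall>N \<omega>. regular \<omega> \<longrightarrow> \<omega> \<in> space M \<longrightarrow> (\<exists>m\<le>N. V N \<omega> = - f (\<mu> i (real m * (T / real N)) \<omega>) \<and>
       \<mu> i (real m * (T / real N)) \<omega> \<le> max_weight (K k) \<and>
       (m = 0 \<or> \<omega> \<in> alive (K k) (real m * (T / real N))) \<and> (m < N \<longrightarrow> \<omega> \<notin> alive (K k) (real (Suc m) * (T / real N)))))"
      for k i and V :: "nat \<Rightarrow> 'a \<Rightarrow> real"
    have ex: "\<exists>V. P k i V" if i: "i < n" for k i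
    proof -
      obtain V :: "nat \<Rightarrow> 'a \<Rightarrow> real" where V: "\<And>N. V N \<in> borel_measurable M"
        "\<And>e. 0 < e \<Longrightarrow> \<forall>\<^sub>F N in sequentially. integrable M (V N) \<and>
          - f (init_weight i) + - B * (T / real N * (\<Sum>l<N. prob (alive (K k) (real l * (T / real N))))) - e \<le> expectation (V N)"
        "\<And>N \<omega>. regular \<omega> \<Longrightarrow> \<omega> \<in> space M \<Longrightarrow> \<exists>m\<le>N. V N \<omega> = - f (\<mu> i (real m * (T / real N)) \<omega>) \<and>
          \<mu> i (real m * (T / real N)) \<omega> \<le> max_weight (K k) \<and>
          (m = 0 \<or> \<omega> \<in> alive (K k) (real m * (T / real N))) \<and> (m < N \<longrightarrow> \<omega> \<notin> alive (K k) (real (Suc m) * (T / real N)))"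
        using dynkin_C2_on[OF C2n drift[rule_format, OF i] i K(1) K(2)[OF i] T] by blast
      have "\<forall>\<^sub>F N in sequentially. integrable M (V N) \<and> - C i \<le> expectation (V N)"
        using V(2)[OF zero_less_one] eventually_gt_at_top[of 0]
      proof eventually_elim
        case (elim N)
        have "(\<Sum>l<N. prob (alive (K k) (real l * (T / real N)))) \<le> real N * 1"
          using sum_bounded_above[of "{..<N}" "\<lambda>l. prob (alive (K k) (real l * (T / real N)))" 1] by simp
        then have "T / real N * (\<Sum>l<N. prob (alive (K k) (real l * (T / real N)))) \<le> T / real N * (real N * 1)"
          using T by (intro mult_left_mono) auto
        also have "\<dots> = T" using elim(2) by simp
        finally have "B * (T / real N * (\<Sum>l<N. prob (alive (K k) (real l * (T / real N))))) \<le> B * T"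
          using B by (intro mult_left_mono)
        then show ?case using elim(1) by (simp add: C_def)
      qed
      then show ?thesis using V(1,3) unfolding P_def by blast
    qed
    \<comment> \<open>Stopped values exist for each region and asset; they are fixed once, so that
      limits over \<open>N\<close> and \<open>k\<close> can be taken.\<close>
    define V where "V k i = (SOME V. P k i V)" for k i
    have V: "P k i (V k i)" if "i < n" for k i unfolding V_def by (rule someI_ex[OF ex[OF that]])
    have Vm: "V k i N \<in> borel_measurable M" if "i < n" for k i N using V[OF that] by (simp add: P_def)
    have VE: "\<forall>\<^sub>F N in sequentially. integrable M (V k i N) \<and> - C i \<le> expectation (V k i N)" if "i < n" for k i
      using V[OF that] by (simp add: P_def)
    have Vv: "\<exists>m\<le>N. V k i N \<omega> = - f (\<mu> i (real m * (T / real N)) \<omega>) \<and> \<mu> i (real m * (T / real N)) \<omega> \<le> max_weight (K k) \<and>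
       (m = 0 \<or> \<omega> \<in> alive (K k) (real m * (T / real N))) \<and> (m < N \<longrightarrow> \<omega> \<notin> alive (K k) (real (Suc m) * (T / real N)))"
      if "i < n" "regular \<omega>" "\<omega> \<in> space M" for k i N \<omega>
      using V[OF that(1)] that(2,3) unfolding P_def by blast
    \<comment> \<open>Which weight exits depends on the path, so all assets are summed; the terms
      \<open>- V k i N \<omega>\<close> are almost surely nonnegative because \<open>f\<close> is
      nonnegative below \<open>1 - \<delta>\<close>.\<close>
    define U where "U k N \<omega> = (\<Sum>i<n. ennreal (- V k i N \<omega>))" for k N \<omega>
    define u where "u k \<omega> = liminf (\<lambda>N. U k N \<omega>)" for k \<omega>
    define c where "c = (\<Sum>i<n. ennreal (C i))"
    have Um: "U k N \<in> borel_measurable M" for k N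
      unfolding U_def using Vm by (intro borel_measurable_sum measurable_compose[OF _ measurable_ennreal]) auto
    have um: "u k \<in> borel_measurable M" for k
      unfolding u_def by (intro borel_measurable_liminf Um)
    have UE: "\<forall>\<^sub>F N in sequentially. integral\<^sup>N M (U k N) \<le> c" for k
    proof -
      have "\<forall>\<^sub>F N in sequentially. \<forall>i\<in>{..<n}. (\<integral>\<^sup>+ \<omega>. ennreal (- V k i N \<omega>) \<partial>M) \<le> ennreal (C i)"
      proof (rule eventually_ball_finite[OF finite_lessThan], rule ballI)
        fix i assume "i \<in> {..<n}"
        then have i: "i < n" by simp
        show "\<forall>\<^sub>F N in sequentially. (\<integral>\<^sup>+ \<omega>. ennreal (- V k i N \<omega>) \<partial>M) \<le> ennreal (C i)"
          using VE[OF i, of k]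
        proof eventually_elim
          case (elim N)
          have "AE \<omega> in M. 0 \<le> - V k i N \<omega>"
            using AE_regular AE_space
          proof eventually_elim
            case (elim \<omega>)
            obtain m where "V k i N \<omega> = - f (\<mu> i (real m * (T / real N)) \<omega>)" "\<mu> i (real m * (T / real N)) \<omega> \<le> max_weight (K k)"
              using Vv[OF i elim, of N k] by blast
            then show ?case using f0 min_max_weight(3)[OF K(1)[of k]] by simp
          qed
          then have "(\<integral>\<^sup>+ \<omega>. ennreal (- V k i N \<omega>) \<partial>M) = ennreal (expectation (\<lambda>\<omega>. - V k i N \<omega>))"
            using elim by (intro nn_integral_eq_integral) auto
          also have "\<dots> \<le> ennreal (C i)" using elim by (intro ennreal_leI) simp
          finally show ?case .
        qed
      qed
      then show ?thesis
      proof eventually_elim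
        case (elim N)
        have "integral\<^sup>N M (U k N) = (\<Sum>i<n. \<integral>\<^sup>+ \<omega>. ennreal (- V k i N \<omega>) \<partial>M)"
          unfolding U_def using Vm by (intro nn_integral_sum measurable_compose[OF _ measurable_ennreal]) auto
        also have "\<dots> \<le> c" unfolding c_def using elim by (intro sum_mono) auto
        finally show ?case .
      qed
    qed
    have uE: "integral\<^sup>N M (u k) \<le> c" for k
    proof -
      have "integral\<^sup>N M (u k) \<le> liminf (\<lambda>N. integral\<^sup>N M (U k N))"
        unfolding u_def by (rule nn_integral_liminf[OF Um])
      also have "\<dots> \<le> liminf (\<lambda>N. c)" by (rule Liminf_mono[OF UE])
      finally show ?thesis by (simp add: Liminf_const)
    qed
    \<comment> \<open>The second limit, over growing regions; the same \<open>c\<close> bounds every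
      stage.\<close>
    have "(\<integral>\<^sup>+ \<omega>. liminf (\<lambda>k. u k \<omega>) \<partial>M) \<le> liminf (\<lambda>k. integral\<^sup>N M (u k))" by (rule nn_integral_liminf[OF um])
    also have "\<dots> \<le> liminf (\<lambda>k. c)" by (rule Liminf_mono) (use uE in auto)
    also have "\<dots> = c" by (simp add: Liminf_const)
    finally have "(\<integral>\<^sup>+ \<omega>. liminf (\<lambda>k. u k \<omega>) \<partial>M) \<le> c" .
    moreover have "c < \<infinity>" by (simp add: c_def)
    ultimately have "(\<integral>\<^sup>+ \<omega>. liminf (\<lambda>k. u k \<omega>) \<partial>M) \<noteq> \<infinity>" by (auto simp: top_unique)
    then have "AE \<omega> in M. liminf (\<lambda>k. u k \<omega>) \<noteq> \<infinity>"
      by (rule nn_integral_PInf_AE[OF borel_measurable_liminf[OF um]])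
    with AE_regular AE_space show ?thesis
    proof eventually_elim
      case (elim \<omega>)
      note \<omega> = elim(1,2)
      show ?case
      proof (rule ccontr)
        assume "\<not> ?thesis"
        then obtain t i where "0 \<le> t" "t \<le> T" "i < n" "\<not> (0 < X i t \<omega> \<and> \<mu> i t \<omega> < ?b)" by blast
        then obtain \<zeta> i0 where \<zeta>: "0 < \<zeta>" "\<zeta> \<le> T" "\<And>s j. s \<in> {0..\<zeta>} \<Longrightarrow> j < n \<Longrightarrow> 0 < X j s \<omega>"
          "\<And>s j. 0 \<le> s \<Longrightarrow> s < \<zeta> \<Longrightarrow> j < n \<Longrightarrow> \<mu> j s \<omega> < ?b" "i0 < n" "?b \<le> \<mu> i0 \<zeta> \<omega>"
          using first_exit[OF \<omega>(1)] by blast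
        have "\<forall>\<^sub>F k in sequentially. \<forall>j\<in>{..<n}. \<forall>s\<in>{0..\<zeta>}. 1 / real k \<le> X j s \<omega> \<and> X j s \<omega> \<le> real k"
          by (rule eventually_in_region[OF \<omega>(1)]) (use \<zeta> in auto)
        then obtain k1 where k1: "\<And>k j s. k1 \<le> k \<Longrightarrow> j < n \<Longrightarrow> s \<in> {0..\<zeta>} \<Longrightarrow> 1 / real k \<le> X j s \<omega> \<and> X j s \<omega> \<le> real k"
          unfolding eventually_sequentially by blast
        have uge: "ennreal (f (max_weight (K k)) - 1) \<le> u k \<omega>" if k: "k1 \<le> k" for k
        proof -
          obtain j where j: "j < n" "\<forall>\<^sub>F N in sequentially. f (max_weight (K k)) - 1 \<le> - V k j N \<omega>"
          proof (rule exit_value[OF \<omega> \<zeta> K(1) K(2) _ fc fm, of k "\<lambda>i N. - V k i N \<omega>"])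
            show "1 / K k \<le> X j s \<omega> \<and> X j s \<omega> \<le> K k" if "s \<in> {0..\<zeta>}" "j < n" for s j
              unfolding K_def using k1[of "k0 + k" j s] that k by simp
            show "\<exists>m\<le>N. - V k i N \<omega> = f (\<mu> i (real m * (T / real N)) \<omega>) \<and>
              (m = 0 \<or> \<omega> \<in> alive (K k) (real m * (T / real N))) \<and> (m < N \<longrightarrow> \<omega> \<notin> alive (K k) (real (Suc m) * (T / real N)))"
              if "i < n" for i N
              using Vv[OF that \<omega>, of N k] by force
          qed auto
          have "\<forall>\<^sub>F N in sequentially. ennreal (f (max_weight (K k)) - 1) \<le> U k N \<omega>"
            using j(2)
          proof eventually_elim
            case (elim N)
            then have "ennreal (f (max_weight (K k)) - 1) \<le> ennreal (- V k j N \<omega>)" by (rule ennreal_leI)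
            also have "\<dots> \<le> U k N \<omega>" unfolding U_def using j(1) by (intro member_le_sum) auto
            finally show ?case .
          qed
          then show ?thesis unfolding u_def by (rule Liminf_bounded)
        qed
        \<comment> \<open>The levels \<open>max_weight (K k)\<close> increase to
          \<open>1 - \<delta>\<close>, below which \<open>f\<close> is monotone and
          unbounded.\<close>
        have large: "ennreal L \<le> liminf (\<lambda>k. u k \<omega>)" for L
        proof (rule Liminf_bounded)
          obtain x where x: "m \<le> x" "x < ?b" "L + 1 < f x" using unbounded by blast
          have "\<forall>\<^sub>F k in sequentially. 1 / real k < ?b - x"
            using x(2) by (intro order_tendstoD(2)[OF lim_const_over_n]) simp
          then obtain k2 where k2: "\<And>k. k2 \<le> k \<Longrightarrow> 1 / real k < ?b - x" unfolding eventually_sequentially by blast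
          show "\<forall>\<^sub>F k in sequentially. ennreal L \<le> u k \<omega>"
            unfolding eventually_sequentially
          proof (intro exI allI impI)
            fix k assume k: "max k1 k2 \<le> k"
            have "1 / real (k0 + k) < ?b - x" using k by (intro k2) simp
            then have "x \<le> max_weight (K k)" by (simp add: max_weight_def K_def)
            then have "f x \<le> f (max_weight (K k))" using min_max_weight(3)[OF K(1)] by (rule fm)
            then have "ennreal L \<le> ennreal (f (max_weight (K k)) - 1)" using x(3) by (intro ennreal_leI) simp
            also have "\<dots> \<le> u k \<omega>" using k by (intro uge) simp
            finally show "ennreal L \<le> u k \<omega>" .
          qed
        qed
        obtain r where r: "0 \<le> r" "liminf (\<lambda>k. u k \<omega>) = ennreal r"
          using elim(3) by (cases "liminf (\<lambda>k. u k \<omega>)") auto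
        then show False using large[of "r + 1"] by simp
      qed
    qed
  qed
  \<comment> \<open>Countably many horizons exhaust all times outside a single null set.\<close>
  have "AE \<omega> in M. \<forall>N::nat. \<forall>t. 0 \<le> t \<longrightarrow> t \<le> real (Suc N) \<longrightarrow> (\<forall>i<n. 0 < X i t \<omega> \<and> \<mu> i t \<omega> < ?b)"
    unfolding AE_all_countable by (intro allI upto) simp
  then show ?thesis
    unfolding delta_diverse_def
  proof eventually_elim
    case (elim \<omega>)
    show ?case
    proof (intro allI impI)
      fix t :: real and i assume t: "0 \<le> t" "i < n"
      obtain N :: nat where "t \<le> real N" using real_arch_simple by blast
      then have "t \<le> real (Suc N)" by simp
      then show "0 < X i t \<omega> \<and> \<mu> i t \<omega> < ?b" using elim t by blast
    qed
  qed
qed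

end

theorem theorem2:
  fixes M :: "'a measure" and n :: nat and \<delta> :: real and g :: "real \<Rightarrow> real"
    and W X :: "nat \<Rightarrow> real \<Rightarrow> 'a \<Rightarrow> real" and x0 :: "nat \<Rightarrow> real" and y0 :: real
  assumes n: "n \<ge> 2"
    and delta: "0 < \<delta>" "\<delta> < 1 / 2"
    and adm: "admissible \<delta> g"
    and liminf: "Liminf (at_right 0) (\<lambda>x. ereal (x * g x)) > -\<infinity>"
    and limsup: "Limsup (at_right 0) (\<lambda>x. ereal (x * g x)) < 0"
    and BM: "std_BM M n W"
    and init: "\<forall>i<n. 0 < x0 i \<and> x0 i / (\<Sum>j<n. x0 j) < 1 - \<delta>"
    and model: "market_model M n \<delta> g W x0 X"
    and y0: "0 < y0" "y0 < 1 - \<delta>"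
  shows "((\<integral>\<^sup>+ y \<in> {y0<..<1 - \<delta>}. ennreal (exp (integral {y0..y} (\<lambda>z. A1 n z * g z))) \<partial>lborel) < \<infinity>
            \<longrightarrow> \<not> delta_diverse M n \<delta> X)
       \<and> ((\<integral>\<^sup>+ y \<in> {y0<..<1 - \<delta>}. ennreal (exp (integral {y0..y} (\<lambda>z. A2 z * g z))) \<partial>lborel) = \<infinity>
            \<longrightarrow> delta_diverse M n \<delta> X)"
proof -
  interpret prob_space M using BM by (simp add: std_BM_def)
  interpret market_limits M n W \<delta> g x0 X
    by unfold_locales (fact BM n delta adm init model liminf limsup)+
  show ?thesis using not_diverse[OF y0] diverse[OF y0] by blast
qed

end
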